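(* Let $n\ge 1$ and $m\ge 1$ be integers, let $0<\alpha<n$ and $0<\beta<1$ with $0<\alpha+\beta<n$, and let $\Omega\in L^s(S^{n-1})$ $(s>1)$ be homogeneous of degree zero on $\mathbb{R}^n$. Let $1<s'<p<n/(\alpha+\beta)$ where $1/s+1/s'=1$, let $1/q=1/p-(\alpha+\beta)/n$, let $0<\kappa<p/q$, and let $w$ be a weight with $w^{s'}\in A(p/s',q/s')$. Let $A$ be a function on $\mathbb{R}^n$ with $D^{\gamma}A\in\dot{\Lambda}_{\beta}(\mathbb{R}^n)$ for every multi-index $\gamma$ with $|\gamma|=m-1$. Then there is a constant $C>0$, independent of $f$ and $A$, such that for all $f\in L^{p,\kappa}(w^p,w^q)$ $$\|T_{\Omega,\alpha}^{A}f\|_{L^{q,\kappa q/p}(w^q)}\leq C\sum_{|\gamma|=m-1}\|D^{\gamma}A\|_{\dot{\Lambda}_{\beta}}\,\|f\|_{L^{p,\kappa}(w^p,w^q)}$$ and $$\|M_{\Omega,\alpha}^{A}f\|_{L^{q,\kappa q/p}(w^q)}\leq C\sum_{|\gamma|=m-1}\|D^{\gamma}A\|_{\dot{\Lambda}_{\beta}}\,\|f\|_{L^{p,\kappa}(w^p,w^q)}.$$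
   Context: A weight is a locally integrable function on $\mathbb{R}^n$ with values in $(0,\infty)$ almost everywhere; for a weight $v$ and measurable $E$, $v(E)=\int_E v(x)\,dx$ (so $w^q(B)=\int_B w(x)^q dx$). $\Omega$ homogeneous of degree zero means $\Omega(\lambda x)=\Omega(x)$ for $\lambda>0$, $x\ne0$. Weighted Morrey spaces: for $1\le p<\infty$, $0<\kappa<1$ and weights $u,v$, $L^{p,\kappa}(u,v)$ is the space of $f$ with $$\|f\|_{L^{p,\kappa}(u,v)}=\sup_B\Big(\frac{1}{v(B)^{\kappa}}\int_B|f(x)|^pu(x)\,dx\Big)^{1/p}<\infty,$$ the supremum over all balls $B\subset\mathbb{R}^n$; $L^{p,\kappa}(u)=L^{p,\kappa}(u,u)$. Class $A(p,q)$, $1<p<q<\infty$: $w\in A(p,q)$ if there is $C>1$ such that for every ball $B$ $$\Big(\frac{1}{|B|}\int_Bw^q\,dx\Big)^{1/q}\Big(\frac{1}{|B|}\int_Bw^{-p/(p-1)}\,dx\Big)^{(p-1)/p}\leq C.$$ Lipschitz space, $0<\beta<1$: $\dot{\Lambda}_\beta(\mathbb{R}^n)$ is the set of $g$ with $|g(x)-g(y)|\le C|x-y|^\beta$ for all $x,y$; the smallest such $C$ is $\|g\|_{\dot{\Lambda}_\beta}$. Taylor remainder: $R_m(A;x,y)=A(x)-\sum_{|\gamma|<m}\frac{1}{\gamma!}D^{\gamma}A(y)(x-y)^{\gamma}$, with the usual multi-index notation. Operators: $$T_{\Omega,\alpha}^{A}f(x)=\int_{\mathbb{R}^n}\frac{\Omega(x-y)}{|x-y|^{n-\alpha+m-1}}R_m(A;x,y)f(y)\,dy,$$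 $$M_{\Omega,\alpha}^{A}f(x)=\sup_{r>0}\frac{1}{r^{n-\alpha+m-1}}\int_{|x-y|<r}|\Omega(x-y)R_m(A;x,y)f(y)|\,dy.$$ *)

theory Defs
  imports "HOL-Analysis.Analysis"
begin

subsection \<open>Weights, Muckenhoupt classes and weighted Morrey spaces\<close>

definition weight :: "(real ^ 'n \<Rightarrow> real) \<Rightarrow> bool" where
  "weight w \<longleftrightarrow>
     (\<forall>K. compact K \<longrightarrow> set_integrable lebesgue K w) \<and> (AE x in lebesgue. 0 < w x)"

text \<open>For a function that is positive almost everywhere, neither factor of the \<open>A(p,q)\<close>
  product can vanish, so its boundedness forces both integrals to be finite. The
  integrability conditions state this explicitly, since the Bochner integral of a
  non-integrable function is 0.\<close>

definition class_A :: "real \<Rightarrow> real \<Rightarrow> (real ^ 'n \<Rightarrow> real) set" where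
  "class_A p q = {w. \<exists>C>1. \<forall>a. \<forall>r>0.
     set_integrable lebesgue (ball a r) (\<lambda>x. w x powr q) \<and>
     set_integrable lebesgue (ball a r) (\<lambda>x. w x powr (- (p / (p - 1)))) \<and>
     (1 / measure lebesgue (ball a r) *
        (LINT x:ball a r|lebesgue. w x powr q)) powr (1 / q) *
     (1 / measure lebesgue (ball a r) *
        (LINT x:ball a r|lebesgue. w x powr (- (p / (p - 1))))) powr ((p - 1) / p) \<le> C}"

text \<open>Real powers on \<open>[0,\<infinity>]\<close>; only used with exponent \<open>a > 0\<close>.\<close>

definition ennreal_powr :: "ennreal \<Rightarrow> real \<Rightarrow> ennreal" where
  "ennreal_powr x a = (if x = \<infinity> then \<infinity> else ennreal (enn2real x powr a))"

text \<open>The Morrey norm takes the modulus of the function as a \<open>[0,\<infinity>]\<close>-valued argument,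
  so that it also applies to a maximal function, which may be infinite at some points.\<close>

definition morrey_norm ::
  "real \<Rightarrow> real \<Rightarrow> (real ^ 'n \<Rightarrow> real) \<Rightarrow> (real ^ 'n \<Rightarrow> real) \<Rightarrow> (real ^ 'n \<Rightarrow> ennreal) \<Rightarrow> ennreal" where
  "morrey_norm p \<kappa> u v F =
     (SUP B\<in>{ball a r | a r. 0 < r}.
        ennreal_powr
          ((\<integral>\<^sup>+ x\<in>B. ennreal_powr (F x) p * ennreal (u x) \<partial>lebesgue) /
           ennreal_powr (\<integral>\<^sup>+ x\<in>B. ennreal (v x) \<partial>lebesgue) \<kappa>)
          (1 / p))"

definition morrey_space ::
  "real \<Rightarrow> real \<Rightarrow> (real ^ 'n \<Rightarrow> real) \<Rightarrow> (real ^ 'n \<Rightarrow> real) \<Rightarrow> (real ^ 'n \<Rightarrow> complex) set" where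
  "morrey_space p \<kappa> u v =
     {f. f \<in> borel_measurable lebesgue \<and>
         morrey_norm p \<kappa> u v (\<lambda>x. ennreal (norm (f x))) < \<infinity>}"

subsection \<open>Homogeneous kernels and the space \<open>L\<^sup>s\<close> of the unit sphere\<close>

definition homogeneous_deg0 :: "(real ^ 'n \<Rightarrow> complex) \<Rightarrow> bool" where
  "homogeneous_deg0 \<Omega> \<longleftrightarrow> (\<forall>c>0. \<forall>x. x \<noteq> 0 \<longrightarrow> \<Omega> (c *\<^sub>R x) = \<Omega> x)"

text \<open>Surface measure on the unit sphere in polar-coordinate form: a Borel set \<open>E\<close> has
  measure \<open>n\<close> times the volume of the cone of all \<open>x\<close> with \<open>0 < \<bar>x\<bar> < 1\<close> and \<open>x/\<bar>x\<bar> \<in> E\<close>.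
  When \<open>n = 1\<close> this is counting measure on the two points.\<close>

definition sphere_measure :: "(real ^ 'n) measure" where
  "sphere_measure =
     scale_measure (of_nat CARD('n))
       (distr (restrict_space lborel (ball 0 1 - {0}))
              (restrict_space borel (sphere 0 1)) sgn)"

definition Ls_sphere :: "real \<Rightarrow> (real ^ 'n \<Rightarrow> complex) set" where
  "Ls_sphere s =
     {\<Omega>. \<Omega> \<in> borel_measurable (completion sphere_measure) \<and>
         integrable (completion sphere_measure) (\<lambda>x. norm (\<Omega> x) powr s)}"

subsection \<open>Partial derivatives, Taylor remainders and Lipschitz spaces\<close>

definition partial_deriv :: "'n \<Rightarrow> (real ^ 'n \<Rightarrow> complex) \<Rightarrow> real ^ 'n \<Rightarrow> complex" where
  "partial_deriv i g x = vector_derivative (\<lambda>t. g (x + t *\<^sub>R axis i 1)) (at 0)"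

primrec C_k :: "nat \<Rightarrow> (real ^ 'n \<Rightarrow> complex) \<Rightarrow> bool" where
  "C_k 0 g \<longleftrightarrow> continuous_on UNIV g"
| "C_k (Suc k) g \<longleftrightarrow> continuous_on UNIV g \<and>
     (\<forall>i. (\<forall>x. (\<lambda>t. g (x + t *\<^sub>R axis i 1)) differentiable (at 0)) \<and> C_k k (partial_deriv i g))"

definition mi_order :: "('n::finite \<Rightarrow> nat) \<Rightarrow> nat" where
  "mi_order \<gamma> = (\<Sum>i\<in>UNIV. \<gamma> i)"

definition mi_fact :: "('n::finite \<Rightarrow> nat) \<Rightarrow> real" where
  "mi_fact \<gamma> = (\<Prod>i\<in>UNIV. fact (\<gamma> i))"

definition mi_power :: "real ^ 'n \<Rightarrow> ('n \<Rightarrow> nat) \<Rightarrow> real" where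
  "mi_power z \<gamma> = (\<Prod>i\<in>UNIV. (z $ i) ^ \<gamma> i)"

text \<open>The index type carries no order, so some sequence of directions containing each \<open>i\<close>
  exactly \<open>\<gamma> i\<close> times is chosen; for functions of class \<open>C_k\<close> with \<open>k \<ge> \<bar>\<gamma>\<bar>\<close> the result
  does not depend on the choice.\<close>

definition mi_deriv :: "('n \<Rightarrow> nat) \<Rightarrow> (real ^ 'n \<Rightarrow> complex) \<Rightarrow> real ^ 'n \<Rightarrow> complex" where
  "mi_deriv \<gamma> = foldr partial_deriv (SOME is. \<forall>i. count_list is i = \<gamma> i)"

definition taylor_remainder ::
  "nat \<Rightarrow> (real ^ 'n \<Rightarrow> complex) \<Rightarrow> real ^ 'n \<Rightarrow> real ^ 'n \<Rightarrow> complex" where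
  "taylor_remainder m A x y =
     A x - (\<Sum>\<gamma> | mi_order \<gamma> < m. (mi_power (x - y) \<gamma> / mi_fact \<gamma>) *\<^sub>R mi_deriv \<gamma> A y)"

definition lip_space :: "real \<Rightarrow> (real ^ 'n \<Rightarrow> complex) set" where
  "lip_space \<beta> = {g. \<exists>C. \<forall>x y. norm (g x - g y) \<le> C * norm (x - y) powr \<beta>}"

definition lip_norm :: "real \<Rightarrow> (real ^ 'n \<Rightarrow> complex) \<Rightarrow> real" where
  "lip_norm \<beta> g = Inf {C. \<forall>x y. norm (g x - g y) \<le> C * norm (x - y) powr \<beta>}"

subsection \<open>The operators\<close>

definition T_kernel ::
  "(real ^ 'n \<Rightarrow> complex) \<Rightarrow> real \<Rightarrow> nat \<Rightarrow> (real ^ 'n \<Rightarrow> complex) \<Rightarrow> real ^ 'n \<Rightarrow> real ^ 'n \<Rightarrow> complex" where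
  "T_kernel \<Omega> \<alpha> m A x y =
     \<Omega> (x - y) / of_real (norm (x - y) powr (real CARD('n) - \<alpha> + real m - 1)) *
     taylor_remainder m A x y"

definition T_op ::
  "(real ^ 'n \<Rightarrow> complex) \<Rightarrow> real \<Rightarrow> nat \<Rightarrow> (real ^ 'n \<Rightarrow> complex) \<Rightarrow>
   (real ^ 'n \<Rightarrow> complex) \<Rightarrow> real ^ 'n \<Rightarrow> complex" where
  "T_op \<Omega> \<alpha> m A f x = (LINT y|lebesgue. T_kernel \<Omega> \<alpha> m A x y * f y)"

definition M_op ::
  "(real ^ 'n \<Rightarrow> complex) \<Rightarrow> real \<Rightarrow> nat \<Rightarrow> (real ^ 'n \<Rightarrow> complex) \<Rightarrow>
   (real ^ 'n \<Rightarrow> complex) \<Rightarrow> real ^ 'n \<Rightarrow> ennreal" where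
  "M_op \<Omega> \<alpha> m A f x =
     (SUP r\<in>{0<..}. ennreal (1 / r powr (real CARD('n) - \<alpha> + real m - 1)) *
        (\<integral>\<^sup>+ y\<in>ball x r. ennreal (norm (\<Omega> (x - y) * taylor_remainder m A x y * f y)) \<partial>lebesgue))"

end

theory Submission
  imports Defs
begin

text \<open>A Taylor estimate gives \<open>\<bar>R\<^sub>m(A;x,y)\<bar> \<le> C * L * \<bar>x - y\<bar> ^ (m - 1 + \<beta>)\<close>, where \<open>L\<close> is the
  sum of the Lipschitz norms, so both operators are dominated pointwise by \<open>L\<close> times the rough fractional
  integral of order \<open>d = \<alpha> + \<beta>\<close> of \<open>\<bar>f\<bar>\<close>. By Hoelder's inequality its part over the annulus of radius
  \<open>r\<close> about \<open>x\<close> is at most \<open>t(x,r)\<close>, a constant times \<open>r ^ d\<close> times the \<open>L\<close>-\<open>s'\<close> average of \<open>f\<close>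
  over \<open>B(x,r)\<close>.

  Put \<open>u\<close> for the \<open>q\<close>-th power of \<open>w\<close>, let \<open>\<sigma>\<close> be its dual weight, and \<open>V = u(B(x,r))\<close>. The Muckenhoupt
  condition yields two bounds: \<open>t(x,r)\<close> is at most the norm of \<open>f\<close> times \<open>V\<close> to the power \<open>- 1/q\<close>, and also
  at most \<open>N(x)\<close> times \<open>V\<close> to the power \<open>1/p - 1/q\<close>. Here \<open>N\<close> is a composition of the maximal functions
  of the measures \<open>u\<close> and \<open>\<sigma>\<close> (Lerner's trick). It is bounded from \<open>L\<^sup>p\<close> with weight \<open>w\<^sup>p\<close> to \<open>L\<^sup>p\<close>
  with weight \<open>u\<close>, because the condition also makes both measures doubling. Reverse doubling makes
  the sums over dyadic radii geometric, and Hedberg's choice of the splitting radius gives the strong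
  \<open>(p,q)\<close> bound without the open-endedness of the Muckenhoupt classes. For the Morrey norm over a ball
  \<open>B\<close>, the strong bound handles \<open>f\<close> on \<open>2B\<close>, and the first of the two bounds handles the rest.\<close>

section \<open>Powers on the extended nonnegative reals\<close>

text \<open>Since the kernel is only in \<open>L\<^sup>s\<close>, Hoelder's inequality leaves
  averages of order \<open>s'\<close>, and the natural exponents are \<open>p / s'\<close> and
  \<open>q / s'\<close>; this is why the hypothesis concerns the \<open>s'\<close>-th power of
  \<open>w\<close>. The signs of the powers of \<open>V\<close> in the two bounds decide their
  roles. The exponent \<open>1/p - 1/q\<close> is positive, so the bound by \<open>N\<close> sums
  over shrinking radii. The exponent \<open>- 1/q\<close>, which becomes
  \<open>\<kappa>/p - 1/q\<close> for Morrey data and stays negative because \<kappa> <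
  \<open>p / q\<close>, sums over growing radii. A Morrey function need not lie in a global weighted
  \<open>L\<^sup>p\<close> space, and the singular integral is not known to converge beforehand. The
  estimates are therefore proved for nonnegative integrands with values in [0, \<infinity>], and
  convergence almost everywhere is read off from the finished bound. The given weight, kernel and
  function are merely Lebesgue measurable, whereas Fubini and the measures \<open>u\<close> and
  \<open>\<sigma>\<close> live on Borel sets, so Borel representatives stand in for all
  three.\<close>

notation ennreal_powr (infixr "powe" 80)

lemma powe_ennreal [simp]: "0 \<le> x \<Longrightarrow> ennreal x powe a = ennreal (x powr a)"
  by (simp add: ennreal_powr_def)

lemma powe_top [simp]: "top powe a = top"
  by (simp add: ennreal_powr_def)

lemma powe_zero [simp]: "0 powe a = 0"
  by (simp add: ennreal_powr_def)

lemma powe_one [simp]: "x powe 1 = x"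
  by (cases x) auto

lemma powe_eq_0_iff [simp]: "x powe a = 0 \<longleftrightarrow> x = 0"
  by (cases x) auto

lemma powe_eq_top_iff [simp]: "x powe a = top \<longleftrightarrow> x = top"
  by (cases x) auto

lemma powe_less_top_iff [simp]: "x powe a < top \<longleftrightarrow> x < top"
  by (cases x) auto

lemma powe_mono: "0 \<le> a \<Longrightarrow> x \<le> y \<Longrightarrow> x powe a \<le> y powe a"
  by (cases x; cases y) (auto intro!: ennreal_leI powr_mono2 simp: top_unique)

lemma powe_mult: "(x * y) powe a = x powe a * y powe a"
  by (cases x; cases y)
     (auto simp: powr_mult ennreal_mult_top ennreal_top_mult simp flip: ennreal_mult)

lemma powe_powe: "(x powe a) powe b = x powe (a * b)"
  by (cases x) (auto simp: powr_powr)

text \<open>With \<open>0 powe a = 0\<close> and \<open>top powe a = top\<close> for every real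
  \<open>a\<close>, whatever its sign, both sides agree at 0 and at infinity. This is a rule of the
  convention, not of the usual extended powers with negative exponents.\<close>

lemma powe_add: "x powe (a + b) = x powe a * x powe b"
  by (cases x) (auto simp: powr_add ennreal_mult)

lemma powe_le_iff: "0 < a \<Longrightarrow> x powe a \<le> y \<longleftrightarrow> x \<le> y powe (1 / a)"
  using powe_mono[of a x "y powe (1/a)"] powe_mono[of "1/a" "x powe a" y] by (auto simp: powe_powe)

lemma measurable_powe [measurable]:
  assumes [measurable]: "f \<in> borel_measurable M"
  shows "(\<lambda>x. f x powe a) \<in> borel_measurable M"
  unfolding ennreal_powr_def by measurable

text \<open>Passing through the maximum of \<open>x\<close> and \<open>y\<close> treats exponents
  below and above 1 alike.\<close>

lemma powe_sum_le:
  assumes "0 < a"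
  shows "(x + y) powe a \<le> ennreal (2 powr a) * (x powe a + y powe a)"
proof -
  have "(x + y) powe a \<le> (ennreal 2 * max x y) powe a"
    using assms
    by (intro powe_mono) (auto simp: max_def mult_2 add_mono)
  also have "\<dots> = ennreal (2 powr a) * max x y powe a"
    by (simp add: powe_mult del: ennreal_numeral)
  also have "max x y powe a \<le> x powe a + y powe a"
    by (auto simp: max_def)
  finally show ?thesis by (simp add: mult_left_mono)
qed

lemma powe_young:
  assumes t: "0 < t" "t < 1"
  shows "x powe t * y powe (1 - t) \<le> ennreal t * x + ennreal (1 - t) * y"
proof (cases "x = 0 \<or> y = 0 \<or> x = top \<or> y = top")
  case True
  then show ?thesis using t by (auto simp: ennreal_mult_top ennreal_top_mult)
next
  case False
  then obtain a b where ab: "x = ennreal a" "y = ennreal b" "0 < a" "0 < b"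
    by (cases x; cases y) (auto simp: less_le)
  then show ?thesis
    using Youngs_inequality_0[of t "1-t" a b] t
    by (auto simp flip: ennreal_mult ennreal_plus simp del: ennreal_minus intro!: ennreal_leI)
qed

text \<open>With the exponents on the integrands, an application only has to exhibit a function as a
  weighted geometric mean.\<close>

lemma nn_integral_Hoelder:
  assumes t: "0 < t" "t < 1"
    and [measurable]: "F \<in> borel_measurable M" "G \<in> borel_measurable M"
  shows "(\<integral>\<^sup>+x. F x powe t * G x powe (1 - t) \<partial>M) \<le>
    (\<integral>\<^sup>+x. F x \<partial>M) powe t * (\<integral>\<^sup>+x. G x \<partial>M) powe (1 - t)"
proof -
  define X where "X = (\<integral>\<^sup>+x. F x \<partial>M)"
  define Y where "Y = (\<integral>\<^sup>+x. G x \<partial>M)"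
  consider "X = 0" | "Y = 0" | "X \<noteq> 0 \<and> Y \<noteq> 0 \<and> (X = top \<or> Y = top)"
    | x y where "X = ennreal x" "0 < x" "Y = ennreal y" "0 < y"
    by (cases X; cases Y) (auto simp: less_le)
  then show ?thesis
  proof cases
    case 1
    then have "AE x in M. F x = 0"
      unfolding X_def by (subst (asm) nn_integral_0_iff_AE) auto
    then have "(\<integral>\<^sup>+x. F x powe t * G x powe (1 - t) \<partial>M) = 0"
      by (subst nn_integral_0_iff_AE) (auto elim: eventually_mono)
    then show ?thesis by simp
  next
    case 2
    then have "AE x in M. G x = 0"
      unfolding Y_def by (subst (asm) nn_integral_0_iff_AE) auto
    then have "(\<integral>\<^sup>+x. F x powe t * G x powe (1 - t) \<partial>M) = 0"
      by (subst nn_integral_0_iff_AE) (auto elim: eventually_mono)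
    then show ?thesis by simp
  next
    \<comment> \<open>Zero integrals had to be separated because \<open>0 * top = 0\<close>; here
      the right-hand side is infinite.\<close>
    case 3
    then have "X powe t * Y powe (1 - t) = top"
      by (auto simp: ennreal_mult_eq_top_iff)
    then show ?thesis by (simp add: X_def Y_def)
  next
    case 4
    \<comment> \<open>Young's inequality is applied to \<open>F / x\<close> and
      \<open>G / y\<close>, both of integral 1; the two terms integrate to \<open>t\<close> and
      \<open>1 - t\<close>, and \<open>c\<close> undoes the normalisation.\<close>
    define c where "c = ennreal (x powr t * y powr (1 - t))"
    have *: "F z powe t * G z powe (1 - t) \<le>
        c * (ennreal (t / x) * F z + ennreal ((1 - t) / y) * G z)" for z
    proof -
      have "F z = ennreal x * (ennreal (1/x) * F z)"  "G z = ennreal y * (ennreal (1/y) * G z)"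
        using 4 by (simp_all flip: mult.assoc ennreal_mult)
      then have "F z powe t * G z powe (1 - t) =
         ennreal (x powr t) * (ennreal (1/x) * F z) powe t *
         (ennreal (y powr (1-t)) * (ennreal (1/y) * G z) powe (1 - t))"
        using 4 by (metis powe_mult powe_ennreal less_imp_le)
      also have "\<dots> = c * ((ennreal (1/x) * F z) powe t * (ennreal (1/y) * G z) powe (1 - t))"
        by (simp add: c_def ennreal_mult ac_simps)
      also have "\<dots> \<le> c * (ennreal t * (ennreal (1/x) * F z) + ennreal (1-t) * (ennreal (1/y) * G z))"
        by (intro mult_left_mono powe_young t) auto
      finally show ?thesis
        using t 4 by (simp add: mult.assoc[symmetric] flip: ennreal_mult)
    qed
    have "(\<integral>\<^sup>+x. F x powe t * G x powe (1 - t) \<partial>M) \<le>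
        (\<integral>\<^sup>+z. c * (ennreal (t / x) * F z + ennreal ((1 - t) / y) * G z) \<partial>M)"
      by (intro nn_integral_mono *)
    also have "\<dots> = c * (ennreal (t / x) * X + ennreal ((1 - t) / y) * Y)"
      by (simp add: nn_integral_cmult nn_integral_add X_def Y_def)
    also have "\<dots> = c"
      using 4 t by (simp flip: ennreal_mult ennreal_plus)
    finally show ?thesis
      using 4 unfolding X_def[symmetric] Y_def[symmetric] c_def by (simp add: ennreal_mult)
  qed
qed

section \<open>The maximal theorem for doubling measures\<close>

text \<open>The layer-cake formula for a single value \<open>F\<close>. Applied at each point and
  combined with Fubini, it turns bounds on superlevel sets into integral bounds.\<close>

lemma nn_integral_layer:
  fixes F :: ennreal
  assumes a: "0 < a"
  shows "(\<integral>\<^sup>+l. ennreal (a * l powr (a - 1)) * indicator {l. 0 < l \<and> ennreal l < F} l \<partial>lborel) = F powe a"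
proof -
  have fin: "(\<integral>\<^sup>+l. ennreal (a * l powr (a - 1)) * indicator {0<..<c} l \<partial>lborel) = ennreal (c powr a)"
    if c: "0 \<le> c" for c :: real
  proof -
    have "((\<lambda>l. a * l powr (a - 1)) has_integral (a * (c powr a / a))) {0..c}"
      using has_integral_powr_from_0[of "a - 1" c] a c by (intro has_integral_mult_right) simp
    from nn_integral_has_integral_lebesgue'[OF _ this] a
    have "(\<integral>\<^sup>+l. ennreal (a * l powr (a - 1)) * indicator {0..c} l \<partial>lborel) = ennreal (c powr a)"
      by simp
    moreover have "AE l in lborel. l \<noteq> 0 \<and> l \<noteq> c"
      using AE_lborel_singleton[of 0] AE_lborel_singleton[of c] by (rule AE_conjI)
    then have "AE l in lborel. ennreal (a * l powr (a - 1)) * indicator {0..c} l =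
       ennreal (a * l powr (a - 1)) * indicator {0<..<c} l"
      by (rule eventually_mono) (auto simp: indicator_def)
    then have "(\<integral>\<^sup>+l. ennreal (a * l powr (a - 1)) * indicator {0..c} l \<partial>lborel) =
       (\<integral>\<^sup>+l. ennreal (a * l powr (a - 1)) * indicator {0<..<c} l \<partial>lborel)"
      by (rule nn_integral_cong_AE)
    ultimately show ?thesis by simp
  qed
  show ?thesis
  proof (cases F)
    case (real c)
    have "{l. 0 < l \<and> ennreal l < F} = {0<..<c}"
      using real by (auto simp: ennreal_less_iff)
    then show ?thesis using fin[of c] real by simp
  next
    case top
    have "ennreal x \<le> (\<integral>\<^sup>+l. ennreal (a * l powr (a - 1)) * indicator {l. 0 < l \<and> ennreal l < F} l \<partial>lborel)"
      if x: "0 \<le> x" for x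
    proof -
      have "ennreal x = ennreal ((x powr (1/a)) powr a)"
        using a x by (simp add: powr_powr)
      also have "\<dots> = (\<integral>\<^sup>+l. ennreal (a * l powr (a - 1)) * indicator {0<..<x powr (1/a)} l \<partial>lborel)"
        by (simp add: fin)
      also have "\<dots> \<le> (\<integral>\<^sup>+l. ennreal (a * l powr (a - 1)) * indicator {l. 0 < l \<and> ennreal l < F} l \<partial>lborel)"
        by (intro nn_integral_mono) (auto simp: top indicator_def)
      finally show ?thesis .
    qed
    \<comment> \<open>A finite integral would have to dominate its own value plus 1.\<close>
    from this[of "enn2real (\<integral>\<^sup>+l. ennreal (a * l powr (a - 1)) * indicator {l. 0 < l \<and> ennreal l < F} l \<partial>lborel) + 1"]
    have "(\<integral>\<^sup>+l. ennreal (a * l powr (a - 1)) * indicator {l. 0 < l \<and> ennreal l < F} l \<partial>lborel) = top"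
      by (cases "\<integral>\<^sup>+l. ennreal (a * l powr (a - 1)) * indicator {l. 0 < l \<and> ennreal l < F} l \<partial>lborel")
         (auto simp flip: ennreal_plus)
    then show ?thesis by (simp add: top)
  qed
qed

text \<open>The uncentred maximal function. Its superlevel sets are unions of balls, hence open, and
  one average over a ball bounds it from below at every point of that ball.\<close>

definition max_fn :: "'a::metric_space measure \<Rightarrow> ('a \<Rightarrow> ennreal) \<Rightarrow> 'a \<Rightarrow> ennreal" where
  "max_fn M h x = (SUP B\<in>{B. x \<in> B \<and> (\<exists>a r. 0 < r \<and> B = ball a r)}.
     (\<integral>\<^sup>+y\<in>B. h y \<partial>M) / emeasure M B)"

lemma max_fn_upper:
  assumes "0 < r" "x \<in> ball a r"
  shows "(\<integral>\<^sup>+y\<in>ball a r. h y \<partial>M) / emeasure M (ball a r) \<le> max_fn M h x"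
  unfolding max_fn_def using assms by (intro SUP_upper) auto

lemma less_max_fn_iff:
  "t < max_fn M h x \<longleftrightarrow> (\<exists>a r. 0 < r \<and> x \<in> ball a r \<and>
     t < (\<integral>\<^sup>+y\<in>ball a r. h y \<partial>M) / emeasure M (ball a r))"
  unfolding max_fn_def less_SUP_iff by blast

lemma measurable_max_fn [measurable]: "max_fn M h \<in> borel_measurable borel"
proof (rule borel_measurableI_greater)
  fix t
  have "{x. t < max_fn M h x} = (\<Union>(a, r)\<in>{(a, r). 0 < r \<and>
     t < (\<integral>\<^sup>+y\<in>ball a r. h y \<partial>M) / emeasure M (ball a r)}. ball a r)"
    unfolding less_max_fn_iff by blast
  then have "open {x. t < max_fn M h x}"
    by auto
  then show "{x \<in> space borel. t < max_fn M h x} \<in> sets borel"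
    by simp
qed

text \<open>The factor 5 is the enlargement in the Vitali covering lemma.\<close>

locale doubling_measure =
  fixes M :: "'a::euclidean_space measure" and D :: real
  assumes sets_eq_borel [measurable_cong]: "sets M = sets borel"
    and ball_finite: "\<And>a r. emeasure M (ball a r) < top"
    and ball_pos: "\<And>a r. 0 < r \<Longrightarrow> 0 < emeasure M (ball a r)"
    and doubling: "\<And>a r. 0 < r \<Longrightarrow> emeasure M (ball a (5 * r)) \<le> ennreal D * emeasure M (ball a r)"
begin

lemma sigma_finite: "sigma_finite_measure M"
proof
  show "\<exists>A. countable A \<and> A \<subseteq> sets M \<and> \<Union> A = space M \<and> (\<forall>a\<in>A. emeasure M a \<noteq> \<infinity>)"
  proof (intro exI conjI)
    show "countable (range (\<lambda>n::nat. ball 0 (real n) :: 'a set))" by simp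
    show "range (\<lambda>n::nat. ball 0 (real n)) \<subseteq> sets M" by (auto simp: sets_eq_borel)
    show "\<Union> (range (\<lambda>n::nat. ball 0 (real n))) = space M"
      using sets_eq_imp_space_eq[OF sets_eq_borel] reals_Archimedean2
      by (auto simp: dist_norm)
    show "\<forall>a\<in>range (\<lambda>n::nat. ball 0 (real n)). emeasure M a \<noteq> \<infinity>"
      using ball_finite by (auto simp: less_top[symmetric])
  qed
qed

text \<open>Vitali selects disjoint balls whose fivefold dilates cover the union: doubling pays for
  the dilation, and disjointness lets the integrals of \<open>h\<close> add up to at most the total.
  The covering lemma requires bounded radii, but the resulting constant is independent of
  \<open>R\<close>.\<close>

lemma weak_bound_aux:
  fixes t :: ennreal
  assumes [measurable]: "h \<in> borel_measurable borel"
  defines "K \<equiv> (\<lambda>R. {(a, r). 0 < r \<and> r \<le> R \<and>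
    t * emeasure M (ball a r) \<le> (\<integral>\<^sup>+y\<in>ball a r. h y \<partial>M)})"
  shows "t * emeasure M (\<Union>(a, r)\<in>K R. ball a r) \<le> ennreal D * (\<integral>\<^sup>+y. h y \<partial>M)"
proof -
  have *: "\<And>i. i \<in> K R \<Longrightarrow> 0 < snd i \<and> snd i \<le> R"
    by (auto simp: K_def)
  obtain C where C: "countable C" "C \<subseteq> K R"
    "pairwise (\<lambda>i j. disjnt (ball (fst i) (snd i)) (ball (fst j) (snd j))) C"
    "(\<Union>i\<in>K R. ball (fst i) (snd i)) \<subseteq> (\<Union>i\<in>C. ball (fst i) (5 * snd i))"
    by (rule Vitali_covering_lemma_balls[where a=fst and r=snd, OF subset_refl *])
  define X where "X = (\<lambda>c i. if i \<in> to_nat_on C ` C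
     then ball (fst (from_nat_into C i)) (c * snd (from_nat_into C i)) else {})"
  have X_Un: "(\<Union>i. X c i) = (\<Union>i\<in>C. ball (fst i) (c * snd i))" for c
    using C(1) by (auto simp: X_def split: if_splits)
  have [measurable]: "X c i \<in> sets borel" for c i
    by (auto simp: X_def)
  have disj: "disjoint_family (X 1)"
    unfolding disjoint_family_on_def
  proof safe
    fix i j x assume ij: "i \<noteq> j" and x: "x \<in> X 1 i" "x \<in> X 1 j"
    then obtain u v where uv: "u \<in> C" "v \<in> C" "i = to_nat_on C u" "j = to_nat_on C v"
      by (auto simp: X_def split: if_splits)
    with ij have "disjnt (ball (fst u) (snd u)) (ball (fst v) (snd v))"
      using C(3) by (auto simp: pairwise_def)
    then show "x \<in> {}"
      using x uv C(1) by (auto simp: X_def disjnt_def)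
  qed
  have "t * emeasure M (\<Union>(a, r)\<in>K R. ball a r) \<le> t * emeasure M (\<Union>i. X 5 i)"
    using C(4) by (intro mult_left_mono emeasure_mono) (auto simp: X_Un sets_eq_borel case_prod_unfold intro!: borel_open)
  also have "\<dots> \<le> t * (\<Sum>i. emeasure M (X 5 i))"
    by (intro mult_left_mono emeasure_subadditive_countably) (auto simp: sets_eq_borel)
  also have "\<dots> = (\<Sum>i. t * emeasure M (X 5 i))"
    by simp
  also have "\<dots> \<le> (\<Sum>i. ennreal D * (\<integral>\<^sup>+y\<in>X 1 i. h y \<partial>M))"
  proof (intro suminf_le summableI)
    fix i
    show "t * emeasure M (X 5 i) \<le> ennreal D * (\<integral>\<^sup>+y\<in>X 1 i. h y \<partial>M)"
    proof (cases "i \<in> to_nat_on C ` C")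
      case True
      then have "from_nat_into C i \<in> K R"
        using C by auto
      moreover define a r where "a = fst (from_nat_into C i)" "r = snd (from_nat_into C i)"
      ultimately have *: "0 < r" "t * emeasure M (ball a r) \<le> (\<integral>\<^sup>+y\<in>ball a r. h y \<partial>M)"
        unfolding K_def by auto
      have "t * emeasure M (ball a (5 * r)) \<le> t * (ennreal D * emeasure M (ball a r))"
        by (intro mult_left_mono doubling *) auto
      also have "\<dots> \<le> ennreal D * (\<integral>\<^sup>+y\<in>ball a r. h y \<partial>M)"
        using mult_left_mono[OF *(2), of "ennreal D"] by (simp add: ac_simps)
      finally show ?thesis using True by (simp add: X_def a_r_def)
    qed (simp add: X_def)
  qed
  also have "\<dots> = ennreal D * (\<Sum>i. (\<integral>\<^sup>+y\<in>X 1 i. h y \<partial>M))"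
    by simp
  also have "(\<Sum>i. (\<integral>\<^sup>+y\<in>X 1 i. h y \<partial>M)) = (\<integral>\<^sup>+y\<in>(\<Union>i. X 1 i). h y \<partial>M)"
    using disj by (subst nn_integral_disjoint_family) (auto simp: sets_eq_borel)
  also have "\<dots> \<le> (\<integral>\<^sup>+y. h y \<partial>M)"
    by (intro nn_integral_mono) (auto simp: indicator_def)
  finally show ?thesis by (simp add: mult_left_mono)
qed

text \<open>As the bound is uniform in \<open>R\<close>, continuity from below removes the
  restriction on the radii.\<close>

lemma weak_bound:
  assumes [measurable]: "h \<in> borel_measurable borel"
  shows "t * emeasure M {x. \<exists>a r. 0 < r \<and> x \<in> ball a r \<and>
    t * emeasure M (ball a r) \<le> (\<integral>\<^sup>+y\<in>ball a r. h y \<partial>M)} \<le> ennreal D * (\<integral>\<^sup>+y. h y \<partial>M)"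
proof -
  define K where "K = (\<lambda>R. {(a, r). 0 < r \<and> r \<le> R \<and>
    t * emeasure M (ball a r) \<le> (\<integral>\<^sup>+y\<in>ball a r. h y \<partial>M)})"
  define O' where "O' n = (\<Union>(a, r)\<in>K (real n). ball a r)" for n :: nat
  have "open (O' n)" for n by (auto simp: O'_def)
  then have "range O' \<subseteq> sets M" by (auto simp: sets_eq_borel)
  moreover have "incseq O'"
    unfolding incseq_def O'_def K_def by fastforce
  ultimately have "emeasure M (\<Union>n. O' n) = (SUP n. emeasure M (O' n))"
    by (simp add: SUP_emeasure_incseq)
  moreover have "(\<Union>n. O' n) = {x. \<exists>a r. 0 < r \<and> x \<in> ball a r \<and>
    t * emeasure M (ball a r) \<le> (\<integral>\<^sup>+y\<in>ball a r. h y \<partial>M)}"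
    unfolding O'_def K_def using real_arch_simple by fastforce
  moreover have "t * (SUP n. emeasure M (O' n)) \<le> ennreal D * (\<integral>\<^sup>+y. h y \<partial>M)"
    unfolding SUP_mult_left_ennreal
    by (intro SUP_least) (use weak_bound_aux[OF assms] in \<open>simp add: O'_def K_def\<close>)
  ultimately show ?thesis by simp
qed

text \<open>Values of \<open>h\<close> up to \<open>l / 2\<close> contribute at most
  \<open>l / 2\<close> to any average. An average above \<open>l\<close> therefore leaves at least
  \<open>l / 2\<close> to the large values, to which the weak bound applies.\<close>

lemma weak_bound_max_fn:
  assumes [measurable]: "h \<in> borel_measurable borel" and l: "0 < l"
  shows "ennreal l * emeasure M {x. ennreal l < max_fn M h x} \<le>
    ennreal (2 * D) * (\<integral>\<^sup>+y. h y * indicator {y. ennreal l < 2 * h y} y \<partial>M)"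
proof -
  let ?h = "\<lambda>y. h y * indicator {y. ennreal l < 2 * h y} y"
  let ?S = "{x. \<exists>a r. 0 < r \<and> x \<in> ball a r \<and>
    ennreal (l/2) * emeasure M (ball a r) \<le> (\<integral>\<^sup>+y\<in>ball a r. ?h y \<partial>M)}"
  have "open ?S"
  proof -
    have "?S = (\<Union>(a, r)\<in>{(a, r). 0 < r \<and>
       ennreal (l/2) * emeasure M (ball a r) \<le> (\<integral>\<^sup>+y\<in>ball a r. ?h y \<partial>M)}. ball a r)"
      by blast
    then show ?thesis by auto
  qed
  have "{x. ennreal l < max_fn M h x} \<subseteq> ?S"
  proof safe
    fix x assume "ennreal l < max_fn M h x"
    then obtain a r where ar: "0 < r" "x \<in> ball a r"
      "ennreal l < (\<integral>\<^sup>+y\<in>ball a r. h y \<partial>M) / emeasure M (ball a r)"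
      by (auto simp: less_max_fn_iff)
    have [measurable]: "ball a r \<in> sets borel" by simp
    define m where "m = emeasure M (ball a r)"
    have m: "0 < m" "m < top"
      using ball_pos[OF ar(1)] ball_finite by (auto simp: m_def)
    have "ennreal (l/2) * m + ennreal (l/2) * m = ennreal l * m"
      using l by (simp flip: distrib_right ennreal_plus)
    also have "\<dots> \<le> (\<integral>\<^sup>+y\<in>ball a r. h y \<partial>M)"
    proof -
      have "ennreal l * m \<le> (\<integral>\<^sup>+y\<in>ball a r. h y \<partial>M) / m * m"
        using ar(3) by (intro mult_right_mono) (auto simp: m_def)
      also have "\<dots> = (\<integral>\<^sup>+y\<in>ball a r. h y \<partial>M)"
        using m by (simp add: ennreal_divide_times ennreal_divide_self)
      finally show ?thesis .
    qed
    also have "\<dots> \<le> (\<integral>\<^sup>+y. ?h y * indicator (ball a r) y + ennreal (l/2) * indicator (ball a r) y \<partial>M)"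
    proof (intro nn_integral_mono)
      fix y
      have "h y \<le> ennreal (l/2)" if "\<not> ennreal l < 2 * h y"
        using that l by (cases "h y") (auto simp: ennreal_mult_top not_less mult.commute
            simp flip: ennreal_numeral ennreal_mult intro!: ennreal_leI)
      then show "h y * indicator (ball a r) y \<le>
         ?h y * indicator (ball a r) y + ennreal (l/2) * indicator (ball a r) y"
        by (auto simp: indicator_def)
    qed
    also have "\<dots> = (\<integral>\<^sup>+y\<in>ball a r. ?h y \<partial>M) + (\<integral>\<^sup>+y\<in>ball a r. ennreal (l/2) \<partial>M)"
      by (rule nn_integral_add) measurable
    also have "\<dots> = (\<integral>\<^sup>+y\<in>ball a r. ?h y \<partial>M) + ennreal (l/2) * m"
      by (simp add: m_def nn_integral_cmult_indicator sets_eq_borel)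
    finally have "ennreal (l/2) * m \<le> (\<integral>\<^sup>+y\<in>ball a r. ?h y \<partial>M)"
      using m by (auto simp: ennreal_mult_eq_top_iff)
    then show "\<exists>a r. 0 < r \<and> x \<in> ball a r \<and>
      ennreal (l/2) * emeasure M (ball a r) \<le> (\<integral>\<^sup>+y\<in>ball a r. ?h y \<partial>M)"
      using ar m_def by blast
  qed
  then have "ennreal l * emeasure M {x. ennreal l < max_fn M h x} \<le> ennreal l * emeasure M ?S"
    using \<open>open ?S\<close> by (intro mult_left_mono emeasure_mono) (auto simp: sets_eq_borel)
  also have "\<dots> = 2 * (ennreal (l/2) * emeasure M ?S)"
    using l by (simp add: mult.assoc[symmetric] flip: ennreal_numeral ennreal_mult)
  also have "\<dots> \<le> 2 * (ennreal D * (\<integral>\<^sup>+y. ?h y \<partial>M))"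
    by (intro mult_left_mono weak_bound) auto
  finally show ?thesis
    by (cases "0 \<le> D") (simp_all add: ennreal_mult mult.assoc ennreal_neg)
qed

text \<open>Marcinkiewicz interpolation by hand. The truncated weak bound enters the layer-cake
  formula at exponent \<open>p\<close>; after Fubini the inner integral is again a layer-cake
  integral, of \<open>2 * h x\<close> at exponent \<open>p - 1\<close>, which produces the factors
  \<open>p / (p - 1)\<close> and \<open>2 powr (p - 1)\<close>.\<close>

theorem max_fn_bound:
  assumes [measurable]: "h \<in> borel_measurable borel" and p: "1 < p" 
  shows "(\<integral>\<^sup>+x. max_fn M h x powe p \<partial>M) \<le>
    ennreal (2 powr p * D * p / (p - 1)) * (\<integral>\<^sup>+x. h x powe p \<partial>M)"
proof -
  interpret sigma_finite_measure M by (rule sigma_finite)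
  interpret pair_sigma_finite M "lborel :: real measure" ..
  \<comment> \<open>For negative \<open>D\<close> the coercion \<open>ennreal D\<close> is 0, and
    doubling would contradict the positivity of balls.\<close>
  have "0 \<le> D"
    using doubling[of 1 0] ball_pos[of 5 0] by (metis ennreal_neg linorder_le_cases mult_zero_left
        not_le mult_1_right zero_less_numeral zero_less_one)
  have "(\<integral>\<^sup>+x. max_fn M h x powe p \<partial>M) =
    (\<integral>\<^sup>+x. (\<integral>\<^sup>+l. ennreal (p * l powr (p - 1)) * indicator {l. 0 < l \<and> ennreal l < max_fn M h x} l \<partial>lborel) \<partial>M)"
    using p by (subst nn_integral_layer) auto
  also have "\<dots> = (\<integral>\<^sup>+l. (\<integral>\<^sup>+x. ennreal (p * l powr (p - 1)) * indicator {l. 0 < l \<and> ennreal l < max_fn M h x} l \<partial>M) \<partial>lborel)"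
    by (rule Fubini'[symmetric]) measurable
  also have "\<dots> \<le> (\<integral>\<^sup>+l. (\<integral>\<^sup>+x. ennreal (2 * D * (p / (p - 1))) * (ennreal ((p - 1) * l powr ((p - 1) - 1)) *
      indicator {l. 0 < l \<and> ennreal l < 2 * h x} l * h x) \<partial>M) \<partial>lborel)"
  proof (rule nn_integral_mono)
    fix l :: real
    show "(\<integral>\<^sup>+x. ennreal (p * l powr (p - 1)) * indicator {l. 0 < l \<and> ennreal l < max_fn M h x} l \<partial>M) \<le>
      (\<integral>\<^sup>+x. ennreal (2 * D * (p / (p - 1))) * (ennreal ((p - 1) * l powr ((p - 1) - 1)) *
      indicator {l. 0 < l \<and> ennreal l < 2 * h x} l * h x) \<partial>M)"
    proof (cases "0 < l")
      case True
      have "(\<integral>\<^sup>+x. ennreal (p * l powr (p - 1)) * indicator {l. 0 < l \<and> ennreal l < max_fn M h x} l \<partial>M) =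
         (\<integral>\<^sup>+x. ennreal (p * l powr (p - 1)) * indicator {x. ennreal l < max_fn M h x} x \<partial>M)"
        using True by (intro nn_integral_cong) (auto simp: indicator_def)
      also have "\<dots> = ennreal (p * l powr (p - 1)) * emeasure M {x. ennreal l < max_fn M h x}"
        by (subst nn_integral_cmult_indicator) (auto simp: sets_eq_borel)
      also have "\<dots> = ennreal (p * l powr (p - 2)) * ennreal l * emeasure M {x. ennreal l < max_fn M h x}"
        using True p powr_mult_base[of l "p - 2", symmetric] by (simp add: mult.left_commute mult.commute flip: ennreal_mult)
      also have "\<dots> \<le>
         ennreal (p * l powr (p - 2)) * (ennreal (2 * D) * (\<integral>\<^sup>+y. h y * indicator {y. ennreal l < 2 * h y} y \<partial>M))"
        unfolding mult.assoc by (intro mult_left_mono weak_bound_max_fn True) auto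
      also have "\<dots> = ennreal (2 * D * (p / (p - 1)) * ((p - 1) * l powr ((p - 1) - 1))) * (\<integral>\<^sup>+y. h y * indicator {y. ennreal l < 2 * h y} y \<partial>M)"
        using p \<open>0 \<le> D\<close> by (simp add: mult.assoc[symmetric] flip: ennreal_mult) (simp add: ac_simps)
      also have "\<dots> = (\<integral>\<^sup>+x. ennreal (2 * D * (p / (p - 1)) * ((p - 1) * l powr ((p - 1) - 1))) *
          (h x * indicator {y. ennreal l < 2 * h y} x) \<partial>M)"
        by (rule nn_integral_cmult[symmetric]) measurable
      also have "\<dots> = (\<integral>\<^sup>+x. ennreal (2 * D * (p / (p - 1))) * (ennreal ((p - 1) * l powr ((p - 1) - 1)) *
          indicator {l. 0 < l \<and> ennreal l < 2 * h x} l * h x) \<partial>M)"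
      proof (intro nn_integral_cong)
        fix x
        show "ennreal (2 * D * (p / (p - 1)) * ((p - 1) * l powr ((p - 1) - 1))) *
            (h x * indicator {y. ennreal l < 2 * h y} x) =
          ennreal (2 * D * (p / (p - 1))) * (ennreal ((p - 1) * l powr ((p - 1) - 1)) *
            indicator {l. 0 < l \<and> ennreal l < 2 * h x} l * h x)"
          using True p \<open>0 \<le> D\<close> by (subst ennreal_mult) (auto simp: indicator_def ac_simps)
      qed
      finally show ?thesis .
    qed simp
  qed
  also have "\<dots> = (\<integral>\<^sup>+x. (\<integral>\<^sup>+l. ennreal (2 * D * (p / (p - 1))) * (ennreal ((p - 1) * l powr ((p - 1) - 1)) *
      indicator {l. 0 < l \<and> ennreal l < 2 * h x} l * h x) \<partial>lborel) \<partial>M)"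
    by (rule Fubini') measurable
  also have "\<dots> = (\<integral>\<^sup>+x. ennreal (2 * D * (p / (p - 1))) * ((2 * h x) powe (p - 1) * h x) \<partial>M)"
    using p nn_integral_layer[of "p - 1"] by (simp add: nn_integral_cmult nn_integral_multc)
  also have "\<dots> = (\<integral>\<^sup>+x. ennreal (2 * D * (p / (p - 1))) * (ennreal (2 powr (p - 1)) * h x powe p) \<partial>M)"
  proof (intro nn_integral_cong)
    fix x
    have "(2 * h x) powe (p - 1) * h x = ennreal (2 powr (p - 1)) * (h x powe (p - 1) * h x powe 1)"
      using powe_ennreal[of 2 "p - 1"] by (simp add: powe_mult mult.assoc)
    also have "\<dots> = ennreal (2 powr (p - 1)) * h x powe p"
      by (subst powe_add[symmetric]) simp
    finally show "ennreal (2 * D * (p / (p - 1))) * ((2 * h x) powe (p - 1) * h x) =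
      ennreal (2 * D * (p / (p - 1))) * (ennreal (2 powr (p - 1)) * h x powe p)" by simp
  qed
  also have "\<dots> = ennreal (2 * D * (p / (p - 1)) * 2 powr (p - 1)) * (\<integral>\<^sup>+x. h x powe p \<partial>M)"
    using p \<open>0 \<le> D\<close> ennreal_mult[of "2 * D * (p / (p - 1))" "2 powr (p - 1)"]
    by (simp add: nn_integral_cmult mult.assoc)
  also have "2 * D * (p / (p - 1)) * 2 powr (p - 1) = 2 powr p * D * p / (p - 1)"
    using p by (simp add: powr_diff divide_simps)
  finally show ?thesis .
qed

end

section \<open>Dual pairs of weights\<close>

lemma ball_borel [measurable]: "ball (c::'a::metric_space) r \<in> sets borel"
  by simp

definition wmeasure :: "('a::euclidean_space \<Rightarrow> real) \<Rightarrow> 'a measure" where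
  "wmeasure u = density lborel (\<lambda>x. ennreal (u x))"

lemma sets_wmeasure [measurable_cong, simp]: "sets (wmeasure u) = sets borel"
  by (simp add: wmeasure_def)

lemma space_wmeasure [simp]: "space (wmeasure u) = UNIV"
  by (simp add: wmeasure_def)

lemma emeasure_wmeasure:
  "u \<in> borel_measurable borel \<Longrightarrow> A \<in> sets borel \<Longrightarrow>
    emeasure (wmeasure u) A = (\<integral>\<^sup>+x\<in>A. ennreal (u x) \<partial>lborel)"
  unfolding wmeasure_def by (subst emeasure_density) auto

lemma nn_integral_wmeasure:
  "u \<in> borel_measurable borel \<Longrightarrow> f \<in> borel_measurable borel \<Longrightarrow>
    (\<integral>\<^sup>+x. f x \<partial>wmeasure u) = (\<integral>\<^sup>+x. ennreal (u x) * f x \<partial>lborel)"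
  unfolding wmeasure_def by (subst nn_integral_density) auto

lemma emeasure_ball_eq_content: "emeasure lborel (ball c r) = ennreal (measure lborel (ball c r))"
  using emeasure_lborel_ball_finite[of c r] by (intro emeasure_eq_ennreal_measure) auto

lemma content_ball_mult:
  "0 \<le> r \<Longrightarrow> 0 \<le> k \<Longrightarrow> measure lborel (ball (c::'a::euclidean_space) (k * r)) = k ^ DIM('a) * measure lborel (ball c r)"
  by (simp add: content_ball power_mult_distrib)

text \<open>The Muckenhoupt condition with its averages multiplied out. In this form it is symmetric
  under exchanging \<open>u\<close>, \<open>a\<close> with \<open>\<sigma>\<close>,
  \<open>b\<close>, so \<open>dual_pair\<close> transfers every result on \<open>u\<close> to
  \<open>\<sigma>\<close>. Positivity at every point allows the weights to be cancelled
  pointwise.\<close>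

locale weight_pair =
  fixes u \<sigma> :: "'a::euclidean_space \<Rightarrow> real" and a b C :: real
  assumes u_borel [measurable]: "u \<in> borel_measurable borel"
    and \<sigma>_borel [measurable]: "\<sigma> \<in> borel_measurable borel"
    and u_pos: "\<And>x. 0 < u x" and \<sigma>_pos: "\<And>x. 0 < \<sigma> x"
    and a_pos: "0 < a" and b_pos: "0 < b" and C_pos: "0 < C"
    and dual: "\<And>x. u x powr a * \<sigma> x powr b = 1"
    and u_finite: "\<And>c r. emeasure (wmeasure u) (ball c r) < top"
    and \<sigma>_finite: "\<And>c r. emeasure (wmeasure \<sigma>) (ball c r) < top"
    and A_cond: "\<And>c r. 0 < r \<Longrightarrow> measure (wmeasure u) (ball c r) powr a *
       measure (wmeasure \<sigma>) (ball c r) powr b \<le> C * measure lborel (ball c r) powr (a + b)"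
begin

lemma dual_pair: "weight_pair \<sigma> u b a C"
  using u_borel \<sigma>_borel u_pos \<sigma>_pos a_pos b_pos C_pos dual u_finite \<sigma>_finite A_cond
  unfolding weight_pair_def by (auto simp: mult.commute add.commute)

abbreviation V :: "'a \<Rightarrow> real \<Rightarrow> real" where
  "V c r \<equiv> measure (wmeasure u) (ball c r)"

lemma emeasure_V: "emeasure (wmeasure u) (ball c r) = ennreal (V c r)"
  using u_finite by (simp add: emeasure_eq_ennreal_measure less_top)

lemma V_pos:
  assumes "0 < r" shows "0 < V c r"
proof -
  have "emeasure (wmeasure u) (ball c r) \<noteq> 0"
  proof
    assume "emeasure (wmeasure u) (ball c r) = 0"
    then have "AE x in lborel. ennreal (u x) * indicator (ball c r) x = 0"
      by (subst (asm) emeasure_wmeasure, simp, simp, subst (asm) nn_integral_0_iff_AE) auto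
    then have "AE x in lborel. x \<notin> ball c r"
      by (rule eventually_mono) (auto simp: indicator_def ennreal_eq_0_iff dest: less_le_trans[OF u_pos] split: if_splits)
    then have "emeasure lborel (ball c r) = 0"
      by (subst (asm) AE_iff_measurable[of "ball c r"]) auto
    then show False using assms by (simp add: emeasure_ball_eq_content)
  qed
  then show ?thesis by (simp add: emeasure_V zero_less_measure_iff)
qed

text \<open>The constant weight 1 is a geometric mean of \<open>u\<close> and \<open>\<sigma>\<close>, so Hoelder's inequality on \<open>E\<close>
  combines with the Muckenhoupt condition on the ball.\<close>

lemma measure_comparison:
  assumes r: "0 < r" and E [measurable]: "E \<in> sets borel" and sub: "E \<subseteq> ball c r"
  shows "measure lborel E powr (a + b) * V c r powr a \<le>
    C * measure (wmeasure u) E powr a * measure lborel (ball c r) powr (a + b)"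
proof -
  interpret D: weight_pair \<sigma> u b a C by (rule dual_pair)
  define t where "t = a / (a + b)"
  have t: "0 < t" "t < 1" "1 - t = b / (a + b)"
    using a_pos b_pos by (auto simp: t_def divide_simps)
  have E_u: "emeasure (wmeasure u) E = ennreal (measure (wmeasure u) E)"
    using le_less_trans[OF emeasure_mono[OF sub, of "wmeasure u"] u_finite[of c r]]
    by (intro emeasure_eq_ennreal_measure) auto
  have E_s: "emeasure (wmeasure \<sigma>) E = ennreal (measure (wmeasure \<sigma>) E)"
    using le_less_trans[OF emeasure_mono[OF sub, of "wmeasure \<sigma>"] \<sigma>_finite[of c r]]
    by (intro emeasure_eq_ennreal_measure) auto
  have E_l: "emeasure lborel E = ennreal (measure lborel E)"
    using le_less_trans[OF emeasure_mono[OF sub, of lborel] emeasure_lborel_ball_finite]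
    by (intro emeasure_eq_ennreal_measure) auto
  have S_mono: "measure (wmeasure \<sigma>) E \<le> D.V c r"
    using emeasure_mono[OF sub, of "wmeasure \<sigma>"] by (simp add: E_s D.emeasure_V)
  have one: "u x powr t * \<sigma> x powr (1 - t) = 1" for x
  proof -
    have "u x powr t * \<sigma> x powr (1 - t) = (u x powr a * \<sigma> x powr b) powr (1 / (a + b))"
      using u_pos[of x] \<sigma>_pos[of x] by (simp only: t(3)) (simp add: t_def powr_mult powr_powr)
    then show ?thesis by (simp add: dual)
  qed
  have "indicator E x = (ennreal (u x) * indicator E x) powe t * (ennreal (\<sigma> x) * indicator E x) powe (1 - t)" for x
    using u_pos[of x] \<sigma>_pos[of x] one[of x] by (cases "x \<in> E") (auto simp flip: ennreal_mult)
  then have "emeasure lborel E = (\<integral>\<^sup>+x. (ennreal (u x) * indicator E x) powe t * (ennreal (\<sigma> x) * indicator E x) powe (1 - t) \<partial>lborel)"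
    by (metis (no_types, lifting) E nn_integral_cong nn_integral_indicator sets_lborel)
  also have "\<dots> \<le> (\<integral>\<^sup>+x. ennreal (u x) * indicator E x \<partial>lborel) powe t *
      (\<integral>\<^sup>+x. ennreal (\<sigma> x) * indicator E x \<partial>lborel) powe (1 - t)"
    by (rule nn_integral_Hoelder) (use t in auto)
  also have "\<dots> = ennreal (measure (wmeasure u) E powr t * measure (wmeasure \<sigma>) E powr (1 - t))"
    by (simp add: emeasure_wmeasure[symmetric] E_u E_s ennreal_mult)
  finally have "measure lborel E \<le> measure (wmeasure u) E powr t * measure (wmeasure \<sigma>) E powr (1 - t)"
    by (simp add: E_l)
  then have "measure lborel E powr (a + b) \<le> (measure (wmeasure u) E powr t * measure (wmeasure \<sigma>) E powr (1 - t)) powr (a + b)"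
    using a_pos b_pos by (intro powr_mono2) auto
  also have "\<dots> = measure (wmeasure u) E powr a * measure (wmeasure \<sigma>) E powr b"
    using a_pos b_pos by (simp add: powr_mult powr_powr t(3)) (simp add: t_def)
  also have "\<dots> \<le> measure (wmeasure u) E powr a * D.V c r powr b"
    using b_pos S_mono by (intro mult_left_mono powr_mono2) auto
  finally have "measure lborel E powr (a + b) * V c r powr a \<le>
      (measure (wmeasure u) E powr a * D.V c r powr b) * V c r powr a"
    by (rule mult_right_mono) simp
  also have "\<dots> = measure (wmeasure u) E powr a * (V c r powr a * D.V c r powr b)"
    by (simp add: ac_simps)
  also have "\<dots> \<le> measure (wmeasure u) E powr a * (C * measure lborel (ball c r) powr (a + b))"
    by (intro mult_left_mono A_cond r) auto
  finally show ?thesis by (simp add: ac_simps)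
qed

text \<open>Quantitative absolute continuity: the volume of \<open>E\<close> cancels from the
  comparison once the ball has at most \<open>k\<close> times that volume. Taking a concentric
  smaller ball for \<open>E\<close> yields doubling, taking an annulus yields reverse
  doubling.\<close>

lemma measure_proportion:
  assumes r: "0 < r" and E [measurable]: "E \<in> sets borel" and sub: "E \<subseteq> ball c r"
    and k: "0 < k" "measure lborel (ball c r) \<le> k * measure lborel E"
  shows "V c r \<le> (C * k powr (a + b)) powr (1 / a) * measure (wmeasure u) E"
proof -
  have Epos: "0 < measure lborel E"
    using k r by (metis content_ball_gt_0_iff less_le_trans zero_less_mult_pos)
  have "measure lborel E powr (a + b) * V c r powr a \<le>
    C * measure (wmeasure u) E powr a * measure lborel (ball c r) powr (a + b)"
    by (rule measure_comparison[OF r E sub])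
  also have "\<dots> \<le> C * measure (wmeasure u) E powr a * (k * measure lborel E) powr (a + b)"
    using C_pos a_pos b_pos k by (intro mult_left_mono powr_mono2) auto
  also have "\<dots> = measure lborel E powr (a + b) * (C * k powr (a + b) * measure (wmeasure u) E powr a)"
    using k by (simp add: powr_mult)
  finally have "V c r powr a \<le> C * k powr (a + b) * measure (wmeasure u) E powr a"
    using Epos by simp
  then have "(V c r powr a) powr (1 / a) \<le> (C * k powr (a + b) * measure (wmeasure u) E powr a) powr (1 / a)"
    using a_pos by (intro powr_mono2) auto
  then show ?thesis
    using a_pos C_pos by (simp add: powr_mult powr_powr)
qed

text \<open>The constant of \<open>measure_proportion\<close> for a ball inside its fivefold
  dilate.\<close>

definition dbl :: real where
  "dbl = (C * (5 ^ DIM('a)) powr (a + b)) powr (1 / a)"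

lemma doubling_wmeasure: "doubling_measure (wmeasure u) dbl"
proof
  fix c :: 'a and r :: real assume r: "0 < r"
  have "V c (5 * r) \<le> dbl * V c r"
    unfolding dbl_def using r by (intro measure_proportion) (auto simp: content_ball_mult)
  then show "emeasure (wmeasure u) (ball c (5 * r)) \<le> ennreal dbl * emeasure (wmeasure u) (ball c r)"
    by (simp add: emeasure_V dbl_def flip: ennreal_mult)
qed (use u_finite V_pos in \<open>auto simp: emeasure_V\<close>)

lemma V_mono: "ball c r \<subseteq> ball c' r' \<Longrightarrow> V c r \<le> V c' r'"
  using emeasure_mono[of "ball c r" "ball c' r'" "wmeasure u"] by (simp add: emeasure_V)

lemma V_doubling:
  assumes "0 < r" "r' \<le> 5 * r" shows "V c r' \<le> dbl * V c r"
proof -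
  have "V c r' \<le> V c (5 * r)" using assms by (intro V_mono) auto
  also have "\<dots> \<le> dbl * V c r"
    unfolding dbl_def using assms by (intro measure_proportion) (auto simp: content_ball_mult)
  finally show ?thesis .
qed

text \<open>If \<open>K\<close> is the constant of \<open>measure_proportion\<close> for volume
  ratio 2, then \<open>V c (2 * r)\<close> is at most \<open>K + 1\<close> times the mass of the
  annulus, and solving for \<open>V c r\<close> gives this ratio. Enlarging \<open>K\<close> to
  \<open>K + 1\<close> keeps it strictly positive.\<close>

definition \<theta> :: real where
  "\<theta> = 1 - 1 / ((C * 2 powr (a + b)) powr (1 / a) + 1)"

lemma \<theta>_bounds: "0 < \<theta>" "\<theta> < 1"
proof -
  define K where "K = (C * 2 powr (a + b)) powr (1 / a)"
  have "0 < K"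
    using C_pos by (simp add: K_def)
  then show "0 < \<theta>" "\<theta> < 1"
    unfolding \<theta>_def K_def[symmetric] by (auto simp: divide_simps)
qed

text \<open>In dimension at least 1 the annulus between radii \<open>r\<close> and
  \<open>2 * r\<close> fills at least half of the larger ball, so it carries a fixed fraction of its
  mass.\<close>

lemma reverse_doubling:
  assumes r: "0 < r"
  shows "V c r \<le> \<theta> * V c (2 * r)"
proof -
  define K where "K = (C * 2 powr (a + b)) powr (1 / a)"
  define E where "E = ball c (2 * r) - ball c r"
  have sub: "ball c r \<subseteq> ball c (2 * r)" using r by auto
  have "measure lborel E = measure lborel (ball c (2 * r)) - measure lborel (ball c r)"
    unfolding E_def using sub
    by (intro measure_Diff) (auto simp: emeasure_ball_eq_content)
  also have "measure lborel (ball c (2 * r)) = 2 ^ DIM('a) * measure lborel (ball c r)"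
    using r by (simp add: content_ball_mult)
  finally have E_l: "measure lborel (ball c (2 * r)) \<le> 2 * measure lborel E"
  proof -
    assume *: "measure lborel E = 2 ^ DIM('a) * measure lborel (ball c r) - measure lborel (ball c r)"
    have "(2::real) ^ 1 \<le> 2 ^ DIM('a)" by (intro power_increasing) (auto simp: Suc_le_eq)
    then have "2 * measure lborel (ball c r) \<le> 2 ^ DIM('a) * measure lborel (ball c r)"
      by (intro mult_right_mono) auto
    with * show ?thesis using r by (simp add: content_ball_mult)
  qed
  have "V c (2 * r) \<le> K * measure (wmeasure u) E"
    unfolding K_def by (rule measure_proportion) (use r E_l in \<open>auto simp: E_def\<close>)
  also have "\<dots> \<le> (K + 1) * measure (wmeasure u) E"
    by (intro mult_right_mono) auto
  also have "measure (wmeasure u) E = V c (2 * r) - V c r"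
    unfolding E_def using sub by (intro measure_Diff) (auto simp: emeasure_V)
  finally have *: "V c (2 * r) \<le> (K + 1) * (V c (2 * r) - V c r)" .
  have "0 < K + 1" unfolding K_def by (simp add: add_nonneg_pos)
  with * have "V c r \<le> V c (2 * r) - V c (2 * r) / (K + 1)"
    by (simp add: field_simps)
  then show ?thesis
    by (simp add: \<theta>_def K_def algebra_simps)
qed

section \<open>Iterated reverse doubling and sums over dyadic radii\<close>

lemma V_pow_ge:
  assumes r: "0 < r" shows "V c r \<le> \<theta> ^ j * V c (2 ^ j * r)"
proof (induction j)
  case (Suc j)
  have "\<theta> ^ j * V c (2 ^ j * r) \<le> \<theta> ^ j * (\<theta> * V c (2 * (2 ^ j * r)))"
    using r \<theta>_bounds by (intro mult_left_mono reverse_doubling) auto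
  with Suc show ?case by (simp add: ac_simps)
qed simp

lemma V_pow_le:
  assumes r: "0 < r" shows "V c (r / 2 ^ j) \<le> \<theta> ^ j * V c r"
  using V_pow_ge[of "r / 2 ^ j" c j] r by simp

lemma geometric_powr:
  assumes e: "0 < e"
  shows "(\<Sum>j. ennreal (B * (\<theta> ^ j) powr e)) = ennreal (B * (1 / (1 - \<theta> powr e)))" "0 < 1 - \<theta> powr e"
proof -
  have 1: "0 \<le> \<theta> powr e" "\<theta> powr e < 1"
    using \<theta>_bounds e by (auto simp: powr01_less_one)
  then show "0 < 1 - \<theta> powr e" by simp
  have 2: "(\<theta> ^ j) powr e = (\<theta> powr e) ^ j" for j
    using \<theta>_bounds by (simp add: powr_realpow[symmetric] powr_powr mult.commute)
  show "(\<Sum>j. ennreal (B * (\<theta> ^ j) powr e)) = ennreal (B * (1 / (1 - \<theta> powr e)))"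
  proof (cases "0 \<le> B")
    case True
    have "(\<lambda>j. B * (\<theta> powr e) ^ j) sums (B * (1 / (1 - \<theta> powr e)))"
      using 1 by (intro sums_mult geometric_sums) auto
    then show ?thesis
      unfolding 2 using True 1 by (intro suminf_ennreal_eq) auto
  next
    case False
    then have "B * (\<theta> ^ j) powr e \<le> 0" for j
      by (simp add: mult_nonpos_nonneg)
    moreover have "B * (1 / (1 - \<theta> powr e)) \<le> 0"
      using False 1 by (intro mult_nonpos_nonneg) auto
    ultimately show ?thesis by (simp add: ennreal_neg)
  qed
qed

lemma sum_V_small:
  assumes r: "0 < r" and e: "0 < e"
  shows "(\<Sum>j. ennreal (V c (r / 2 ^ j) powr e)) \<le> ennreal (V c r powr e / (1 - \<theta> powr e))"
proof -
  have "(\<Sum>j. ennreal (V c (r / 2 ^ j) powr e)) \<le> (\<Sum>j. ennreal (V c r powr e * (\<theta> ^ j) powr e))"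
  proof (intro suminf_le summableI ennreal_leI)
    fix j
    have "V c (r / 2 ^ j) powr e \<le> (\<theta> ^ j * V c r) powr e"
      using e r by (intro powr_mono2 V_pow_le) auto
    then show "V c (r / 2 ^ j) powr e \<le> V c r powr e * (\<theta> ^ j) powr e"
      using \<theta>_bounds by (simp add: powr_mult mult.commute)
  qed
  also note geometric_powr(1)[OF e]
  finally show ?thesis by simp
qed

lemma sum_V_large:
  assumes r: "0 < r" and e: "0 < e"
  shows "(\<Sum>j. ennreal (V c (2 ^ j * r) powr (- e))) \<le> ennreal (V c r powr (- e) / (1 - \<theta> powr e))"
proof -
  have "(\<Sum>j. ennreal (V c (2 ^ j * r) powr (- e))) \<le> (\<Sum>j. ennreal (V c r powr (- e) * (\<theta> ^ j) powr e))"
  proof (intro suminf_le summableI ennreal_leI)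
    fix j
    have pos: "0 < V c r" "0 < V c (2 ^ j * r)" "0 < \<theta> ^ j"
      using r \<theta>_bounds by (auto intro!: V_pos)
    have "(\<theta> ^ j * V c (2 ^ j * r)) powr (- e) \<le> V c r powr (- e)"
      using e pos by (intro powr_mono2' V_pow_ge r) auto
    then have "(\<theta> ^ j) powr (- e) * V c (2 ^ j * r) powr (- e) * (\<theta> ^ j) powr e \<le> V c r powr (- e) * (\<theta> ^ j) powr e"
      by (intro mult_right_mono) (auto simp: powr_mult)
    also have "(\<theta> ^ j) powr (- e) * V c (2 ^ j * r) powr (- e) * (\<theta> ^ j) powr e = V c (2 ^ j * r) powr (- e)"
      using pos \<theta>_bounds by (simp add: powr_minus field_simps)
    finally show "V c (2 ^ j * r) powr (- e) \<le> V c r powr (- e) * (\<theta> ^ j) powr e" .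
  qed
  also note geometric_powr(1)[OF e]
  finally show ?thesis by simp
qed

text \<open>In place of a solution of \<open>V c R = l\<close>, a radius is taken above half the
  supremum of those with \<open>V c r \<le> l\<close>. Reverse doubling drives \<open>V\<close> to 0
  at small radii and to infinity at large ones, so this set is nonempty and bounded; as
  \<open>2 * R\<close> lies outside it, doubling gives the last inequality.\<close>

lemma ex_radius:
  assumes l: "0 < l"
  obtains R where "0 < R" "V c R \<le> l" "l \<le> dbl * V c R"
proof -
  define X where "X = {r. 0 < r \<and> V c r \<le> l}"
  have V1: "0 < V c 1" by (simp add: V_pos)
  have lim: "(\<lambda>j. \<theta> ^ j) \<longlonglongrightarrow> 0"
    using \<theta>_bounds by (intro LIMSEQ_power_zero) auto
  have "0 < l / V c 1" using l V1 by simp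
  from order_tendstoD(2)[OF lim this] obtain j where j: "\<theta> ^ j < l / V c 1"
    by (auto simp: eventually_sequentially)
  then have "\<theta> ^ j * V c 1 \<le> l" using V1 by (simp add: field_simps)
  then have X1: "1 / 2 ^ j \<in> X"
    using V_pow_le[of 1 c j] by (auto simp: X_def)
  have "0 < V c 1 / l" using l V1 by simp
  from order_tendstoD(2)[OF lim this] obtain k where k: "\<theta> ^ k < V c 1 / l"
    by (auto simp: eventually_sequentially)
  have "\<theta> ^ k * l < \<theta> ^ k * V c (2 ^ k)"
    using k l V_pow_ge[of 1 c k] by (simp add: field_simps)
  then have Vk: "l < V c (2 ^ k)"
    using \<theta>_bounds by simp
  have bdd: "r \<le> 2 ^ k" if "r \<in> X" for r
  proof (rule ccontr)
    assume "\<not> r \<le> 2 ^ k"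
    then have "V c (2 ^ k) \<le> V c r" by (intro V_mono) auto
    with that Vk show False by (auto simp: X_def)
  qed
  then have bdd': "bdd_above X" by (auto simp: bdd_above_def)
  have "0 < Sup X"
    using cSup_upper[OF X1 bdd'] by (rule less_le_trans[rotated]) simp
  then have "Sup X / 2 < Sup X" by simp
  then obtain R where R: "R \<in> X" "Sup X / 2 < R"
    using X1 by (metis less_cSupE empty_iff)
  then have "2 * R \<notin> X" using cSup_upper[OF _ bdd', of "2 * R"] by auto
  then have "l \<le> V c (2 * R)" using R by (auto simp: X_def)
  also have "\<dots> \<le> dbl * V c R" using R by (intro V_doubling) (auto simp: X_def)
  finally show thesis using R that by (auto simp: X_def)
qed

end

section \<open>Averages over balls\<close>

lemma ennreal_mult_le_imp:
  assumes "0 < c" "ennreal c * Y \<le> Z" shows "Y \<le> ennreal (1 / c) * Z"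
proof -
  have "Y = ennreal (1 / c) * (ennreal c * Y)"
    using assms by (simp add: mult.assoc[symmetric] flip: ennreal_mult)
  also have "\<dots> \<le> ennreal (1 / c) * Z"
    using assms by (intro mult_left_mono) auto
  finally show ?thesis .
qed

locale potential_pair = weight_pair u \<sigma> a b C
  for u \<sigma> :: "'a::euclidean_space \<Rightarrow> real" and a b C +
  fixes n d s s' p q :: real
  assumes n: "n = real DIM('a)" and conj: "1 / s + 1 / s' = 1" and s: "1 < s" and s': "1 < s'" "s' < p"
    and d: "0 < d" "d < n"
    and q: "0 < q" "1 / q = 1 / p - d / n"
    and a_def: "a = s' / q" and b_def: "b = 1 - s' / p"
begin

sublocale D: weight_pair \<sigma> u b a C by (rule dual_pair)

lemma p_gt: "1 < p" "0 < p" using s' by auto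

definition \<omega> :: real where "\<omega> = unit_ball_vol n"

lemma \<omega>_pos: "0 < \<omega>" unfolding \<omega>_def by (subst n) simp

lemma ball_vol: "0 < r \<Longrightarrow> measure lborel (ball (c::'a) r) = \<omega> * r powr n"
  by (simp add: \<omega>_def content_ball powr_realpow) (simp add: n powr_realpow)

text \<open>Both identities rewrite \<open>a + b = 1 - s' * d / n\<close>. The first is the
  homogeneity that removes \<open>r\<close> from the bounds on \<open>t\<close>; the second produces
  the power of \<open>V\<close> in the bound by \<open>N\<close>.\<close>

lemma exponent_sum: "n * (a + b) / s' = n / s' - d" "1 - (a + b) = s' * (1 / p - 1 / q)"
proof -
  have "(a + b) = 1 - s' * d / n"
  proof -
    have "a + b = 1 - s' * (1 / p - 1 / q)"
      unfolding a_def b_def by (simp add: field_simps)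
    also have "1 / p - 1 / q = d / n" using q(2) by simp
    finally show ?thesis by simp
  qed
  then show "n * (a + b) / s' = n / s' - d"
    using d s' by (simp add: field_simps)
  show "1 - (a + b) = s' * (1 / p - 1 / q)"
    unfolding a_def b_def by (simp add: field_simps)
qed

text \<open>With \<open>u\<close> equal to \<open>w powr q\<close>, the factor
  \<open>u x powr (p / q)\<close> is \<open>w powr p\<close>, the weight in the Morrey norm of the
  input.\<close>

definition J :: "('a \<Rightarrow> ennreal) \<Rightarrow> 'a set \<Rightarrow> ennreal" where
  "J \<phi> B = (\<integral>\<^sup>+x\<in>B. \<phi> x powe p * ennreal (u x powr (p / q)) \<partial>lborel)"

definition t :: "('a \<Rightarrow> ennreal) \<Rightarrow> 'a \<Rightarrow> real \<Rightarrow> ennreal" where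
  "t \<phi> x r = ennreal (r powr (d - n / s')) * (\<integral>\<^sup>+y\<in>ball x r. \<phi> y powe s' \<partial>lborel) powe (1 / s')"

text \<open>By duality of the weights, \<open>\<phi> powe s'\<close> is the geometric mean, with
  weights \<open>s' / p\<close> and \<open>b\<close>, of the integrand of \<open>J\<close> and of
  \<open>\<sigma>\<close>.\<close>

lemma hoelder_ball:
  assumes [measurable]: "\<phi> \<in> borel_measurable borel"
  shows "(\<integral>\<^sup>+y\<in>ball c r. \<phi> y powe s' \<partial>lborel) \<le> J \<phi> (ball c r) powe (s' / p) * ennreal (D.V c r powr b)"
proof -
  have "\<phi> y powe s' * indicator (ball c r) y =
     (\<phi> y powe p * ennreal (u y powr (p / q)) * indicator (ball c r) y) powe (s' / p) *
     (ennreal (\<sigma> y) * indicator (ball c r) y) powe (1 - s' / p)" for y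
  proof (cases "y \<in> ball c r")
    case True
    have "(\<phi> y powe p * ennreal (u y powr (p / q))) powe (s' / p) * ennreal (\<sigma> y) powe (1 - s' / p)
       = \<phi> y powe s' * (ennreal (u y powr a) * ennreal (\<sigma> y powr b))"
      using p_gt \<sigma>_pos[of y] u_pos[of y] by (simp add: powe_mult powe_powe powr_powr a_def b_def mult.assoc)
    also have "\<dots> = \<phi> y powe s'"
      using dual by (simp flip: ennreal_mult)
    finally show ?thesis using True by simp
  qed simp
  then have "(\<integral>\<^sup>+y\<in>ball c r. \<phi> y powe s' \<partial>lborel) =
     (\<integral>\<^sup>+y. (\<phi> y powe p * ennreal (u y powr (p / q)) * indicator (ball c r) y) powe (s' / p) *
     (ennreal (\<sigma> y) * indicator (ball c r) y) powe (1 - s' / p) \<partial>lborel)"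
    by simp
  also have "\<dots> \<le> J \<phi> (ball c r) powe (s' / p) * (\<integral>\<^sup>+y\<in>ball c r. ennreal (\<sigma> y) \<partial>lborel) powe (1 - s' / p)"
    unfolding J_def by (rule nn_integral_Hoelder) (use s' in auto)
  also have "(\<integral>\<^sup>+y\<in>ball c r. ennreal (\<sigma> y) \<partial>lborel) powe (1 - s' / p) = ennreal (D.V c r powr b)"
    by (simp add: emeasure_wmeasure[symmetric] D.emeasure_V b_def)
  finally show ?thesis .
qed

definition CA :: real where "CA = (C * \<omega> powr (a + b)) powr (1 / s')"

text \<open>The exponents of \<open>r\<close> cancel by the relation between \<open>p\<close>, \<open>q\<close> and \<open>d\<close>.\<close>

lemma t_scale:
  assumes r: "0 < r" and Z: "0 \<le> Z"
  shows "ennreal (r powr (d - n / s')) * (ennreal (Z * (\<omega> * r powr n) powr (a + b)) * X) powe (1 / s')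
    = ennreal ((Z * \<omega> powr (a + b)) powr (1 / s')) * X powe (1 / s')"
proof -
  have "(Z * (\<omega> * r powr n) powr (a + b)) powr (1 / s') =
      (Z * \<omega> powr (a + b)) powr (1 / s') * r powr (n * (a + b) / s')"
    using \<omega>_pos Z by (simp add: powr_mult powr_powr mult.assoc)
  then have "r powr (d - n / s') * (Z * (\<omega> * r powr n) powr (a + b)) powr (1 / s') =
      (Z * \<omega> powr (a + b)) powr (1 / s') * (r powr (d - n / s') * r powr (n / s' - d))"
    by (simp add: exponent_sum ac_simps)
  also have "r powr (d - n / s') * r powr (n / s' - d) = 1"
    using r by (simp flip: powr_add)
  finally have "r powr (d - n / s') * (Z * (\<omega> * r powr n) powr (a + b)) powr (1 / s') =
      (Z * \<omega> powr (a + b)) powr (1 / s')" by simp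
  then show ?thesis
    using Z by (simp add: powe_mult mult.assoc[symmetric] flip: ennreal_mult)
qed

text \<open>The Muckenhoupt condition, solved for the \<sigma>-mass of the ball, trades that mass
  for \<open>V c r powr (- a)\<close>; the root of order \<open>s'\<close> turns \<open>a\<close>
  into \<open>1 / q\<close>.\<close>

lemma t_le_J:
  assumes r: "0 < r" and [measurable]: "\<phi> \<in> borel_measurable borel"
  shows "t \<phi> c r \<le> ennreal CA * (J \<phi> (ball c r) powe (1 / p) * ennreal (V c r powr (- (1 / q))))"
proof -
  have "V c r powr a * D.V c r powr b \<le> C * (\<omega> * r powr n) powr (a + b)"
    using A_cond[OF r, of c] r by (simp add: ball_vol)
  then have *: "D.V c r powr b \<le> C * (\<omega> * r powr n) powr (a + b) * V c r powr (- a)"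
    using V_pos[OF r, of c] by (simp add: powr_minus field_simps)
  have "(\<integral>\<^sup>+y\<in>ball c r. \<phi> y powe s' \<partial>lborel) \<le> J \<phi> (ball c r) powe (s' / p) * ennreal (D.V c r powr b)"
    by (rule hoelder_ball) simp
  also have "\<dots> \<le> J \<phi> (ball c r) powe (s' / p) * ennreal (C * (\<omega> * r powr n) powr (a + b) * V c r powr (- a))"
    by (intro mult_left_mono ennreal_leI *) auto
  also have "\<dots> = ennreal (C * (\<omega> * r powr n) powr (a + b)) * (J \<phi> (ball c r) powe (s' / p) * ennreal (V c r powr (- a)))"
    using C_pos by (subst ennreal_mult) (auto simp: ac_simps)
  finally have "t \<phi> c r \<le> ennreal (r powr (d - n / s')) *
      (ennreal (C * (\<omega> * r powr n) powr (a + b)) * (J \<phi> (ball c r) powe (s' / p) * ennreal (V c r powr (- a)))) powe (1 / s')"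
    unfolding t_def using s' by (intro mult_left_mono powe_mono) auto
  also have "\<dots> = ennreal CA * (J \<phi> (ball c r) powe (s' / p) * ennreal (V c r powr (- a))) powe (1 / s')"
    unfolding CA_def by (rule t_scale) (use r C_pos in auto)
  also have "(J \<phi> (ball c r) powe (s' / p) * ennreal (V c r powr (- a))) powe (1 / s') =
      J \<phi> (ball c r) powe (1 / p) * ennreal (V c r powr (- (1 / q)))"
    using s' by (simp add: powe_mult powe_powe powr_powr a_def)
  finally show ?thesis .
qed

text \<open>In terms of \<open>P = p / s'\<close> and \<open>Q = q / s'\<close> we have \<open>a = 1 / Q\<close> and \<open>b = 1 - 1 / P\<close>. The exponent \<open>\<tau>\<close> is
  chosen so that \<open>\<tau> * P = 1 + a / b\<close>, because \<open>\<sigma> = u powr (- a / b)\<close>.\<close>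

definition \<tau> :: real where "\<tau> = (1 - b) * (a + b) / b"

lemma b_less_1: "b < 1" using s' by (simp add: b_def)

lemma \<tau>_pos: "0 < \<tau>"
  using b_less_1 a_pos b_pos by (simp add: \<tau>_def)

lemma \<tau>_eq: "\<tau> * p / s' = (a + b) / b" "(a + b) / b - \<tau> = a + b" "\<tau> - a / b = 1 - (a + b)"
proof -
  have 1: "1 - b = s' / p" by (simp add: b_def)
  show "\<tau> * p / s' = (a + b) / b"
    unfolding \<tau>_def 1 using s' by simp
  show "(a + b) / b - \<tau> = a + b" "\<tau> - a / b = 1 - (a + b)"
    unfolding \<tau>_def using b_pos by (simp_all add: field_simps)
qed

text \<open>Division by \<open>\<sigma>\<close> makes the integral of \<open>h \<phi>\<close>
  against \<open>\<sigma>\<close> equal to the Lebesgue integral of \<open>\<phi> powe s'\<close>.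
  The division by \<open>u\<close> in \<open>g\<close> has the same purpose.\<close>

definition h :: "('a \<Rightarrow> ennreal) \<Rightarrow> 'a \<Rightarrow> ennreal" where
  "h \<phi> y = \<phi> y powe s' * ennreal (1 / \<sigma> y)"

definition g :: "('a \<Rightarrow> ennreal) \<Rightarrow> 'a \<Rightarrow> ennreal" where
  "g \<phi> y = max_fn (wmeasure \<sigma>) (h \<phi>) y powe (1 / \<tau>) * ennreal (1 / u y)"

definition N :: "('a \<Rightarrow> ennreal) \<Rightarrow> 'a \<Rightarrow> ennreal" where
  "N \<phi> x = max_fn (wmeasure u) (g \<phi>) x powe (\<tau> / s')"

lemma measurable_hgN [measurable]:
  assumes [measurable]: "\<phi> \<in> borel_measurable borel"
  shows "h \<phi> \<in> borel_measurable borel" "g \<phi> \<in> borel_measurable borel" "N \<phi> \<in> borel_measurable borel"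
  unfolding h_def[abs_def] g_def[abs_def] N_def[abs_def] by measurable

definition CB :: real where "CB = (C powr (1 / b) * \<omega> powr (a + b)) powr (1 / s')"

lemma cancel_weight: "0 < c \<Longrightarrow> ennreal c * (X * ennreal (1 / c)) = X"
  by (simp add: mult.left_commute flip: ennreal_mult)

text \<open>The \<sigma>-average of \<open>h \<phi>\<close> bounds the \<sigma>-maximal function
  from below on the entire ball. Taking the power \<open>1 / \<tau>\<close> and integrating over the
  ball gives a lower bound for the \<open>u\<close>-integral of \<open>g \<phi>\<close>, hence for
  the \<open>u\<close>-maximal function at any \<open>x\<close> in the ball. The \<sigma>-mass left
  over is eliminated by the Muckenhoupt condition.\<close>

lemma integral_ball_le_max_fn:
  assumes r: "0 < r" and x: "x \<in> ball c r" and [measurable]: "\<phi> \<in> borel_measurable borel"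
  shows "(\<integral>\<^sup>+y\<in>ball c r. \<phi> y powe s' \<partial>lborel) \<le>
     ennreal (C powr (1 / b) * (\<omega> * r powr n) powr (a + b)) *
     (ennreal (V c r powr (1 - (a + b))) * max_fn (wmeasure u) (g \<phi>) x powe \<tau>)"
proof -
  let ?B = "ball c r"
  define X where "X = (\<integral>\<^sup>+y\<in>?B. \<phi> y powe s' \<partial>lborel)"
  define N0 where "N0 = max_fn (wmeasure u) (g \<phi>) x"
  define L where "L = \<omega> * r powr n"
  have L: "0 < L" "emeasure lborel ?B = ennreal L"
    using r \<omega>_pos by (simp_all add: L_def emeasure_ball_eq_content ball_vol)
  have Vp: "0 < V c r" "0 < D.V c r"
    using V_pos D.V_pos r by auto
  have X_h: "X = (\<integral>\<^sup>+y\<in>?B. h \<phi> y \<partial>wmeasure \<sigma>)"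
    unfolding X_def by (subst nn_integral_wmeasure)
      (auto simp: h_def mult.assoc[symmetric] cancel_weight[OF \<sigma>_pos, unfolded mult.assoc[symmetric]])
  have low: "ennreal (1 / D.V c r) * X \<le> max_fn (wmeasure \<sigma>) (h \<phi>) y" if "y \<in> ?B" for y
  proof -
    have "ennreal (1 / D.V c r) * X = X / emeasure (wmeasure \<sigma>) ?B"
      using Vp by (simp add: D.emeasure_V divide_ennreal_def inverse_ennreal mult.commute divide_inverse)
    also have "\<dots> \<le> max_fn (wmeasure \<sigma>) (h \<phi>) y"
      unfolding X_h by (rule max_fn_upper) (use r that in auto)
    finally show ?thesis .
  qed
  have "ennreal L * (ennreal (1 / D.V c r) * X) powe (1 / \<tau>) =
      (\<integral>\<^sup>+y\<in>?B. (ennreal (1 / D.V c r) * X) powe (1 / \<tau>) \<partial>lborel)"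
    by (subst nn_integral_cmult_indicator) (auto simp: L(2) mult.commute)
  also have "\<dots> \<le> (\<integral>\<^sup>+y\<in>?B. max_fn (wmeasure \<sigma>) (h \<phi>) y powe (1 / \<tau>) \<partial>lborel)"
    using \<tau>_pos by (intro nn_integral_mono) (auto simp: indicator_def intro!: powe_mono low)
  also have "\<dots> = (\<integral>\<^sup>+y\<in>?B. g \<phi> y \<partial>wmeasure u)"
    by (subst nn_integral_wmeasure)
      (auto simp: g_def mult.assoc[symmetric] cancel_weight[OF u_pos, unfolded mult.assoc[symmetric]])
  also have "\<dots> = ennreal (V c r) * ((\<integral>\<^sup>+y\<in>?B. g \<phi> y \<partial>wmeasure u) / emeasure (wmeasure u) ?B)"
    using Vp by (subst mult.commute) (simp add: emeasure_V ennreal_divide_times ennreal_divide_self)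
  also have "\<dots> \<le> ennreal (V c r) * N0"
    unfolding N0_def using r x by (intro mult_left_mono max_fn_upper) auto
  finally have "(ennreal (1 / D.V c r) * X) powe (1 / \<tau>) \<le> ennreal (1 / L) * (ennreal (V c r) * N0)"
    by (rule ennreal_mult_le_imp[OF L(1)])
  also have "\<dots> = ennreal (V c r / L) * N0"
    using L Vp by (simp add: mult.assoc[symmetric] flip: ennreal_mult)
  finally have "ennreal (1 / D.V c r) * X \<le> (ennreal (V c r / L) * N0) powe \<tau>"
    using \<tau>_pos by (subst (asm) powe_le_iff) auto
  also have "\<dots> = ennreal ((V c r / L) powr \<tau>) * N0 powe \<tau>"
    using Vp L by (simp add: powe_mult)
  finally have "X \<le> ennreal (1 / (1 / D.V c r)) * (ennreal ((V c r / L) powr \<tau>) * N0 powe \<tau>)"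
    using Vp by (intro ennreal_mult_le_imp) auto
  then have "X \<le> ennreal (D.V c r * (V c r / L) powr \<tau>) * N0 powe \<tau>"
    by (simp add: ennreal_mult mult.assoc)
  also have "\<dots> \<le> ennreal (C powr (1 / b) * L powr (a + b) * V c r powr (1 - (a + b))) * N0 powe \<tau>"
  proof (intro mult_right_mono ennreal_leI)
    have "V c r powr a * D.V c r powr b \<le> C * L powr (a + b)"
      using A_cond[OF r, of c] r by (simp add: ball_vol L_def)
    then have "D.V c r powr b \<le> C * L powr (a + b) * V c r powr (- a)"
      using Vp by (simp add: powr_minus field_simps)
    then have "(D.V c r powr b) powr (1 / b) \<le> (C * L powr (a + b) * V c r powr (- a)) powr (1 / b)"
      using b_pos by (intro powr_mono2) auto
    then have "D.V c r \<le> C powr (1 / b) * L powr ((a + b) / b) * V c r powr (- a / b)"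
      using b_pos C_pos L Vp by (simp add: powr_powr powr_mult)
    then have "D.V c r * (V c r / L) powr \<tau> \<le>
        C powr (1 / b) * L powr ((a + b) / b) * V c r powr (- a / b) * (V c r / L) powr \<tau>"
      by (intro mult_right_mono) auto
    \<comment> \<open>By the choice of \<open>\<tau>\<close> these exponents are
      \<open>a + b\<close> for the volume and \<open>1 - (a + b)\<close> for \<open>V\<close>, as
      the cancellation of \<open>r\<close> in \<open>t_scale\<close> demands.\<close>
    also have "\<dots> = C powr (1 / b) * L powr ((a + b) / b - \<tau>) * V c r powr (\<tau> - a / b)"
      using Vp L by (simp add: powr_divide powr_diff powr_minus field_simps)
    finally show "D.V c r * (V c r / L) powr \<tau> \<le> C powr (1 / b) * L powr (a + b) * V c r powr (1 - (a + b))"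
      by (simp only: \<tau>_eq)
  qed simp
  also have "\<dots> = ennreal (C powr (1 / b) * L powr (a + b)) * (ennreal (V c r powr (1 - (a + b))) * N0 powe \<tau>)"
    by (subst ennreal_mult) (auto simp: mult.assoc)
  finally show ?thesis unfolding X_def N0_def L_def .
qed

lemma t_le_N:
  assumes r: "0 < r" and [measurable]: "\<phi> \<in> borel_measurable borel"
  shows "t \<phi> x r \<le> ennreal CB * (ennreal (V x r powr (1 / p - 1 / q)) * N \<phi> x)"
proof -
  have "t \<phi> x r \<le> ennreal (r powr (d - n / s')) *
      (ennreal (C powr (1 / b) * (\<omega> * r powr n) powr (a + b)) *
     (ennreal (V x r powr (1 - (a + b))) * max_fn (wmeasure u) (g \<phi>) x powe \<tau>)) powe (1 / s')"
    unfolding t_def using s' r by (intro mult_left_mono powe_mono integral_ball_le_max_fn) auto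
  also have "\<dots> = ennreal CB * (ennreal (V x r powr (1 - (a + b))) * max_fn (wmeasure u) (g \<phi>) x powe \<tau>) powe (1 / s')"
    unfolding CB_def by (rule t_scale) (use r C_pos in auto)
  also have "(ennreal (V x r powr (1 - (a + b))) * max_fn (wmeasure u) (g \<phi>) x powe \<tau>) powe (1 / s') =
     ennreal (V x r powr (1 / p - 1 / q)) * N \<phi> x"
    using s' by (simp add: exponent_sum(2) powe_mult powe_powe powr_powr N_def)
  finally show ?thesis .
qed

text \<open>Two maximal theorems in succession: for \<open>u\<close> at exponent
  \<open>e = 1 + a / b\<close>, then for \<open>\<sigma>\<close> at exponent \<open>P\<close>. The
  definition of \<open>\<tau>\<close> makes the exponents of the nested functions match.\<close>

lemma N_bound_ex: "\<exists>K\<ge>0. \<forall>\<phi>\<in>borel_measurable borel. (\<integral>\<^sup>+x. N \<phi> x powe p * ennreal (u x) \<partial>lborel) \<le> ennreal K * J \<phi> UNIV"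
proof -
  interpret U: doubling_measure "wmeasure u" dbl by (rule doubling_wmeasure)
  interpret S: doubling_measure "wmeasure \<sigma>" D.dbl by (rule D.doubling_wmeasure)
  define e where "e = (a + b) / b"
  have e: "1 < e" using a_pos b_pos by (simp add: e_def)
  define P where "P = p / s'"
  have P: "1 < P" using s' by (simp add: P_def)
  have e': "e = \<tau> * P" using \<tau>_eq(1) by (simp add: e_def P_def)
  define K1 where "K1 = 2 powr e * dbl * e / (e - 1)"
  define K2 where "K2 = 2 powr P * D.dbl * P / (P - 1)"
  have K: "0 \<le> K1" "0 \<le> K2"
    using e P by (auto simp: K1_def K2_def dbl_def D.dbl_def)
  have "(\<integral>\<^sup>+x. N \<phi> x powe p * ennreal (u x) \<partial>lborel) \<le> ennreal (K1 * K2) * J \<phi> UNIV"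
    if [measurable]: "\<phi> \<in> borel_measurable borel" for \<phi>
  proof -
    have "(\<integral>\<^sup>+x. N \<phi> x powe p * ennreal (u x) \<partial>lborel) =
        (\<integral>\<^sup>+x. max_fn (wmeasure u) (g \<phi>) x powe e \<partial>wmeasure u)"
      by (subst nn_integral_wmeasure) (auto simp: N_def powe_powe e' P_def mult.commute)
    also have "\<dots> \<le> ennreal K1 * (\<integral>\<^sup>+x. g \<phi> x powe e \<partial>wmeasure u)"
      unfolding K1_def by (rule U.max_fn_bound) (use e in auto)
    also have "(\<integral>\<^sup>+x. g \<phi> x powe e \<partial>wmeasure u) =
        (\<integral>\<^sup>+x. ennreal (u x) * (max_fn (wmeasure \<sigma>) (h \<phi>) x powe P * ennreal (u x powr (- e))) \<partial>lborel)"
    proof (subst nn_integral_wmeasure, simp, simp, intro nn_integral_cong)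
      fix x
      have "1 / \<tau> * e = P" using \<tau>_pos by (simp add: e')
      moreover have "(1 / u x) powr e = u x powr (- e)"
        using u_pos[of x] by (simp add: powr_divide powr_minus_divide)
      ultimately show "ennreal (u x) * g \<phi> x powe e =
         ennreal (u x) * (max_fn (wmeasure \<sigma>) (h \<phi>) x powe P * ennreal (u x powr (- e)))"
        using u_pos[of x] by (simp add: g_def powe_mult powe_powe less_imp_le)
    qed
    \<comment> \<open>Duality of the weights gives \<open>u powr (1 - e) = \<sigma>\<close>, so the
      integral passes from the measure of \<open>u\<close> to that of
      \<open>\<sigma>\<close>.\<close>
    also have "\<dots> = (\<integral>\<^sup>+x. max_fn (wmeasure \<sigma>) (h \<phi>) x powe P \<partial>wmeasure \<sigma>)"
    proof (subst nn_integral_wmeasure, simp, simp, intro nn_integral_cong)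
      fix x
      have up: "0 < u x" "0 < \<sigma> x" using u_pos \<sigma>_pos by auto
      have "(u x powr a * \<sigma> x powr b) powr (1 / b) = 1" by (simp add: dual)
      then have "u x powr (a / b) * \<sigma> x = 1"
        using up b_pos by (simp add: powr_mult powr_powr)
      then have "\<sigma> x = u x powr (- (a / b))"
        using up by (simp add: powr_minus field_simps)
      moreover have "u x * u x powr (- e) = u x powr (1 + (- e))"
        using up by (subst powr_add) simp
      moreover have "1 + (- e) = - (a / b)"
        using b_pos by (simp add: e_def field_simps)
      ultimately have "u x * u x powr (- e) = \<sigma> x" by metis
      then have "ennreal (\<sigma> x) = ennreal (u x) * ennreal (u x powr (- e))"
        using up by (simp flip: ennreal_mult)
      then show "ennreal (u x) * (max_fn (wmeasure \<sigma>) (h \<phi>) x powe P * ennreal (u x powr (- e))) =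
          ennreal (\<sigma> x) * max_fn (wmeasure \<sigma>) (h \<phi>) x powe P"
        by (simp add: ac_simps)
    qed
    also have "\<dots> \<le> ennreal K2 * (\<integral>\<^sup>+x. h \<phi> x powe P \<partial>wmeasure \<sigma>)"
      unfolding K2_def by (rule S.max_fn_bound) (use P in auto)
    also have "(\<integral>\<^sup>+x. h \<phi> x powe P \<partial>wmeasure \<sigma>) = J \<phi> UNIV"
      unfolding J_def
    proof (subst nn_integral_wmeasure, simp, simp, intro nn_integral_cong)
      fix x
      have up: "0 < u x" "0 < \<sigma> x" using u_pos \<sigma>_pos by auto
      \<comment> \<open>This writes \<open>\<sigma> powr (1 - P)\<close> as a power of
        \<open>\<sigma> powr b\<close>, which duality converts into \<open>u powr (a * P)\<close>,
        that is \<open>u powr (p / q)\<close>.\<close>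
      have Pb: "1 - P = b * (- P)" using s' by (simp add: P_def b_def field_simps)
      have "\<sigma> x * (1 / \<sigma> x) powr P = \<sigma> x powr (1 - P)"
        using up by (simp add: powr_divide powr_diff)
      also have "\<dots> = (\<sigma> x powr b) powr (- P)"
        unfolding Pb powr_powr ..
      also have "\<sigma> x powr b = u x powr (- a)"
        using dual[of x] up by (simp add: powr_minus field_simps)
      also have "(u x powr (- a)) powr (- P) = u x powr (p / q)"
        using s' by (simp add: powr_powr a_def P_def)
      finally have "ennreal (u x powr (p / q)) = ennreal (\<sigma> x) * ennreal ((1 / \<sigma> x) powr P)"
        using up by (simp flip: ennreal_mult)
      then show "ennreal (\<sigma> x) * h \<phi> x powe P = \<phi> x powe p * ennreal (u x powr (p / q)) * indicator UNIV x"
        using up s' by (simp add: h_def powe_mult powe_powe P_def ac_simps)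
    qed
    finally show ?thesis
      using K by (simp add: ennreal_mult mult.assoc mult_left_mono)
  qed
  then show ?thesis using K by (intro exI[of _ "K1 * K2"]) auto
qed

end

section \<open>Rough fractional integrals\<close>

lemma suminf_cmult_mult_ennreal:
  "(\<Sum>j. c * (X * f j)) = c * X * (\<Sum>j. f j :: ennreal)"
  by (simp add: mult.assoc)

lemma ennreal_collect_constants:
  assumes "0 \<le> A" "0 \<le> B" "0 \<le> v" "0 \<le> c"
  shows "ennreal A * (ennreal B * X * ennreal (v / c)) = ennreal (A * B / c) * (ennreal v * X)"
proof -
  have "ennreal (v / c) = ennreal v * ennreal (1 / c)" "ennreal (A * B / c) = ennreal A * ennreal B * ennreal (1 / c)"
    using assms by (simp_all flip: ennreal_mult)
  then show ?thesis by (simp add: ac_simps)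
qed

text \<open>The index is the predecessor of the least \<open>k\<close> with
  \<open>r / 2 ^ k \<le> x\<close>; it exists because \<open>x < r\<close> excludes
  \<open>k = 0\<close>.\<close>

lemma ex_dyadic_annulus:
  fixes x r :: real
  assumes "0 < x" "x < r"
  shows "\<exists>j::nat. x < r / 2 ^ j \<and> r / 2 ^ j / 2 \<le> x"
proof -
  obtain k :: nat where k: "r / 2 ^ k < x"
  proof -
    obtain k where "(1/2) ^ k < x / r"
      using real_arch_pow_inv[of "x / r" "1/2"] assms by auto
    then show thesis using assms that[of k] by (simp add: field_simps power_divide)
  qed
  define j where "j = (LEAST k. r / 2 ^ k \<le> x)"
  have j: "r / 2 ^ j \<le> x" "\<And>i. i < j \<Longrightarrow> x < r / 2 ^ i"
    unfolding j_def using k LeastI[of "\<lambda>k. r / 2 ^ k \<le> x" k] not_less_Least[of _ "\<lambda>k. r / 2 ^ k \<le> x"]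
    by (auto simp: not_le)
  then have "j \<noteq> 0" using assms by (metis div_by_1 linorder_not_less power_0)
  then obtain i where "j = Suc i" using not0_implies_Suc by blast
  with j have "x < r / 2 ^ i \<and> r / 2 ^ i / 2 \<le> x" by (simp add: mult.commute)
  then show ?thesis by blast
qed

text \<open>Outer radii start at \<open>2 * r\<close>, so that the annulus of index 0 begins at
  \<open>r\<close>.\<close>

lemma ex_dyadic_annulus_outer:
  fixes x r :: real
  assumes "0 < r" "r \<le> x"
  shows "\<exists>j::nat. x < 2 ^ j * (2 * r) \<and> 2 ^ j * (2 * r) / 2 \<le> x"
proof -
  obtain k where k: "x < 2 ^ k * r"
    using real_arch_pow[of 2 "x / r"] assms by (auto simp: field_simps)
  define j where "j = (LEAST k. x < 2 ^ k * r)"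
  have j: "x < 2 ^ j * r" "\<And>i. i < j \<Longrightarrow> 2 ^ i * r \<le> x"
    unfolding j_def using k LeastI[of "\<lambda>k. x < 2 ^ k * r" k] not_less_Least[of _ "\<lambda>k. x < 2 ^ k * r"]
    by (auto simp: not_less)
  then have "j \<noteq> 0" using assms by (metis linorder_not_less mult_1 power_0)
  then obtain i where "j = Suc i" using not0_implies_Suc by blast
  with j have "x < 2 ^ i * (2 * r) \<and> 2 ^ i * (2 * r) / 2 \<le> x" by (auto simp: mult.commute mult.left_commute)
  then show ?thesis by blast
qed

text \<open>Here \<open>\<Omega>\<close> stands for the modulus of the kernel. Homogeneity and
  integrability on the sphere enter only through the growth of the mass of
  \<open>\<Omega> powr s\<close> on balls about the origin.\<close>

locale rough_potential = potential_pair u \<sigma> a b C n d s s' p q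
  for u \<sigma> :: "'a::euclidean_space \<Rightarrow> real" and a b C n d s s' p q +
  fixes \<Omega> :: "'a \<Rightarrow> real" and K :: real
  assumes \<Omega>_borel [measurable]: "\<Omega> \<in> borel_measurable borel"
    and \<Omega>_nonneg: "\<And>z. 0 \<le> \<Omega> z" and K: "0 \<le> K"
    and \<Omega>_int: "\<And>r. 0 < r \<Longrightarrow> (\<integral>\<^sup>+z\<in>ball 0 r. ennreal (\<Omega> z powr s) \<partial>lborel) \<le> ennreal (K * r powr n)"
begin

definition k :: "'a \<Rightarrow> real" where
  "k z = \<Omega> z * norm z powr (d - n)"

lemma k_borel [measurable]: "k \<in> borel_measurable borel"
  unfolding k_def[abs_def] by measurable

lemma k_nonneg: "0 \<le> k z" by (simp add: k_def \<Omega>_nonneg)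

text \<open>Valued in [0, \<infinity>], so that splitting and estimating precede any question of
  convergence.\<close>

definition T :: "('a \<Rightarrow> ennreal) \<Rightarrow> 'a \<Rightarrow> 'a set \<Rightarrow> ennreal" where
  "T \<phi> x A = (\<integral>\<^sup>+y\<in>A. ennreal (k (x - y)) * \<phi> y \<partial>lborel)"

lemma T_measurable [measurable]:
  assumes [measurable]: "\<phi> \<in> borel_measurable borel" "A \<in> sets borel"
  shows "(\<lambda>x. T \<phi> x A) \<in> borel_measurable borel"
  unfolding T_def by measurable

definition CT :: real where "CT = 2 powr (n - d) * K powr (1 / s)"

lemma \<Omega>_translate:
  assumes "0 < r"
  shows "(\<integral>\<^sup>+y\<in>ball x r. ennreal (\<Omega> (x - y) powr s) \<partial>lborel) \<le> ennreal (K * r powr n)"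
proof -
  have "(\<integral>\<^sup>+y\<in>ball x r. ennreal (\<Omega> (x - y) powr s) \<partial>lborel) =
      (\<integral>\<^sup>+y. ennreal (\<Omega> (x - y) powr s) * indicator (ball 0 r) (x - y) \<partial>lborel)"
    by (intro nn_integral_cong) (auto simp: indicator_def dist_norm norm_minus_commute)
  also have "\<dots> = (\<integral>\<^sup>+z\<in>ball 0 r. ennreal (\<Omega> z powr s) \<partial>lborel)"
  proof -
    have "lborel = distr lborel borel (\<lambda>y. x - y)"
      using lborel_affine[of "-1" x] by (simp add: density_1)
    then have "(\<integral>\<^sup>+z\<in>ball 0 r. ennreal (\<Omega> z powr s) \<partial>lborel) =
        (\<integral>\<^sup>+z\<in>ball 0 r. ennreal (\<Omega> z powr s) \<partial>distr lborel borel (\<lambda>y. x - y))"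
      by simp
    also have "\<dots> = (\<integral>\<^sup>+y. ennreal (\<Omega> (x - y) powr s) * indicator (ball 0 r) (x - y) \<partial>lborel)"
      by (rule nn_integral_distr) measurable
    finally show ?thesis by simp
  qed
  also have "\<dots> \<le> ennreal (K * r powr n)" by (rule \<Omega>_int[OF assms])
  finally show ?thesis .
qed

text \<open>On the annulus the distance is at least \<open>r / 2\<close> and \<open>d - n\<close> is
  negative, which costs \<open>2 powr (n - d)\<close>; Hoelder's inequality with \<open>s\<close>
  and \<open>s'\<close> contributes \<open>K powr (1 / s)\<close>.\<close>

lemma T_annulus:
  assumes r: "0 < r" and [measurable]: "\<phi> \<in> borel_measurable borel"
  shows "T \<phi> x (ball x r - ball x (r / 2)) \<le> ennreal CT * t \<phi> x r"
proof -
  let ?B = "ball x r"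
  have s1: "1 - 1 / s = 1 / s'" using conj by simp
  have "T \<phi> x (ball x r - ball x (r / 2)) \<le>
     (\<integral>\<^sup>+y. ennreal ((r / 2) powr (d - n)) *
       ((ennreal (\<Omega> (x - y) powr s) * indicator ?B y) powe (1 / s) * (\<phi> y powe s' * indicator ?B y) powe (1 - 1 / s)) \<partial>lborel)"
    unfolding T_def
  proof (intro nn_integral_mono)
    fix y
    show "ennreal (k (x - y)) * \<phi> y * indicator (ball x r - ball x (r / 2)) y \<le>
      ennreal ((r / 2) powr (d - n)) *
       ((ennreal (\<Omega> (x - y) powr s) * indicator ?B y) powe (1 / s) * (\<phi> y powe s' * indicator ?B y) powe (1 - 1 / s))"
    proof (cases "y \<in> ball x r - ball x (r / 2)")
      case True
      then have "r / 2 \<le> norm (x - y)" by (auto simp: dist_norm)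
      then have "norm (x - y) powr (d - n) \<le> (r / 2) powr (d - n)"
        using d r by (intro powr_mono2') auto
      then have "k (x - y) \<le> (r / 2) powr (d - n) * \<Omega> (x - y)"
        unfolding k_def using \<Omega>_nonneg[of "x - y"] by (simp add: mult.commute mult_left_mono)
      then have "ennreal (k (x - y)) * \<phi> y \<le> ennreal ((r / 2) powr (d - n) * \<Omega> (x - y)) * \<phi> y"
        by (intro mult_right_mono ennreal_leI) auto
      also have "\<dots> = ennreal ((r / 2) powr (d - n)) *
          (ennreal (\<Omega> (x - y) powr s) powe (1 / s) * (\<phi> y powe s') powe (1 - 1 / s))"
        using s s' \<Omega>_nonneg[of "x - y"] unfolding s1 by (simp add: powr_powr powe_powe ennreal_mult mult.assoc)
      finally show ?thesis using True by simp
    qed simp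
  qed
  also have "\<dots> = ennreal ((r / 2) powr (d - n)) *
     (\<integral>\<^sup>+y. (ennreal (\<Omega> (x - y) powr s) * indicator ?B y) powe (1 / s) * (\<phi> y powe s' * indicator ?B y) powe (1 - 1 / s) \<partial>lborel)"
    by (rule nn_integral_cmult) measurable
  also have "\<dots> \<le> ennreal ((r / 2) powr (d - n)) *
     ((\<integral>\<^sup>+y\<in>?B. ennreal (\<Omega> (x - y) powr s) \<partial>lborel) powe (1 / s) * (\<integral>\<^sup>+y\<in>?B. \<phi> y powe s' \<partial>lborel) powe (1 - 1 / s))"
    using s by (intro mult_left_mono nn_integral_Hoelder) auto
  also have "\<dots> \<le> ennreal ((r / 2) powr (d - n)) *
     (ennreal (K * r powr n) powe (1 / s) * (\<integral>\<^sup>+y\<in>?B. \<phi> y powe s' \<partial>lborel) powe (1 - 1 / s))"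
    using s by (intro mult_left_mono mult_right_mono powe_mono \<Omega>_translate r) auto
  also have "\<dots> = ennreal ((r / 2) powr (d - n) * (K * r powr n) powr (1 / s)) * (\<integral>\<^sup>+y\<in>?B. \<phi> y powe s' \<partial>lborel) powe (1 / s')"
    unfolding s1 using K by (subst ennreal_mult) (auto simp: mult.assoc)
  also have "(r / 2) powr (d - n) * (K * r powr n) powr (1 / s) = CT * r powr (d - n / s')"
  proof -
    have "d - n / s' = (d - n) + n * (1 / s)"
    proof -
      have "n * (1 / s + 1 / s') = n" using conj by simp
      then show ?thesis by (simp add: algebra_simps)
    qed
    then have "r powr (d - n / s') = r powr (d - n) * r powr (n * (1 / s))"
      by (simp only: powr_add)
    moreover have "(r / 2) powr (d - n) = r powr (d - n) * 2 powr (n - d)"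
      using r powr_minus_divide[of 2 "d - n"] by (simp add: powr_divide)
    moreover have "(K * r powr n) powr (1 / s) = K powr (1 / s) * r powr (n * (1 / s))"
      using K by (simp add: powr_mult powr_powr)
    ultimately show ?thesis
      by (simp add: CT_def)
  qed
  finally show ?thesis
    unfolding t_def CT_def by (simp add: ennreal_mult mult.assoc)
qed

lemma T_sum:
  assumes r: "\<And>j. 0 < r j" and cover: "\<And>y. y \<in> A \<Longrightarrow> y \<noteq> x \<Longrightarrow> \<exists>j::nat. y \<in> ball x (r j) - ball x (r j / 2)"
    and [measurable]: "\<phi> \<in> borel_measurable borel" 
  shows "T \<phi> x A \<le> ennreal CT * (\<Sum>j. t \<phi> x (r j))"
proof -
  let ?A = "\<lambda>j. ball x (r j) - ball x (r j / 2)"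
  have "T \<phi> x A \<le> (\<integral>\<^sup>+y. (\<Sum>j. ennreal (k (x - y)) * \<phi> y * indicator (?A j) y) \<partial>lborel)"
    unfolding T_def
  proof (intro nn_integral_mono)
    fix y
    show "ennreal (k (x - y)) * \<phi> y * indicator A y \<le> (\<Sum>j. ennreal (k (x - y)) * \<phi> y * indicator (?A j) y)"
    proof (cases "y \<in> A \<and> y \<noteq> x")
      case True
      then obtain j where j: "y \<in> ?A j" using cover by blast
      have "ennreal (k (x - y)) * \<phi> y * indicator A y = (\<Sum>i\<in>{j}. ennreal (k (x - y)) * \<phi> y * indicator (?A i) y)"
        using True j by simp
      also have "\<dots> \<le> (\<Sum>i. ennreal (k (x - y)) * \<phi> y * indicator (?A i) y)"
        by (intro sum_le_suminf) auto
      finally show ?thesis .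
    \<comment> \<open>At \<open>y = x\<close> the kernel is 0 because
      \<open>0 powr (d - n) = 0\<close>, so the annuli may miss the centre.\<close>
    qed (auto simp: k_def indicator_def)
  qed
  also have "\<dots> = (\<Sum>j. T \<phi> x (?A j))"
    unfolding T_def by (rule nn_integral_suminf) measurable
  also have "\<dots> \<le> (\<Sum>j. ennreal CT * t \<phi> x (r j))"
    by (intro suminf_le summableI T_annulus r) auto
  finally show ?thesis by simp
qed

lemma T_near:
  assumes r: "0 < r" and [measurable]: "\<phi> \<in> borel_measurable borel"
  shows "T \<phi> x (ball x r) \<le> ennreal CT * (\<Sum>j. t \<phi> x (r / 2 ^ j))"
proof (rule T_sum)
  fix y assume "y \<in> ball x r" "y \<noteq> x"
  then show "\<exists>j. y \<in> ball x (r / 2 ^ j) - ball x (r / 2 ^ j / 2)"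
    using ex_dyadic_annulus[of "dist x y" r] by (auto simp: not_less)
qed (use r in auto)

lemma T_far:
  assumes r: "0 < r" and [measurable]: "\<phi> \<in> borel_measurable borel"
  shows "T \<phi> x (- ball x r) \<le> ennreal CT * (\<Sum>j. t \<phi> x (2 ^ j * (2 * r)))"
proof (rule T_sum)
  fix y assume "y \<in> - ball x r" "y \<noteq> x"
  then show "\<exists>j. y \<in> ball x (2 ^ j * (2 * r)) - ball x (2 ^ j * (2 * r) / 2)"
    using ex_dyadic_annulus_outer[of r "dist x y"] r by (auto simp: not_less)
qed (use r in auto)

section \<open>Near and far parts of the potential\<close>

lemma T_split:
  assumes [measurable]: "\<phi> \<in> borel_measurable borel" "A \<in> sets borel"
  shows "T \<phi> x UNIV = T \<phi> x A + T \<phi> x (- A)"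
proof -
  have "T \<phi> x UNIV = (\<integral>\<^sup>+y. ennreal (k (x - y)) * \<phi> y * indicator A y + ennreal (k (x - y)) * \<phi> y * indicator (- A) y \<partial>lborel)"
    unfolding T_def by (intro nn_integral_cong) (auto simp: indicator_def)
  also have "\<dots> = T \<phi> x A + T \<phi> x (- A)"
    unfolding T_def by (rule nn_integral_add) measurable
  finally show ?thesis .
qed

lemma T_mono: "A \<subseteq> B \<Longrightarrow> T \<phi> x A \<le> T \<phi> x B"
  unfolding T_def by (intro nn_integral_mono) (auto simp: indicator_def)

text \<open>\<open>N \<phi> x\<close> is independent of the radius and leaves the sum, which then
  consists of positive powers of \<open>V\<close> at shrinking radii.\<close>

lemma near_bound:
  assumes r: "0 < r" and [measurable]: "\<phi> \<in> borel_measurable borel"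
  shows "T \<phi> x (ball x r) \<le> ennreal (CT * CB / (1 - \<theta> powr (1 / p - 1 / q))) * (ennreal (V x r powr (1 / p - 1 / q)) * N \<phi> x)"
proof -
  let ?e = "1 / p - 1 / q"
  have e: "0 < ?e" using q d by simp
  have "T \<phi> x (ball x r) \<le> ennreal CT * (\<Sum>j. t \<phi> x (r / 2 ^ j))"
    by (rule T_near[OF r]) measurable
  also have "\<dots> \<le> ennreal CT * (\<Sum>j. ennreal CB * (N \<phi> x * ennreal (V x (r / 2 ^ j) powr ?e)))"
    using r by (intro mult_left_mono suminf_le summableI) (auto intro!: t_le_N simp: mult.commute[of "N \<phi> x"])
  also have "\<dots> = ennreal CT * (ennreal CB * N \<phi> x * (\<Sum>j. ennreal (V x (r / 2 ^ j) powr ?e)))"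
    by (subst suminf_cmult_mult_ennreal) simp
  also have "\<dots> \<le> ennreal CT * (ennreal CB * N \<phi> x * ennreal (V x r powr ?e / (1 - \<theta> powr ?e)))"
    by (intro mult_left_mono sum_V_small r e) auto
  also have "\<dots> = ennreal (CT * CB / (1 - \<theta> powr ?e)) * (ennreal (V x r powr ?e) * N \<phi> x)"
    using geometric_powr(2)[OF e] by (intro ennreal_collect_constants) (auto simp: CT_def CB_def)
  finally show ?thesis .
qed

text \<open>With \<open>\<kappa> = 0\<close> this is the far part in the \<open>L\<^sup>p\<close>-\<open>L\<^sup>q\<close> bound, with \<open>\<kappa> > 0\<close> the far part in
  the Morrey bound.\<close>

lemma far_bound:
  assumes r: "0 < r" and [measurable]: "\<phi> \<in> borel_measurable borel"
    and \<kappa>: "\<kappa> / p < 1 / q"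
    and J: "\<And>r. 0 < r \<Longrightarrow> J \<phi> (ball x r) powe (1 / p) \<le> M * ennreal (V x r powr (\<kappa> / p))"
  shows "T \<phi> x (- ball x r) \<le> ennreal (CT * CA / (1 - \<theta> powr (1 / q - \<kappa> / p))) *
    (ennreal (V x (2 * r) powr (- (1 / q - \<kappa> / p))) * M)"
proof -
  let ?e = "1 / q - \<kappa> / p"
  have e: "0 < ?e" using \<kappa> by simp
  have "T \<phi> x (- ball x r) \<le> ennreal CT * (\<Sum>j. t \<phi> x (2 ^ j * (2 * r)))"
    by (rule T_far[OF r]) measurable
  also have "\<dots> \<le> ennreal CT * (\<Sum>j. ennreal CA * (M * ennreal (V x (2 ^ j * (2 * r)) powr (- ?e))))"
  proof (intro mult_left_mono suminf_le summableI)
    fix j :: nat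
    let ?r = "2 ^ j * (2 * r)"
    have r': "0 < ?r" using r by simp
    have "t \<phi> x ?r \<le> ennreal CA * (J \<phi> (ball x ?r) powe (1 / p) * ennreal (V x ?r powr (- (1 / q))))"
      by (rule t_le_J[OF r']) measurable
    also have "\<dots> \<le> ennreal CA * (M * ennreal (V x ?r powr (\<kappa> / p)) * ennreal (V x ?r powr (- (1 / q))))"
      by (intro mult_left_mono mult_right_mono J r') auto
    also have "\<dots> = ennreal CA * (M * ennreal (V x ?r powr (- ?e)))"
      by (simp add: mult.assoc flip: ennreal_mult powr_add)
    finally show "t \<phi> x ?r \<le> ennreal CA * (M * ennreal (V x ?r powr (- ?e)))" .
  qed simp
  also have "\<dots> = ennreal CT * (ennreal CA * M * (\<Sum>j. ennreal (V x (2 ^ j * (2 * r)) powr (- ?e))))"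
    by (subst suminf_cmult_mult_ennreal) simp
  also have "\<dots> \<le> ennreal CT * (ennreal CA * M * ennreal (V x (2 * r) powr (- ?e) / (1 - \<theta> powr ?e)))"
    using r by (intro mult_left_mono sum_V_large e) auto
  also have "\<dots> = ennreal (CT * CA / (1 - \<theta> powr ?e)) * (ennreal (V x (2 * r) powr (- ?e)) * M)"
    using geometric_powr(2)[OF e] by (intro ennreal_collect_constants) (auto simp: CT_def CA_def)
  finally show ?thesis .
qed

lemma J_mono: "A \<subseteq> B \<Longrightarrow> J \<phi> A \<le> J \<phi> B"
  unfolding J_def by (intro nn_integral_mono) (auto simp: indicator_def)

text \<open>Hedberg's argument: the radius is chosen so that the two terms balance.\<close>

lemma hedberg_ex:
  "\<exists>K1\<ge>0. \<forall>\<phi>\<in>borel_measurable borel. \<forall>x.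
     T \<phi> x UNIV powe q \<le> ennreal K1 * (J \<phi> UNIV powe (q / p - 1) * N \<phi> x powe p)"
proof -
  define c1 where "c1 = CT * CB / (1 - \<theta> powr (1 / p - 1 / q))"
  define c2 where "c2 = CT * CA / (1 - \<theta> powr (1 / q))"
  have "0 < d / n" using d by simp
  then have "0 < 1 / p - 1 / q" using q(2) by linarith
  moreover have "0 < 1 / q" using q(1) by simp
  ultimately have e: "0 < 1 / p - 1 / q" "0 < 1 / q" by blast+
  have c: "0 \<le> c1" "0 \<le> c2"
    using geometric_powr(2)[OF e(1)] geometric_powr(2)[OF e(2)]
    by (auto simp: c1_def c2_def CT_def CA_def CB_def)
  define K2 where "K2 = c1 + c2 * dbl powr (1 / q)"
  have K2: "0 \<le> K2" using c by (simp add: K2_def)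
  have "T \<phi> x UNIV powe q \<le> ennreal (K2 powr q) * (J \<phi> UNIV powe (q / p - 1) * N \<phi> x powe p)"
    if [measurable]: "\<phi> \<in> borel_measurable borel" for \<phi> x
  proof -
    have bound: "T \<phi> x UNIV \<le> ennreal c1 * (ennreal (V x r powr (1 / p - 1 / q)) * N \<phi> x) +
        ennreal c2 * (ennreal (V x r powr (- (1 / q))) * J \<phi> UNIV powe (1 / p))" if r: "0 < r" for r
    proof -
      have "T \<phi> x (- ball x r) \<le> ennreal c2 * (ennreal (V x (2 * r) powr (- (1 / q))) * J \<phi> UNIV powe (1 / p))"
      proof -
        have "T \<phi> x (- ball x r) \<le> ennreal (CT * CA / (1 - \<theta> powr (1 / q - 0 / p))) *
          (ennreal (V x (2 * r) powr (- (1 / q - 0 / p))) * J \<phi> UNIV powe (1 / p))"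
        proof (rule far_bound[OF r])
          fix r' :: real assume r': "0 < r'"
          have "J \<phi> (ball x r') powe (1 / p) \<le> J \<phi> UNIV powe (1 / p)"
            using p_gt by (intro powe_mono J_mono) auto
          then show "J \<phi> (ball x r') powe (1 / p) \<le> J \<phi> UNIV powe (1 / p) * ennreal (V x r' powr (0 / p))"
            using V_pos[OF r', of x] by simp
        qed (use q(1) in auto)
        then show ?thesis by (simp add: c2_def)
      qed
      \<comment> \<open>A negative power decreases in the radius, so \<open>2 * r\<close> may be
        replaced by \<open>r\<close> and both terms refer to the same ball.\<close>
      also have "\<dots> \<le> ennreal c2 * (ennreal (V x r powr (- (1 / q))) * J \<phi> UNIV powe (1 / p))"
        using r V_pos[OF r, of x] q(1) by (intro mult_left_mono mult_right_mono ennreal_leI powr_mono2' V_mono) auto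
      finally show ?thesis
        using T_split[of \<phi> "ball x r" x] near_bound[OF r, of \<phi> x]
        by (auto simp: c1_def intro!: add_mono)
    qed
    define j where "j = J \<phi> UNIV"
    define m where "m = N \<phi> x"
    \<comment> \<open>The balancing radius exists only for positive finite \<open>m\<close> and
      \<open>j\<close>. When one of them is 0 the right-hand side is 0, even against an infinite
      other factor, so the potential itself has to vanish.\<close>
    consider "m = 0" | "j = 0" | "m \<noteq> 0" "j \<noteq> 0" "m = top \<or> j = top"
      | m' j' where "m = ennreal m'" "0 < m'" "j = ennreal j'" "0 < j'"
      by (cases m; cases j) (auto simp: less_le)
    then have "T \<phi> x UNIV powe q \<le> ennreal (K2 powr q) * (j powe (q / p - 1) * m powe p)"
    proof cases
      case 1
      have "t \<phi> x r = 0" if "0 < r" for r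
        using t_le_N[OF that, of \<phi> x] 1 by (simp add: m_def)
      then have "T \<phi> x UNIV = 0"
        using T_split[of \<phi> "ball x 1" x] T_near[of 1 \<phi> x] T_far[of 1 \<phi> x] by simp
      then show ?thesis by simp
    next
      case 2
      have "t \<phi> x r = 0" if "0 < r" for r
      proof -
        have "J \<phi> (ball x r) = 0" using J_mono[of "ball x r" UNIV \<phi>] 2 by (simp add: j_def)
        then show ?thesis using t_le_J[OF that, of \<phi> x] by simp
      qed
      then have "T \<phi> x UNIV = 0"
        using T_split[of \<phi> "ball x 1" x] T_near[of 1 \<phi> x] T_far[of 1 \<phi> x] by simp
      then show ?thesis by simp
    next
      case 3
      show ?thesis
      \<comment> \<open>An infinite product multiplied by \<open>K2 = 0\<close> would still be 0;
        then both terms of \<open>bound\<close> vanish as well.\<close>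
      proof (cases "K2 = 0")
        case False
        then have "0 < K2" using K2 by simp
        then show ?thesis using 3 by (auto simp: ennreal_mult_eq_top_iff ennreal_mult_top ennreal_top_mult)
      next
        case True
        then have "c1 = 0" "c2 * dbl powr (1 / q) = 0"
          using c add_nonneg_eq_0_iff[of c1 "c2 * dbl powr (1/q)"] by (auto simp: K2_def)
        moreover have "dbl \<noteq> 0" using C_pos by (simp add: dbl_def)
        ultimately have "T \<phi> x UNIV \<le> 0" using bound[of 1] by simp
        then show ?thesis by simp
      qed
    next
      case 4
      \<comment> \<open>Equating \<open>V powr (1/p - 1/q) * m'\<close> with
        \<open>V powr (- 1/q) * j' powr (1/p)\<close> and solving for \<open>V\<close> gives this
        value.\<close>
      define l where "l = j' / m' powr p"
      have l: "0 < l" using 4 by (simp add: l_def)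
      obtain R where R: "0 < R" "V x R \<le> l" "l \<le> dbl * V x R"
        using ex_radius[OF l] by blast
      have VR: "0 < V x R" by (rule V_pos[OF R(1)])
      have dbl: "0 < dbl" using C_pos by (simp add: dbl_def)
      define Z where "Z = j' powr (1 / p - 1 / q) * m' powr (p / q)"
      have 1: "V x R powr (1 / p - 1 / q) * m' \<le> Z"
      proof -
        have "V x R powr (1 / p - 1 / q) * m' \<le> l powr (1 / p - 1 / q) * m'"
          using e VR R 4 by (intro mult_right_mono powr_mono2) auto
        also have "\<dots> = j' powr (1 / p - 1 / q) * m' powr (1 - p * (1 / p - 1 / q))"
        proof -
          have "(j' / m' powr p) powr e * m' = j' powr e * m' powr (1 - p * e)" for e
            using 4 by (simp add: powr_divide powr_powr powr_diff)
          then show ?thesis by (simp add: l_def)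
        qed
        also have "1 - p * (1 / p - 1 / q) = p / q"
          using p_gt by (simp add: field_simps)
        finally show ?thesis by (simp add: Z_def)
      qed
      have 2: "V x R powr (- (1 / q)) * j' powr (1 / p) \<le> dbl powr (1 / q) * Z"
      proof -
        have "l / dbl \<le> V x R" using R dbl by (simp add: field_simps)
        then have "V x R powr (- (1 / q)) \<le> (l / dbl) powr (- (1 / q))"
          using e VR dbl l by (intro powr_mono2') auto
        also have "\<dots> = dbl powr (1 / q) * j' powr (- (1 / q)) * m' powr (p / q)"
          using 4 dbl by (simp add: l_def powr_divide powr_minus powr_powr powr_mult divide_simps)
        finally have "V x R powr (- (1 / q)) * j' powr (1 / p) \<le>
            dbl powr (1 / q) * j' powr (- (1 / q)) * m' powr (p / q) * j' powr (1 / p)"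
          by (intro mult_right_mono) auto
        also have "\<dots> = dbl powr (1 / q) * Z"
          using 4 by (simp add: Z_def powr_diff powr_minus field_simps)
        finally show ?thesis .
      qed
      have "T \<phi> x UNIV \<le> ennreal (c1 * (V x R powr (1 / p - 1 / q) * m') + c2 * (V x R powr (- (1 / q)) * j' powr (1 / p)))"
        using bound[OF R(1)] c 4 unfolding m_def[symmetric] j_def[symmetric]
        by (simp add: ennreal_mult ennreal_plus mult.assoc)
      also have "\<dots> \<le> ennreal (c1 * Z + c2 * (dbl powr (1 / q) * Z))"
        using 1 2 c by (intro ennreal_leI add_mono mult_left_mono) auto
      also have "c1 * Z + c2 * (dbl powr (1 / q) * Z) = K2 * Z"
        by (simp add: K2_def algebra_simps)
      finally have "T \<phi> x UNIV powe q \<le> ennreal (K2 * Z) powe q"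
        using q by (intro powe_mono) auto
      also have "\<dots> = ennreal (K2 powr q * (j' powr (q / p - 1) * m' powr p))"
      proof -
        have "(1 / p - 1 / q) * q = q / p - 1" using q by (simp add: field_simps)
        then have "Z powr q = j' powr (q / p - 1) * m' powr p"
          using 4 q by (simp add: Z_def powr_mult powr_powr)
        then show ?thesis using K2 by (simp add: Z_def powr_mult)
      qed
      finally show ?thesis using 4 by (simp add: ennreal_mult)
    qed
    then show ?thesis by (simp add: j_def m_def)
  qed
  then show ?thesis by (intro exI[of _ "K2 powr q"]) auto
qed

section \<open>Integrated bounds: strong type and Morrey\<close>

theorem strong_bound_ex:
  "\<exists>K1\<ge>0. \<forall>\<phi>\<in>borel_measurable borel.
     (\<integral>\<^sup>+x. T \<phi> x UNIV powe q * ennreal (u x) \<partial>lborel) \<le> ennreal K1 * J \<phi> UNIV powe (q / p)"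
proof -
  obtain K1 where K1: "0 \<le> K1" "\<And>\<phi> x. \<phi> \<in> borel_measurable borel \<Longrightarrow>
     T \<phi> x UNIV powe q \<le> ennreal K1 * (J \<phi> UNIV powe (q / p - 1) * N \<phi> x powe p)"
    using hedberg_ex by blast
  obtain K2 where K2: "0 \<le> K2" "\<And>\<phi>. \<phi> \<in> borel_measurable borel \<Longrightarrow>
     (\<integral>\<^sup>+x. N \<phi> x powe p * ennreal (u x) \<partial>lborel) \<le> ennreal K2 * J \<phi> UNIV"
    using N_bound_ex by blast
  have "(\<integral>\<^sup>+x. T \<phi> x UNIV powe q * ennreal (u x) \<partial>lborel) \<le> ennreal (K1 * K2) * J \<phi> UNIV powe (q / p)"
    if [measurable]: "\<phi> \<in> borel_measurable borel" for \<phi>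
  proof -
    have "(\<integral>\<^sup>+x. T \<phi> x UNIV powe q * ennreal (u x) \<partial>lborel) \<le>
      (\<integral>\<^sup>+x. ennreal K1 * (J \<phi> UNIV powe (q / p - 1)) * (N \<phi> x powe p * ennreal (u x)) \<partial>lborel)"
      using K1(2)[of \<phi>] by (intro nn_integral_mono) (auto simp: mult.assoc[symmetric] intro!: mult_right_mono)
    also have "\<dots> = ennreal K1 * (J \<phi> UNIV powe (q / p - 1)) * (\<integral>\<^sup>+x. N \<phi> x powe p * ennreal (u x) \<partial>lborel)"
      by (rule nn_integral_cmult) measurable
    also have "\<dots> \<le> ennreal K1 * (J \<phi> UNIV powe (q / p - 1)) * (ennreal K2 * J \<phi> UNIV)"
      by (intro mult_left_mono K2) auto
    also have "\<dots> = ennreal (K1 * K2) * (J \<phi> UNIV powe (q / p - 1) * J \<phi> UNIV powe 1)"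
      using K1 K2 by (simp add: ennreal_mult ac_simps)
    also have "J \<phi> UNIV powe (q / p - 1) * J \<phi> UNIV powe 1 = J \<phi> UNIV powe (q / p)"
      by (subst powe_add[symmetric]) simp
    finally show ?thesis .
  qed
  then show ?thesis using K1 K2 by (intro exI[of _ "K1 * K2"]) auto
qed

text \<open>\<open>M\<close> plays the role of the Morrey norm of \<open>\<phi>\<close>, with the
  supremum over balls and the roots unfolded. The constant precedes \<open>\<phi>\<close> and
  \<open>M\<close>, so it is uniform in both.\<close>

theorem morrey_bound_ex:
  assumes \<kappa>: "0 < \<kappa>" "\<kappa> < p / q"
  shows "\<exists>K1\<ge>0. \<forall>\<phi>\<in>borel_measurable borel. \<forall>M.
     (\<forall>c r. 0 < r \<longrightarrow> J \<phi> (ball c r) \<le> M powe p * ennreal (V c r powr \<kappa>)) \<longrightarrow>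
     (\<forall>c r. 0 < r \<longrightarrow> (\<integral>\<^sup>+x\<in>ball c r. T \<phi> x UNIV powe q * ennreal (u x) \<partial>lborel) \<le>
        ennreal K1 * (M powe q * ennreal (V c r powr (\<kappa> * q / p))))"
proof -
  obtain K1 where K1: "0 \<le> K1" "\<And>\<phi>. \<phi> \<in> borel_measurable borel \<Longrightarrow>
     (\<integral>\<^sup>+x. T \<phi> x UNIV powe q * ennreal (u x) \<partial>lborel) \<le> ennreal K1 * J \<phi> UNIV powe (q / p)"
    using strong_bound_ex by blast
  define e where "e = 1 / q - \<kappa> / p"
  have kp: "\<kappa> / p < 1 / q" using \<kappa> p_gt q by (simp add: field_simps)
  then have e: "0 < e" by (simp add: e_def)
  define c2 where "c2 = CT * CA / (1 - \<theta> powr e)"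
  have c2: "0 \<le> c2" using geometric_powr(2)[OF e] by (auto simp: c2_def CT_def CA_def)
  have dbl: "0 < dbl" using C_pos by (simp add: dbl_def)
  define K2 where "K2 = K1 * dbl powr (\<kappa> * q / p)"
  define K3 where "K3 = c2 powr q"
  have K23: "0 \<le> K2" "0 \<le> K3" using K1 by (auto simp: K2_def K3_def)
  have "(\<integral>\<^sup>+x\<in>ball c r. T \<phi> x UNIV powe q * ennreal (u x) \<partial>lborel) \<le>
        ennreal (2 powr q * (K2 + K3)) * (M powe q * ennreal (V c r powr (\<kappa> * q / p)))"
    if [measurable]: "\<phi> \<in> borel_measurable borel" and
      M: "\<And>c r. 0 < r \<Longrightarrow> J \<phi> (ball c r) \<le> M powe p * ennreal (V c r powr \<kappa>)" and r: "0 < r" for \<phi> M c r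
  proof -
    let ?B = "ball c r"
    define \<phi>1 where "\<phi>1 y = \<phi> y * indicator (ball c (2 * r)) y" for y
    have [measurable]: "\<phi>1 \<in> borel_measurable borel" unfolding \<phi>1_def[abs_def] by measurable
    define F where "F = ennreal c2 * (ennreal (V c r powr (- e)) * M)"
    have Vr: "0 < V c r" by (rule V_pos[OF r])
    have point: "T \<phi> x UNIV \<le> T \<phi>1 x UNIV + F" if x: "x \<in> ?B" for x
    proof -
      have "T \<phi> x UNIV = T \<phi> x (ball c (2 * r)) + T \<phi> x (- ball c (2 * r))"
        by (rule T_split) auto
      moreover have "T \<phi> x (ball c (2 * r)) = T \<phi>1 x UNIV"
        unfolding T_def \<phi>1_def by (simp add: mult.assoc)
      \<comment> \<open>For \<open>x\<close> in \<open>ball c r\<close> the ball about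
        \<open>x\<close> of radius \<open>r\<close> lies in \<open>ball c (2 * r)\<close>, so the
        tail can be estimated around \<open>x\<close> itself.\<close>
      moreover have "T \<phi> x (- ball c (2 * r)) \<le> T \<phi> x (- ball x r)"
      proof (rule T_mono)
        have "y \<in> ball c (2 * r)" if "y \<in> ball x r" for y
          using that x dist_triangle[of c y x] by simp
        then show "- ball c (2 * r) \<subseteq> - ball x r" by auto
      qed
      moreover have "T \<phi> x (- ball x r) \<le> ennreal c2 * (ennreal (V x (2 * r) powr (- e)) * M)"
        unfolding c2_def e_def
      proof (rule far_bound[OF r _ kp])
        fix r' :: real assume "0 < r'"
        then have "J \<phi> (ball x r') powe (1 / p) \<le> (M powe p * ennreal (V x r' powr \<kappa>)) powe (1 / p)"
          using p_gt by (intro powe_mono M) auto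
        then show "J \<phi> (ball x r') powe (1 / p) \<le> M * ennreal (V x r' powr (\<kappa> / p))"
          using p_gt by (simp add: powe_mult powe_powe powr_powr)
      qed simp
      moreover have "ennreal c2 * (ennreal (V x (2 * r) powr (- e)) * M) \<le> F"
      proof -
        \<comment> \<open>The inclusion of \<open>ball c r\<close> in \<open>ball x (2 * r)\<close>,
          under a negative power, removes the dependence on \<open>x\<close>: the tail bound
          \<open>F\<close> is constant on the ball.\<close>
        have "V c r \<le> V x (2 * r)"
        proof (rule V_mono)
          have "y \<in> ball x (2 * r)" if "y \<in> ball c r" for y
            using that x dist_triangle[of x y c] by (simp add: dist_commute)
          then show "ball c r \<subseteq> ball x (2 * r)" by auto
        qed
        then show ?thesis unfolding F_def
          using Vr e by (intro mult_left_mono mult_right_mono ennreal_leI powr_mono2') auto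
      qed
      ultimately show ?thesis by (auto intro!: add_left_mono intro: order_trans)
    qed
    have "(\<integral>\<^sup>+x\<in>?B. T \<phi> x UNIV powe q * ennreal (u x) \<partial>lborel) \<le>
      (\<integral>\<^sup>+x. ennreal (2 powr q) * (T \<phi>1 x UNIV powe q * ennreal (u x) + F powe q * (ennreal (u x) * indicator ?B x)) \<partial>lborel)"
    proof (intro nn_integral_mono)
      fix x
      show "T \<phi> x UNIV powe q * ennreal (u x) * indicator ?B x \<le>
         ennreal (2 powr q) * (T \<phi>1 x UNIV powe q * ennreal (u x) + F powe q * (ennreal (u x) * indicator ?B x))"
      proof (cases "x \<in> ?B")
        case True
        have "T \<phi> x UNIV powe q \<le> (T \<phi>1 x UNIV + F) powe q"
          using q by (intro powe_mono point True) auto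
        also have "\<dots> \<le> ennreal (2 powr q) * (T \<phi>1 x UNIV powe q + F powe q)"
          by (rule powe_sum_le[OF q(1)])
        finally have "T \<phi> x UNIV powe q * ennreal (u x) \<le> ennreal (2 powr q) * (T \<phi>1 x UNIV powe q + F powe q) * ennreal (u x)"
          by (rule mult_right_mono) simp
        then show ?thesis using True by (simp add: algebra_simps)
      qed simp
    qed
    also have "\<dots> = ennreal (2 powr q) * ((\<integral>\<^sup>+x. T \<phi>1 x UNIV powe q * ennreal (u x) \<partial>lborel) +
        F powe q * (\<integral>\<^sup>+x\<in>?B. ennreal (u x) \<partial>lborel))"
      by (simp add: nn_integral_cmult nn_integral_add)
    also have "\<dots> \<le> ennreal (2 powr q) * (ennreal K2 * (M powe q * ennreal (V c r powr (\<kappa> * q / p))) +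
        ennreal K3 * (M powe q * ennreal (V c r powr (\<kappa> * q / p))))"
    proof (intro mult_left_mono add_mono)
      have "J \<phi>1 UNIV = J \<phi> (ball c (2 * r))"
        unfolding J_def \<phi>1_def by (intro nn_integral_cong) (auto simp: indicator_def)
      also have "\<dots> \<le> M powe p * ennreal (V c (2 * r) powr \<kappa>)"
        using r by (intro M) auto
      also have "\<dots> \<le> M powe p * ennreal ((dbl * V c r) powr \<kappa>)"
        using r \<kappa> by (intro mult_left_mono ennreal_leI powr_mono2 V_doubling) auto
      finally have "J \<phi>1 UNIV powe (q / p) \<le> (M powe p * ennreal ((dbl * V c r) powr \<kappa>)) powe (q / p)"
        using p_gt q by (intro powe_mono) auto
      also have "\<dots> = ennreal (dbl powr (\<kappa> * q / p)) * (M powe q * ennreal (V c r powr (\<kappa> * q / p)))"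
        using dbl Vr p_gt by (simp add: powe_mult powe_powe powr_mult powr_powr ennreal_mult ac_simps)
      finally have "J \<phi>1 UNIV powe (q / p) \<le> ennreal (dbl powr (\<kappa> * q / p)) * (M powe q * ennreal (V c r powr (\<kappa> * q / p)))" .
      then have "ennreal K1 * J \<phi>1 UNIV powe (q / p) \<le> ennreal K2 * (M powe q * ennreal (V c r powr (\<kappa> * q / p)))"
        unfolding K2_def using K1(1) by (simp add: ennreal_mult mult.assoc mult_left_mono)
      with K1(2)[of \<phi>1] show "(\<integral>\<^sup>+x. T \<phi>1 x UNIV powe q * ennreal (u x) \<partial>lborel) \<le>
          ennreal K2 * (M powe q * ennreal (V c r powr (\<kappa> * q / p)))"
        by (auto intro: order_trans)
      have "F powe q * (\<integral>\<^sup>+x\<in>?B. ennreal (u x) \<partial>lborel) = F powe q * ennreal (V c r)"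
        by (simp add: emeasure_wmeasure[symmetric] emeasure_V)
      also have "\<dots> = ennreal K3 * (M powe q * ennreal (V c r powr (- e * q) * V c r))"
        using c2 q by (simp add: F_def K3_def powe_mult powr_powr ennreal_mult ac_simps)
      also have "V c r powr (- e * q) * V c r = V c r powr (- e * q + 1)"
        using Vr by (subst powr_add) simp
      also have "- e * q + 1 = \<kappa> * q / p"
        using q by (simp add: e_def field_simps)
      finally show "F powe q * (\<integral>\<^sup>+x\<in>?B. ennreal (u x) \<partial>lborel) \<le> ennreal K3 * (M powe q * ennreal (V c r powr (\<kappa> * q / p)))"
        by simp
    qed simp
    also have "\<dots> = ennreal (2 powr q * (K2 + K3)) * (M powe q * ennreal (V c r powr (\<kappa> * q / p)))"
      using K23 by (simp add: ennreal_mult ennreal_plus distrib_right distrib_left mult.assoc)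
    finally show ?thesis .
  qed
  then show ?thesis using K23 by (intro exI[of _ "2 powr q * (K2 + K3)"]) auto
qed

end

section \<open>Taylor remainders\<close>

text \<open>\<open>partial_deriv\<close> differentiates at parameter 0 only; moving the base point
  along the axis gives the derivative at every \<open>t0\<close>.\<close>

lemma partial_deriv_has_derivative:
  assumes "C_k (Suc k) g"
  shows "((\<lambda>t. g (x + t *\<^sub>R axis i 1)) has_vector_derivative partial_deriv i g (x + t0 *\<^sub>R axis i 1)) (at t0)"
proof -
  let ?e = "axis i 1 :: real ^ 'a"
  have "(\<lambda>t. g ((x + t0 *\<^sub>R ?e) + t *\<^sub>R ?e)) differentiable (at 0)"
    using assms by simp
  then have 1: "((\<lambda>t. g ((x + t0 *\<^sub>R ?e) + t *\<^sub>R ?e)) has_vector_derivative partial_deriv i g (x + t0 *\<^sub>R ?e)) (at (t0 - t0))"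
    unfolding partial_deriv_def by (simp add: vector_derivative_works)
  have 2: "((\<lambda>t. t - t0) has_vector_derivative 1) (at t0)"
    by (auto intro!: derivative_eq_intros simp flip: has_real_derivative_iff_has_vector_derivative)
  from vector_diff_chain_at[OF 2 1] show ?thesis
    by (simp add: o_def algebra_simps)
qed

lemma C_k_continuous: "C_k k g \<Longrightarrow> continuous_on UNIV g"
  by (cases k) auto

lemma C_k_Suc: "C_k (Suc k) g \<Longrightarrow> C_k k g"
  by (induction k arbitrary: g) auto

lemma C_k_mono: "C_k k g \<Longrightarrow> j \<le> k \<Longrightarrow> C_k j g"
  by (induction k) (simp_all add: le_Suc_eq C_k_Suc del: C_k.simps, blast intro: C_k_Suc)

lemma C_k_partial: "C_k (Suc k) g \<Longrightarrow> C_k k (partial_deriv i g)"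
  by simp

text \<open>Clairaut's theorem: differentiate \<open>g (x + s e\<^sub>i + t e\<^sub>j) - g (x + s e\<^sub>i - e\<^sub>j)\<close>, written as an integral
  of the \<open>j\<close>-th partial derivative, under the integral sign in \<open>s\<close>.\<close>

lemma partial_deriv_commute:
  fixes g :: "real ^ 'n \<Rightarrow> complex"
  assumes g: "C_k (Suc (Suc k)) g"
  shows "partial_deriv j (partial_deriv i g) = partial_deriv i (partial_deriv j g)"
proof
  fix x :: "real ^ 'n"
  let ?i = "axis i 1 :: real ^ 'n" and ?j = "axis j 1 :: real ^ 'n"
  let ?gi = "partial_deriv i g" and ?gj = "partial_deriv j g"
  let ?gij = "partial_deriv i (partial_deriv j g)"
  have gj: "C_k (Suc k) ?gj" and gi: "C_k (Suc k) ?gi" using g by (auto simp only: intro!: C_k_partial)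
  have cont: "continuous_on UNIV ?gj" "continuous_on UNIV ?gij"
    using C_k_continuous[OF gj] C_k_continuous[OF C_k_partial[OF gj]] by auto
  have cgj: "continuous_on S (\<lambda>y. ?gj (f y))" if "continuous_on S f" for S and f :: "'b::topological_space \<Rightarrow> real ^ 'n"
    using continuous_on_compose2[OF cont(1) that] by simp
  have cgij: "continuous_on S (\<lambda>y. ?gij (f y))" if "continuous_on S f" for S and f :: "'b::topological_space \<Rightarrow> real ^ 'n"
    using continuous_on_compose2[OF cont(2) that] by simp
  \<comment> \<open>The integral starts at -1 so that \<open>t = 0\<close> is interior and the
    derivative there is two-sided.\<close>
  have eq: "?gi (x + t *\<^sub>R ?j) = ?gi (x - ?j) + integral {-1..t} (\<lambda>\<tau>. ?gij (x + \<tau> *\<^sub>R ?j))" if t: "-1 \<le> t" for t :: real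
  proof -
    have FTC: "g (x + s *\<^sub>R ?i + t *\<^sub>R ?j) - g (x + s *\<^sub>R ?i - ?j) =
       integral (cbox (-1) t) (\<lambda>\<tau>. ?gj (x + s *\<^sub>R ?i + \<tau> *\<^sub>R ?j))" for s
    proof -
      have "((\<lambda>\<tau>. ?gj (x + s *\<^sub>R ?i + \<tau> *\<^sub>R ?j)) has_integral
         (g (x + s *\<^sub>R ?i + t *\<^sub>R ?j) - g (x + s *\<^sub>R ?i + (-1) *\<^sub>R ?j))) {-1..t}"
        by (rule fundamental_theorem_of_calculus[OF t])
           (rule has_vector_derivative_at_within, rule partial_deriv_has_derivative[OF g])
      then show ?thesis by (simp add: integral_unique)
    qed
    have "((\<lambda>s. integral (cbox (-1) t) (\<lambda>\<tau>. ?gj (x + s *\<^sub>R ?i + \<tau> *\<^sub>R ?j))) has_vector_derivative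
       integral (cbox (-1) t) (\<lambda>\<tau>. ?gij (x + 0 *\<^sub>R ?i + \<tau> *\<^sub>R ?j))) (at 0 within UNIV)"
    proof (rule leibniz_rule_vector_derivative)
      fix s \<tau> :: real
      have "((\<lambda>s. ?gj (x + \<tau> *\<^sub>R ?j + s *\<^sub>R ?i)) has_vector_derivative ?gij (x + \<tau> *\<^sub>R ?j + s *\<^sub>R ?i)) (at s)"
        by (rule partial_deriv_has_derivative[OF gj])
      then show "((\<lambda>s. ?gj (x + s *\<^sub>R ?i + \<tau> *\<^sub>R ?j)) has_vector_derivative ?gij (x + s *\<^sub>R ?i + \<tau> *\<^sub>R ?j)) (at s within UNIV)"
        by (simp add: add.assoc add.commute add.left_commute)
      show "(\<lambda>\<tau>. ?gj (x + s *\<^sub>R ?i + \<tau> *\<^sub>R ?j)) integrable_on cbox (- 1) t"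
        by (intro integrable_continuous cgj continuous_intros)
    next
      show "continuous_on (UNIV \<times> cbox (- 1) t) (\<lambda>(s, \<tau>). ?gij (x + s *\<^sub>R ?i + \<tau> *\<^sub>R ?j))"
        unfolding case_prod_unfold by (intro cgij continuous_intros)
    qed auto
    moreover have "((\<lambda>s. g (x + s *\<^sub>R ?i + t *\<^sub>R ?j) - g (x + s *\<^sub>R ?i - ?j)) has_vector_derivative
       ?gi (x + t *\<^sub>R ?j) - ?gi (x - ?j)) (at 0)"
      using partial_deriv_has_derivative[OF g, of "x + t *\<^sub>R ?j" i 0] partial_deriv_has_derivative[OF g, of "x - ?j" i 0]
      by (intro has_vector_derivative_diff) (simp_all add: algebra_simps)
    ultimately have "?gi (x + t *\<^sub>R ?j) - ?gi (x - ?j) = integral (cbox (-1) t) (\<lambda>\<tau>. ?gij (x + 0 *\<^sub>R ?i + \<tau> *\<^sub>R ?j))"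
      unfolding FTC by (intro vector_derivative_unique_at)
    then show ?thesis by (simp add: algebra_simps)
  qed
  have "((\<lambda>t. integral {-1..t} (\<lambda>\<tau>. ?gij (x + \<tau> *\<^sub>R ?j))) has_vector_derivative ?gij (x + 0 *\<^sub>R ?j)) (at 0 within {-1..1})"
    by (rule integral_has_vector_derivative) (auto intro!: cgij continuous_intros)
  then have "((\<lambda>t. ?gi (x - ?j) + integral {-1..t} (\<lambda>\<tau>. ?gij (x + \<tau> *\<^sub>R ?j))) has_vector_derivative ?gij x) (at 0 within {-1..1})"
    using has_vector_derivative_add[OF has_vector_derivative_const[of "?gi (x - ?j)"]] by (auto simp only: add_0 scaleR_zero_left add_0_right)
  then have "((\<lambda>t. ?gi (x + t *\<^sub>R ?j)) has_vector_derivative ?gij x) (at 0 within {-1..1})"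
    by (rule has_vector_derivative_transform[rotated 2]) (auto simp: eq)
  then have "((\<lambda>t. ?gi (x + t *\<^sub>R ?j)) has_vector_derivative ?gij x) (at 0)"
    by (subst (asm) at_within_interior[of 0 "{-1..1}"]) (auto simp: interior_atLeastAtMost_real)
  moreover have "((\<lambda>t. ?gi (x + t *\<^sub>R ?j)) has_vector_derivative partial_deriv j ?gi x) (at 0)"
    using partial_deriv_has_derivative[OF gi, of x j 0] by simp
  ultimately show "partial_deriv j ?gi x = ?gij x"
    by (rule vector_derivative_unique_at[symmetric])
qed

section \<open>Multi-index derivatives and independence of the order of differentiation\<close>

lemma C_k_foldr: "C_k (k + length is) g \<Longrightarrow> C_k k (foldr partial_deriv is g)"
proof (induction "is" arbitrary: k)
  case (Cons i "is")
  then have "C_k (Suc k) (foldr partial_deriv is g)" by (simp del: C_k.simps)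
  then show ?case by (simp only: foldr_Cons o_apply C_k_partial)
qed simp

text \<open>An occurrence of \<open>i\<close> moves to the front by adjacent swaps; the smoothness
  assumption leaves two continuous derivatives for each swap.\<close>

lemma foldr_partial_remove1:
  assumes "C_k (length is) g" "i \<in> set is"
  shows "foldr partial_deriv is g = partial_deriv i (foldr partial_deriv (remove1 i is) g)"
  using assms
proof (induction "is")
  case (Cons j js)
  show ?case
  proof (cases "j = i")
    case False
    then have i: "i \<in> set js" using Cons.prems by simp
    have "foldr partial_deriv js g = partial_deriv i (foldr partial_deriv (remove1 i js) g)"
      by (rule Cons.IH[OF C_k_mono[OF Cons.prems(1)] i]) simp
    moreover have "C_k (Suc (Suc 0)) (foldr partial_deriv (remove1 i js) g)"
    proof (rule C_k_foldr)
      have "Suc (Suc 0) + length (remove1 i js) = length (j # js)"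
        using i length_pos_if_in_set[OF i] by (simp add: length_remove1)
      then show "C_k (Suc (Suc 0) + length (remove1 i js)) g" using Cons.prems(1) by metis
    qed
    ultimately show ?thesis
      using False partial_deriv_commute[of 0 "foldr partial_deriv (remove1 i js) g" j i] by (simp del: C_k.simps)
  qed simp
qed simp

lemma foldr_partial_perm:
  assumes "C_k (length is) g" "mset is = mset js"
  shows "foldr partial_deriv is g = foldr partial_deriv js g"
  using assms
proof (induction "is" arbitrary: js)
  case (Cons i "is")
  then have i: "i \<in> set js" by (metis list.set_intros(1) set_mset_mset)
  have len: "length js = length (i # is)" using Cons.prems(2) by (metis size_mset)
  have "foldr partial_deriv is g = foldr partial_deriv (remove1 i js) g"
    using Cons.prems by (intro Cons.IH C_k_mono[OF Cons.prems(1)]) (auto simp flip: Cons.prems(2))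
  then show ?case
    using foldr_partial_remove1[OF _ i] Cons.prems(1) len by (metis comp_apply foldr_Cons)
qed simp

definition mi_inc :: "'n \<Rightarrow> ('n \<Rightarrow> nat) \<Rightarrow> 'n \<Rightarrow> nat" where
  "mi_inc i \<gamma> = \<gamma>(i := Suc (\<gamma> i))"

lemma mi_inc_eq_iff [simp]: "mi_inc i \<gamma> = mi_inc i \<delta> \<longleftrightarrow> \<gamma> = \<delta>"
proof
  assume *: "mi_inc i \<gamma> = mi_inc i \<delta>"
  have "\<gamma> j = \<delta> j" for j
    using fun_cong[OF *, of j] by (simp add: mi_inc_def split: if_splits)
  then show "\<gamma> = \<delta>" by blast
qed simp

lemma mi_list_ex: "\<exists>is. \<forall>i. count_list is i = (\<gamma> :: 'n::finite \<Rightarrow> nat) i"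
proof -
  have "finite {i. 0 < \<gamma> i}" by simp
  then have "count (Abs_multiset \<gamma>) = \<gamma>" by (rule count_Abs_multiset)
  moreover obtain "is" where "mset is = Abs_multiset \<gamma>" using ex_mset by blast
  ultimately have "count_list is i = \<gamma> i" for i by (simp flip: count_mset)
  then show ?thesis by blast
qed

lemma length_mi_list:
  assumes "\<forall>i. count_list is i = (\<gamma> :: 'n::finite \<Rightarrow> nat) i" shows "length is = mi_order \<gamma>"
proof -
  have "length is = size (mset is)" by simp
  also have "\<dots> = (\<Sum>i\<in>set is. count_list is i)"
    by (simp add: size_multiset_overloaded_eq count_mset)
  also have "\<dots> = (\<Sum>i\<in>UNIV. count_list is i)"
    by (rule sum.mono_neutral_left) auto
  finally show ?thesis using assms by (simp add: mi_order_def)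
qed

text \<open>Lists with equal counts are permutations of each other, so the list chosen inside
  \<open>mi_deriv\<close> may be replaced by any convenient one.\<close>

lemma mi_deriv_eq:
  assumes "C_k (mi_order \<gamma>) g" "\<forall>i. count_list is i = \<gamma> i"
  shows "mi_deriv \<gamma> g = foldr partial_deriv is g"
proof -
  define js where "js = (SOME is. \<forall>i. count_list is i = \<gamma> i)"
  have js: "\<forall>i. count_list js i = \<gamma> i"
    unfolding js_def by (rule someI_ex) (rule mi_list_ex)
  have "mset js = mset is" using js assms(2) by (intro multiset_eqI) (simp add: count_mset)
  then show ?thesis
    unfolding mi_deriv_def js_def[symmetric]
    using assms(1) by (intro foldr_partial_perm) (auto simp: length_mi_list[OF js])
qed

text \<open>Appending \<open>i\<close> at the end of the list makes it the innermost derivative of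
  \<open>foldr\<close>.\<close>

lemma mi_deriv_partial:
  assumes "C_k (Suc (mi_order \<gamma>)) g"
  shows "mi_deriv (mi_inc i \<gamma>) g = mi_deriv \<gamma> (partial_deriv i g)"
proof -
  obtain "is" where is': "\<forall>j. count_list is j = \<gamma> j" using mi_list_ex by blast
  have *: "\<forall>j. count_list (is @ [i]) j = mi_inc i \<gamma> j" using is' by (simp add: mi_inc_def)
  have "mi_deriv (mi_inc i \<gamma>) g = foldr partial_deriv (is @ [i]) g"
    using mi_deriv_eq[OF _ *, of g] length_mi_list[OF *] length_mi_list[OF is'] assms
    by (simp del: C_k.simps)
  also have "\<dots> = mi_deriv \<gamma> (partial_deriv i g)"
    using mi_deriv_eq[OF C_k_partial[OF assms] is'] by simp
  finally show ?thesis .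
qed

lemma mi_deriv_continuous:
  assumes "C_k k g" "mi_order \<gamma> \<le> k" shows "continuous_on UNIV (mi_deriv \<gamma> g)"
proof -
  obtain "is" where is': "\<forall>j. count_list is j = \<gamma> j" using mi_list_ex by blast
  have "C_k (mi_order \<gamma>) g" using C_k_mono assms by blast
  then show ?thesis
    using mi_deriv_eq[OF _ is'] C_k_foldr[of 0 "is" g] length_mi_list[OF is'] by simp
qed

lemma finite_mi_order_less [simp]: "finite {\<gamma> :: 'n::finite \<Rightarrow> nat. mi_order \<gamma> < m}"
proof (rule finite_subset)
  show "{\<gamma> :: 'n \<Rightarrow> nat. mi_order \<gamma> < m} \<subseteq> (\<Pi>\<^sub>E i\<in>UNIV. {..<m})"
  proof
    fix \<gamma> :: "'n \<Rightarrow> nat" assume "\<gamma> \<in> {\<gamma>. mi_order \<gamma> < m}"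
    then have "\<gamma> i < m" for i
      using member_le_sum[of i UNIV \<gamma>] by (simp add: mi_order_def)
    then show "\<gamma> \<in> (\<Pi>\<^sub>E i\<in>UNIV. {..<m})" by (auto simp: PiE_def)
  qed
qed (simp add: finite_PiE)

lemma finite_mi_order_eq [simp]: "finite {\<gamma> :: 'n::finite \<Rightarrow> nat. mi_order \<gamma> = m}"
  by (rule finite_subset[OF _ finite_mi_order_less[of "Suc m"]]) auto

lemma mi_order_upd: "mi_order (mi_inc i \<gamma>) = Suc (mi_order \<gamma>)"
  unfolding mi_order_def mi_inc_def by (subst (1 2) sum.remove[of UNIV i]) auto

lemma mi_order_0_iff: "mi_order \<gamma> = 0 \<longleftrightarrow> \<gamma> = (\<lambda>_. 0)"
  by (auto simp: mi_order_def)

lemma mi_deriv_zero: "mi_deriv (\<lambda>_. 0) g = g"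
proof -
  have "(SOME is. \<forall>i. count_list is i = 0) = ([] :: 'a list)"
  proof (rule some_equality)
    fix js :: "'a list" assume "\<forall>i. count_list js i = 0"
    then have "set js = {}" by (auto simp: count_list_0_iff)
    then show "js = []" by simp
  qed simp
  then show ?thesis by (simp add: mi_deriv_def)
qed

section \<open>Differentiation and size of Taylor remainders\<close>

lemma taylor_remainder_1: "taylor_remainder (Suc 0) A x y = A x - A y"
  by (simp add: taylor_remainder_def mi_order_0_iff mi_deriv_zero mi_power_def mi_fact_def)

lemma mi_power_0: "mi_order \<gamma> \<noteq> 0 \<Longrightarrow> mi_power 0 \<gamma> = 0"
  by (auto simp: mi_order_def mi_power_def)

text \<open>Only the zero multi-index survives. This anchors the path argument at \<open>y\<close>
  and later makes the diagonal harmless in the maximal operator.\<close>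

lemma taylor_remainder_same:
  assumes "0 < m" shows "taylor_remainder m A y y = 0"
proof -
  have "(\<Sum>\<gamma> | mi_order \<gamma> < m. (mi_power (y - y) \<gamma> / mi_fact \<gamma>) *\<^sub>R mi_deriv \<gamma> A y) =
    (\<Sum>\<gamma> | mi_order \<gamma> = 0. (mi_power (y - y) \<gamma> / mi_fact \<gamma>) *\<^sub>R mi_deriv \<gamma> A y)"
    using assms by (intro sum.mono_neutral_right) (auto simp: mi_power_0)
  also have "\<dots> = A y"
    by (simp add: mi_order_0_iff mi_deriv_zero mi_power_def mi_fact_def)
  finally show ?thesis by (simp add: taylor_remainder_def)
qed

lemma mi_power_axis:
  "mi_power (z + t *\<^sub>R axis i 1) \<gamma> = (z $ i + t) ^ \<gamma> i * (\<Prod>j\<in>UNIV - {i}. (z $ j) ^ \<gamma> j)"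
  unfolding mi_power_def
  by (subst prod.remove[of _ i]) (auto intro!: arg_cong2[of _ _ _ _ "(*)"] prod.cong simp: axis_def)

lemma mi_fact_upd: "mi_fact (mi_inc i \<gamma>) = real (Suc (\<gamma> i)) * mi_fact \<gamma>"
  unfolding mi_fact_def mi_inc_def by (subst (1 2) prod.remove[of UNIV i]) auto

lemma mi_fact_pos: "0 < mi_fact \<gamma>"
  by (simp add: mi_fact_def prod_pos)

lemma mi_power_upd_deriv:
  "((\<lambda>t. mi_power (z + t *\<^sub>R axis i 1) (mi_inc i \<gamma>) / mi_fact (mi_inc i \<gamma>))
     has_real_derivative (mi_power z \<gamma> / mi_fact \<gamma>)) (at 0)"
proof -
  define c where "c = (\<Prod>j\<in>UNIV - {i}. (z $ j) ^ \<gamma> j)"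
  have "(\<Prod>j\<in>UNIV - {i}. (z $ j) ^ (mi_inc i \<gamma>) j) = c"
    unfolding c_def mi_inc_def by (intro prod.cong) auto
  then have eq: "(\<lambda>t. mi_power (z + t *\<^sub>R axis i 1) (mi_inc i \<gamma>) / mi_fact (mi_inc i \<gamma>)) =
     (\<lambda>t. (z $ i + t) ^ Suc (\<gamma> i) * c / (real (Suc (\<gamma> i)) * mi_fact \<gamma>))"
    unfolding mi_power_axis mi_fact_upd by (simp add: mi_inc_def)
  have "((\<lambda>t. (z $ i + t) ^ Suc (\<gamma> i) * c / (real (Suc (\<gamma> i)) * mi_fact \<gamma>)) has_real_derivative
      real (Suc (\<gamma> i)) * (z $ i + 0) ^ \<gamma> i * c / (real (Suc (\<gamma> i)) * mi_fact \<gamma>)) (at 0)"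
    using mi_fact_pos[of \<gamma>] by (auto intro!: derivative_eq_intros simp del: of_nat_Suc power_Suc)
  also have "real (Suc (\<gamma> i)) * (z $ i + 0) ^ \<gamma> i * c / (real (Suc (\<gamma> i)) * mi_fact \<gamma>) =
      (z $ i + 0) ^ \<gamma> i * c / mi_fact \<gamma>"
    by (simp del: of_nat_Suc)
  also have "(z $ i + 0) ^ \<gamma> i * c = mi_power z \<gamma>"
    using mi_power_axis[of z 0 i \<gamma>] by (simp add: c_def)
  finally show ?thesis unfolding eq .
qed

lemma mi_power_axis_const:
  assumes "\<gamma> i = 0"
  shows "mi_power (z + t *\<^sub>R axis i 1) \<gamma> = mi_power z \<gamma>"
  using mi_power_axis[of z t i \<gamma>] mi_power_axis[of z 0 i \<gamma>] assms by simp

text \<open>Multi-indices with \<open>\<gamma> i \<noteq> 0\<close> are the images under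
  \<open>mi_inc i\<close> of those of order below \<open>m\<close>, and their monomials
  differentiate to the lower ones. Monomials with \<open>\<gamma> i = 0\<close> are constant along
  the axis.\<close>

lemma taylor_remainder_partial:
  assumes A: "C_k m A" and m: "m = Suc k"
  shows "((\<lambda>t. taylor_remainder (Suc m) A (x + t *\<^sub>R axis i 1) y) has_vector_derivative
     taylor_remainder m (partial_deriv i A) x y) (at 0)"
proof -
  let ?e = "axis i 1 :: real ^ 'a"
  let ?up = "mi_inc i"
  let ?term = "\<lambda>\<gamma> t. (mi_power (x + t *\<^sub>R ?e - y) \<gamma> / mi_fact \<gamma>) *\<^sub>R mi_deriv \<gamma> A y"
  let ?S = "{\<gamma>. mi_order \<gamma> < Suc m}"
  have inj: "inj_on ?up {\<gamma>. mi_order \<gamma> < m}"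
    by (rule inj_onI) simp
  have img: "?up ` {\<gamma>. mi_order \<gamma> < m} = {\<gamma> \<in> ?S. \<gamma> i \<noteq> 0}"
  proof safe
    fix \<gamma> assume \<gamma>: "mi_order \<gamma> < Suc m" "0 < \<gamma> i"
    define \<delta> where "\<delta> = \<gamma>(i := \<gamma> i - 1)"
    have "\<gamma> = ?up \<delta>" using \<gamma> by (auto simp: \<delta>_def mi_inc_def)
    moreover then have "mi_order \<delta> < m" using \<gamma> mi_order_upd[of i \<delta>] by simp
    ultimately show "\<gamma> \<in> ?up ` {\<gamma>. mi_order \<gamma> < m}" by blast
  qed (auto simp: mi_order_upd, simp add: mi_inc_def)
  have split: "(\<Sum>\<gamma>\<in>?S. ?term \<gamma> t) = (\<Sum>\<gamma> | mi_order \<gamma> < m. ?term (?up \<gamma>) t) + (\<Sum>\<gamma>\<in>{\<gamma>\<in>?S. \<gamma> i = 0}. ?term \<gamma> 0)" for t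
  proof -
    have "?S = {\<gamma> \<in> ?S. \<gamma> i \<noteq> 0} \<union> {\<gamma> \<in> ?S. \<gamma> i = 0}" by auto
    then have "(\<Sum>\<gamma>\<in>?S. ?term \<gamma> t) = (\<Sum>\<gamma>\<in>{\<gamma> \<in> ?S. \<gamma> i \<noteq> 0} \<union> {\<gamma> \<in> ?S. \<gamma> i = 0}. ?term \<gamma> t)"
      by metis
    also have "\<dots> = (\<Sum>\<gamma>\<in>{\<gamma> \<in> ?S. \<gamma> i \<noteq> 0}. ?term \<gamma> t) + (\<Sum>\<gamma>\<in>{\<gamma> \<in> ?S. \<gamma> i = 0}. ?term \<gamma> t)"
      by (rule sum.union_disjoint) auto
    also have "(\<Sum>\<gamma>\<in>{\<gamma> \<in> ?S. \<gamma> i \<noteq> 0}. ?term \<gamma> t) = (\<Sum>\<gamma> | mi_order \<gamma> < m. ?term (?up \<gamma>) t)"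
      unfolding img[symmetric] by (rule sum.reindex_cong[OF inj refl refl])
    also have "(\<Sum>\<gamma>\<in>{\<gamma> \<in> ?S. \<gamma> i = 0}. ?term \<gamma> t) = (\<Sum>\<gamma>\<in>{\<gamma>\<in>?S. \<gamma> i = 0}. ?term \<gamma> 0)"
      using mi_power_axis_const[of _ i "x - y" t]
      by (intro sum.cong) (auto simp: algebra_simps)
    finally show ?thesis .
  qed
  have "((\<lambda>t. A (x + t *\<^sub>R ?e)) has_vector_derivative partial_deriv i A x) (at 0)"
    using partial_deriv_has_derivative[of k A x i 0] A m by (simp del: C_k.simps)
  moreover have "((\<lambda>t. (\<Sum>\<gamma>\<in>?S. ?term \<gamma> t)) has_vector_derivative
     (\<Sum>\<gamma> | mi_order \<gamma> < m. (mi_power (x - y) \<gamma> / mi_fact \<gamma>) *\<^sub>R mi_deriv \<gamma> (partial_deriv i A) y)) (at 0)"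
  proof -
    have "((\<lambda>t. ?term (?up \<gamma>) t) has_vector_derivative
      (mi_power (x - y) \<gamma> / mi_fact \<gamma>) *\<^sub>R mi_deriv \<gamma> (partial_deriv i A) y) (at 0)" if \<gamma>: "mi_order \<gamma> < m" for \<gamma>
    proof -
      have "C_k (Suc (mi_order \<gamma>)) A" using A \<gamma> C_k_mono Suc_leI by blast
      then have eq: "mi_deriv (?up \<gamma>) A = mi_deriv \<gamma> (partial_deriv i A)" by (rule mi_deriv_partial)
      have "((\<lambda>t. mi_power (x - y + t *\<^sub>R ?e) (?up \<gamma>) / mi_fact (?up \<gamma>)) has_vector_derivative
          mi_power (x - y) \<gamma> / mi_fact \<gamma>) (at 0)"
        using mi_power_upd_deriv[of "x - y" i \<gamma>] unfolding has_real_derivative_iff_has_vector_derivative .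
      from has_vector_derivative_scaleR[OF this[folded has_real_derivative_iff_has_vector_derivative] has_vector_derivative_const[of "mi_deriv (?up \<gamma>) A y"]]
      show ?thesis unfolding eq by (simp add: algebra_simps)
    qed
    then have "((\<lambda>t. \<Sum>\<gamma> | mi_order \<gamma> < m. ?term (?up \<gamma>) t) has_vector_derivative
      (\<Sum>\<gamma> | mi_order \<gamma> < m. (mi_power (x - y) \<gamma> / mi_fact \<gamma>) *\<^sub>R mi_deriv \<gamma> (partial_deriv i A) y)) (at 0)"
      by (intro has_vector_derivative_sum) auto
    from has_vector_derivative_add[OF this has_vector_derivative_const]
    show ?thesis unfolding split by simp
  qed
  ultimately show ?thesis
    unfolding taylor_remainder_def by (rule has_vector_derivative_diff)
qed

text \<open>Only partial derivatives are at hand, so the mean value inequality is applied on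
  axis-parallel segments from \<open>y\<close> to \<open>x\<close>, one for each coordinate; this is
  the origin of the factor \<open>CARD('n)\<close>.\<close>

lemma coordinate_path_bound:
  fixes G :: "real ^ 'n \<Rightarrow> complex"
  assumes deriv: "\<And>w i. ((\<lambda>t. G (w + t *\<^sub>R axis i 1)) has_vector_derivative G' i w) (at 0)"
    and bound: "\<And>w i. norm (w - y) \<le> norm (x - y) \<Longrightarrow> norm (G' i w) \<le> B"
  shows "norm (G x - G y) \<le> real CARD('n) * B * norm (x - y)"
proof -
  define pt where "pt S = (\<chi> i. if i \<in> S then x $ i else y $ i)" for S
  have "0 \<le> B" using bound[of y] by (metis diff_self norm_ge_zero norm_zero order_trans)
  have "norm (G (pt S) - G y) \<le> real (card S) * (B * norm (x - y))" if "finite S" for S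
    using that
  proof (induction S)
    case empty
    have "pt {} = y" by (simp add: pt_def vec_eq_iff)
    then show ?case by simp
  next
    case (insert i S)
    define c where "c = x $ i - y $ i"
    define h where "h t = G (pt S + (t * c) *\<^sub>R axis i 1)" for t
    \<comment> \<open>Each coordinate of the difference to \<open>y\<close> is 0, that of
      \<open>x - y\<close>, or a fraction of it, so the path stays where \<open>G'\<close> is
      bounded.\<close>
    have near: "norm (pt S + (t * c) *\<^sub>R axis i 1 - y) \<le> norm (x - y)" if t: "t \<in> {0..1}" for t
    proof (rule norm_le_componentwise_cart)
      fix j
      have "\<bar>t * c\<bar> \<le> \<bar>c\<bar>" using t by (simp add: abs_mult mult_left_le_one_le)
      then show "norm ((pt S + (t * c) *\<^sub>R axis i 1 - y) $ j) \<le> norm ((x - y) $ j)"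
        using insert.hyps by (auto simp: pt_def axis_def c_def)
    qed
    have "(h has_vector_derivative c *\<^sub>R G' i (pt S + (t * c) *\<^sub>R axis i 1)) (at t)" for t
    proof -
      have 1: "((\<lambda>s. s * c - t * c) has_vector_derivative c) (at t)"
        by (auto intro!: derivative_eq_intros simp flip: has_real_derivative_iff_has_vector_derivative)
      have 2: "((\<lambda>s. G (pt S + (t * c) *\<^sub>R axis i 1 + s *\<^sub>R axis i 1)) has_vector_derivative G' i (pt S + (t * c) *\<^sub>R axis i 1)) (at (t * c - t * c))"
        using deriv[of "pt S + (t * c) *\<^sub>R axis i 1" i] by simp
      from vector_diff_chain_at[OF 1 2] show ?thesis
        by (simp add: h_def[abs_def] o_def algebra_simps)
    qed
    then have hd: "(h has_derivative (\<lambda>s. s *\<^sub>R (c *\<^sub>R G' i (pt S + (t * c) *\<^sub>R axis i 1)))) (at t within {0..1})" for t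
      unfolding has_vector_derivative_def by (rule has_derivative_at_withinI)
    have "norm (h 1 - h 0) \<le> (\<bar>c\<bar> * B) * norm (1 - 0 :: real)"
    proof (rule differentiable_bound[OF _ hd])
      fix t :: real assume t: "t \<in> {0..1}"
      have *: "norm (G' i (pt S + (t * c) *\<^sub>R axis i 1)) \<le> B" by (intro bound near t)
      then show "onorm (\<lambda>s. s *\<^sub>R (c *\<^sub>R G' i (pt S + (t * c) *\<^sub>R axis i 1))) \<le> \<bar>c\<bar> * B"
      proof (intro onorm_le)
        fix s :: real
        have "norm (s *\<^sub>R (c *\<^sub>R G' i (pt S + (t * c) *\<^sub>R axis i 1))) =
            \<bar>s\<bar> * (\<bar>c\<bar> * norm (G' i (pt S + (t * c) *\<^sub>R axis i 1)))" by (simp add: abs_mult)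
        also have "\<dots> \<le> \<bar>s\<bar> * (\<bar>c\<bar> * B)" using * by (intro mult_left_mono) auto
        finally show "norm (s *\<^sub>R (c *\<^sub>R G' i (pt S + (t * c) *\<^sub>R axis i 1))) \<le> \<bar>c\<bar> * B * norm s"
          by (simp add: mult.commute)
      qed
    qed auto
    moreover have "h 0 = G (pt S)" by (simp add: h_def)
    moreover have "pt (insert i S) = pt S + c *\<^sub>R axis i 1"
      using insert.hyps by (auto simp: pt_def c_def vec_eq_iff axis_def)
    then have "h 1 = G (pt (insert i S))" by (simp add: h_def)
    moreover have "\<bar>c\<bar> * B \<le> norm (x - y) * B"
      using \<open>0 \<le> B\<close> component_le_norm_cart[of "x - y" i] by (intro mult_right_mono) (auto simp: c_def)
    ultimately have "norm (G (pt (insert i S)) - G (pt S)) \<le> B * norm (x - y)"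
      by (simp add: mult.commute)
    with insert norm_triangle_ineq[of "G (pt (insert i S)) - G (pt S)" "G (pt S) - G y"]
    show ?case by (simp add: algebra_simps)
  qed
  from this[of UNIV] have "norm (G (pt UNIV) - G y) \<le> real CARD('n) * (B * norm (x - y))" by simp
  moreover have "pt UNIV = x" by (simp add: pt_def vec_eq_iff)
  ultimately show ?thesis by (simp add: mult.assoc)
qed

text \<open>Induction on \<open>m\<close> with \<open>y\<close> fixed: the partial derivatives of a
  remainder are remainders of one order less, bounded on the ball about \<open>y\<close> through
  \<open>x\<close>, and the remainder vanishes at \<open>y\<close>. Each level costs one factor
  \<open>CARD('n)\<close>.\<close>

lemma taylor_remainder_bound:
  fixes A :: "real ^ 'n \<Rightarrow> complex"
  assumes "C_k m A" "0 \<le> L" "0 < \<beta>"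
    and "\<And>\<gamma> x y. mi_order \<gamma> = m \<Longrightarrow> norm (mi_deriv \<gamma> A x - mi_deriv \<gamma> A y) \<le> L * norm (x - y) powr \<beta>"
  shows "norm (taylor_remainder (Suc m) A x y) \<le> real CARD('n) ^ m * L * norm (x - y) powr (real m + \<beta>)"
  using assms
proof (induction m arbitrary: A x)
  case 0
  then show ?case
    using "0.prems"(4)[of "\<lambda>_. 0" x y] by (simp add: taylor_remainder_1 mi_deriv_zero mi_order_0_iff)
next
  case (Suc m)
  let ?B = "real CARD('n) ^ m * L * norm (x - y) powr (real m + \<beta>)"
  have "norm (taylor_remainder (Suc (Suc m)) A x y - taylor_remainder (Suc (Suc m)) A y y) \<le> real CARD('n) * ?B * norm (x - y)"
  proof (rule coordinate_path_bound[OF taylor_remainder_partial[OF Suc.prems(1) refl]])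
    fix w :: "real ^ 'n" and i
    assume w: "norm (w - y) \<le> norm (x - y)"
    have "norm (taylor_remainder (Suc m) (partial_deriv i A) w y) \<le> real CARD('n) ^ m * L * norm (w - y) powr (real m + \<beta>)"
    proof (rule Suc.IH)
      fix \<gamma> :: "'n \<Rightarrow> nat" and x y :: "real ^ 'n" assume \<gamma>: "mi_order \<gamma> = m"
      then show "norm (mi_deriv \<gamma> (partial_deriv i A) x - mi_deriv \<gamma> (partial_deriv i A) y) \<le> L * norm (x - y) powr \<beta>"
        using Suc.prems(4)[of "mi_inc i \<gamma>" x y] mi_deriv_partial[of \<gamma> A i] Suc.prems(1)
        by (simp add: mi_order_upd del: C_k.simps)
    qed (use Suc.prems in \<open>auto simp del: C_k.simps intro: C_k_partial\<close>)
    also have "\<dots> \<le> ?B"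
      using w Suc.prems by (intro mult_left_mono powr_mono2) auto
    finally show "norm (taylor_remainder (Suc m) (partial_deriv i A) w y) \<le> ?B" .
  qed
  moreover have "norm (x - y) powr (real m + \<beta>) * norm (x - y) = norm (x - y) powr (real (Suc m) + \<beta>)"
    using Suc.prems(3) by (cases "norm (x - y) = 0") (auto simp: powr_add)
  ultimately show ?case by (simp add: taylor_remainder_same mult.assoc del: of_nat_Suc)
qed

lemma taylor_remainder_measurable:
  assumes "C_k m A"
  shows "(\<lambda>(x, y). taylor_remainder (Suc m) A x y) \<in> borel_measurable (borel \<Otimes>\<^sub>M borel)"
proof -
  have 1: "continuous_on UNIV (\<lambda>z::(real ^ 'a) \<times> (real ^ 'a). mi_deriv \<gamma> A (snd z))" if "mi_order \<gamma> < Suc m" for \<gamma>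
    using that by (intro continuous_on_compose2[OF mi_deriv_continuous[OF assms]] continuous_intros) auto
  have 2: "continuous_on UNIV (\<lambda>z::(real ^ 'a) \<times> (real ^ 'a). A (fst z))"
    by (intro continuous_on_compose2[OF C_k_continuous[OF assms]] continuous_intros) auto
  have "continuous_on UNIV (\<lambda>z. taylor_remainder (Suc m) A (fst z) (snd z))"
    unfolding taylor_remainder_def mi_power_def
    by (intro continuous_intros 1 2) (auto simp: less_imp_neq[OF mi_fact_pos, symmetric])
  then show ?thesis
    by (simp add: borel_prod case_prod_unfold borel_measurable_continuous_onI)
qed

section \<open>Borel representatives\<close>

lemma completion_ex_borel_measurable_complex:
  fixes f :: "'a \<Rightarrow> complex"
  assumes f: "f \<in> borel_measurable (completion M)"
  shows "\<exists>f'\<in>borel_measurable M. AE x in M. f x = f' x"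
proof -
  have "(\<lambda>x. Re (f x)) \<in> borel_measurable (completion M)" "(\<lambda>x. Im (f x)) \<in> borel_measurable (completion M)"
    using f by (auto intro: borel_measurable_Re borel_measurable_Im)
  from this[THEN completion_ex_borel_measurable_real] obtain g h
    where [measurable]: "g \<in> borel_measurable M" "h \<in> borel_measurable M"
    and ae: "AE x in M. Re (f x) = g x" "AE x in M. Im (f x) = h x"
    by blast
  have "(\<lambda>x. complex_of_real (g x) + \<i> * complex_of_real (h x)) \<in> borel_measurable M"
    by measurable
  moreover have "AE x in M. f x = complex_of_real (g x) + \<i> * complex_of_real (h x)"
    using ae by eventually_elim (rule complex_eqI, auto)
  ultimately show ?thesis
    by (intro bexI[of _ "\<lambda>x. complex_of_real (g x) + \<i> * complex_of_real (h x)"])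
qed

lemma measurable_completion_AE:
  assumes g: "g \<in> borel_measurable M" and ae: "AE x in M. f x = g x"
  shows "f \<in> borel_measurable (completion M)"
proof (rule measurableI)
  fix A :: "'b set" assume A: "A \<in> sets borel"
  show "f -` A \<inter> space (completion M) \<in> sets (completion M)"
  proof (rule completion.in_sets_AE)
    show "AE x in completion M. (x \<in> g -` A \<inter> space M) = (x \<in> f -` A \<inter> space (completion M))"
      using ae by (intro AE_completion) (auto elim: eventually_mono)
    show "g -` A \<inter> space M \<in> sets (completion M)"
      using measurable_sets[OF g A] by simp
  qed auto
qed simp

text \<open>Lebesgue measure is the completion of \<open>lborel\<close>, so this replaces integrands
  by Borel representatives, for the value of the integral as well as for its existence.\<close>

lemma integral_completion_AE:
  fixes f g :: "'a \<Rightarrow> 'b::{banach, second_countable_topology}"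
  assumes g: "g \<in> borel_measurable M" and ae: "AE x in M. f x = g x"
  shows "integral\<^sup>L (completion M) f = integral\<^sup>L M g"
    and "integrable (completion M) f \<longleftrightarrow> integrable M g"
proof -
  have f: "f \<in> borel_measurable (completion M)" by (rule measurable_completion_AE[OF g ae])
  have "integral\<^sup>L (completion M) f = integral\<^sup>L (completion M) g"
    by (rule integral_cong_AE[OF f measurable_completion[OF g] AE_completion[OF ae]])
  then show "integral\<^sup>L (completion M) f = integral\<^sup>L M g" using integral_completion[OF g] by simp
  have "integrable (completion M) f \<longleftrightarrow> integrable (completion M) g"
    by (rule integrable_cong_AE[OF f measurable_completion[OF g] AE_completion[OF ae]])
  then show "integrable (completion M) f \<longleftrightarrow> integrable M g" using integrable_completion[OF g] by simp
qed

lemma nn_integral_lborel_scale: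
  fixes f :: "'a::euclidean_space \<Rightarrow> ennreal"
  assumes [measurable]: "f \<in> borel_measurable borel" and r: "0 < r"
  shows "(\<integral>\<^sup>+z. f z \<partial>lborel) = ennreal (r ^ DIM('a)) * (\<integral>\<^sup>+z. f (r *\<^sub>R z) \<partial>lborel)"
proof -
  have "(\<integral>\<^sup>+z. f z \<partial>lborel) = (\<integral>\<^sup>+z. f z \<partial>density (distr lborel borel (\<lambda>x. 0 + r *\<^sub>R x)) (\<lambda>_. ennreal (\<bar>r\<bar> ^ DIM('a))))"
    using lborel_affine[of r "0::'a"] r by simp
  also have "\<dots> = ennreal (r ^ DIM('a)) * (\<integral>\<^sup>+z. f (r *\<^sub>R z) \<partial>lborel)"
    using r by (simp add: nn_integral_density nn_integral_distr nn_integral_cmult)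
  finally show ?thesis .
qed

lemma AE_lborel_reflect:
  fixes P :: "'a::euclidean_space \<Rightarrow> bool"
  assumes "AE z in lborel. P z" shows "AE y in lborel. P (x - y)"
proof -
  obtain N where N: "{z. \<not> P z} \<subseteq> N" "emeasure lborel N = 0" "N \<in> sets borel"
    using AE_E[OF assms] by auto
  have "lborel = distr lborel borel (\<lambda>y. x - y)"
    using lborel_affine[of "-1" x] by (simp add: density_1)
  then have "emeasure (distr lborel borel (\<lambda>y. x - y)) N = 0" using N(2) by simp
  then have "emeasure lborel ((\<lambda>y. x - y) -` N) = 0"
    using N(3) by (subst (asm) emeasure_distr) auto
  moreover have "(\<lambda>y. x - y) -` N \<in> sets borel"
    using measurable_sets[of "\<lambda>y. x - y" borel borel N] N(3) by simp
  ultimately show ?thesis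
    using N(1) by (intro AE_I[of _ _ "(\<lambda>y. x - y) -` N"]) auto
qed

section \<open>Surface measure and the radial extension of the kernel\<close>

lemma sgn_borel_measurable [measurable]: "(sgn :: 'a::euclidean_space \<Rightarrow> 'a) \<in> borel_measurable borel"
  unfolding sgn_div_norm by measurable

lemma sgn_measurable_sphere:
  "(sgn :: 'a::euclidean_space \<Rightarrow> 'a) \<in> restrict_space lborel (ball 0 1 - {0}) \<rightarrow>\<^sub>M restrict_space borel (sphere 0 1)"
proof (rule measurable_restrict_space2)
  show "sgn \<in> space (restrict_space lborel (ball 0 1 - {0})) \<rightarrow> sphere (0::'a) 1"
    by (auto simp: space_restrict_space norm_sgn)
  show "(sgn :: 'a \<Rightarrow> 'a) \<in> restrict_space lborel (ball 0 1 - {0}) \<rightarrow>\<^sub>M borel"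
    by (intro measurable_restrict_space1) simp
qed

lemma sets_sphere_measure [measurable_cong]: "sets sphere_measure = sets (restrict_space borel (sphere 0 1))"
  by (simp add: sphere_measure_def)

lemma space_sphere_measure [simp]: "space sphere_measure = sphere 0 1"
  using sets_eq_imp_space_eq[OF sets_sphere_measure] by (simp add: space_restrict_space)

lemma nn_integral_sphere_measure:
  fixes g :: "real ^ 'n \<Rightarrow> ennreal"
  assumes g: "g \<in> borel_measurable (restrict_space borel (sphere 0 1))"
  shows "(\<integral>\<^sup>+x. g x \<partial>sphere_measure) = of_nat CARD('n) * (\<integral>\<^sup>+z\<in>ball 0 1 - {0}. g (sgn z) \<partial>lborel)"
proof -
  let ?R = "restrict_space lborel (ball 0 1 - {0}) :: (real ^ 'n) measure"
  have "(\<integral>\<^sup>+x. g x \<partial>sphere_measure) = of_nat CARD('n) * (\<integral>\<^sup>+x. g x \<partial>distr ?R (restrict_space borel (sphere 0 1)) sgn)"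
    unfolding sphere_measure_def using g by (subst nn_integral_scale_measure) auto
  also have "(\<integral>\<^sup>+x. g x \<partial>distr ?R (restrict_space borel (sphere 0 1)) sgn) = (\<integral>\<^sup>+z. g (sgn z) \<partial>?R)"
    by (rule nn_integral_distr[OF sgn_measurable_sphere]) (use g in auto)
  also have "\<dots> = (\<integral>\<^sup>+z\<in>ball 0 1 - {0}. g (sgn z) \<partial>lborel)"
    by (rule nn_integral_restrict_space) auto
  finally show ?thesis .
qed

text \<open>The cone over a null set of the sphere is null inside the unit ball by the definition of
  \<open>sphere_measure\<close>, then inside every ball by dilation, and finally everywhere by a
  countable union.\<close>

lemma AE_sphere_measure:
  fixes P :: "real ^ 'n \<Rightarrow> bool"
  assumes "AE x in sphere_measure. P x"
  shows "AE z in lborel. z \<noteq> 0 \<longrightarrow> P (sgn z)"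
proof -
  obtain N where N: "{x \<in> sphere 0 1. \<not> P x} \<subseteq> N" "emeasure sphere_measure N = 0" "N \<in> sets (restrict_space borel (sphere 0 1))"
    using AE_E[OF assms] by (auto simp: sets_sphere_measure)
  then have N': "N \<in> sets borel" "N \<subseteq> sphere 0 1"
    by (auto simp: sets_restrict_space)
  define W where "W k = {z. z \<in> ball 0 k - {0} \<and> sgn z \<in> N}" for k :: real
  have [measurable]: "W k \<in> sets borel" for k
  proof -
    have "W k = (ball 0 k - {0}) \<inter> (sgn -` N)" by (auto simp: W_def)
    moreover have "sgn -` N \<in> sets borel"
      using measurable_sets[OF sgn_borel_measurable N'(1)] by simp
    ultimately show ?thesis by auto
  qed
  have "0 = (\<integral>\<^sup>+x. indicator N x \<partial>sphere_measure)"
    using N by (subst nn_integral_indicator) (auto simp: sets_sphere_measure)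
  also have "\<dots> = of_nat CARD('n) * (\<integral>\<^sup>+z\<in>ball 0 1 - {0}. indicator N (sgn z) \<partial>lborel)"
    using N(3) by (intro nn_integral_sphere_measure) simp
  also have "(\<integral>\<^sup>+z\<in>ball 0 1 - {0}. indicator N (sgn z) \<partial>lborel) = (\<integral>\<^sup>+z. indicator (W 1) z \<partial>(lborel :: (real ^ 'n) measure))"
    by (intro nn_integral_cong) (auto simp: W_def indicator_def)
  finally have W1: "(\<integral>\<^sup>+z. indicator (W 1) z \<partial>(lborel :: (real ^ 'n) measure)) = 0" by simp
  have "emeasure lborel (W k) = 0" if k: "0 < k" for k
  proof -
    have "emeasure lborel (W k) = (\<integral>\<^sup>+z. indicator (W k) z \<partial>lborel)" by simp
    also have "\<dots> = ennreal (k ^ DIM(real ^ 'n)) * (\<integral>\<^sup>+z. indicator (W k) (k *\<^sub>R z) \<partial>lborel)"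
      by (rule nn_integral_lborel_scale) (use k in auto)
    also have "(\<lambda>z. indicator (W k) (k *\<^sub>R z) :: ennreal) = indicator (W 1)"
      using k by (auto simp: fun_eq_iff indicator_def W_def sgn_scaleR)
    finally show ?thesis using W1 by simp
  qed
  then have "W (real (Suc j)) \<in> null_sets lborel" for j by auto
  then have "(\<Union>j. W (real (Suc j))) \<in> null_sets lborel" by (rule null_sets_UN)
  moreover have "{z. \<not> (z \<noteq> 0 \<longrightarrow> P (sgn z))} \<subseteq> (\<Union>j. W (real (Suc j)))"
  proof
    fix z :: "real ^ 'n" assume z: "z \<in> {z. \<not> (z \<noteq> 0 \<longrightarrow> P (sgn z))}"
    obtain j where "norm z < real j" using reals_Archimedean2 by blast
    then have "z \<in> ball 0 (real (Suc j))" by simp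
    moreover have "sgn z \<in> N" using z N(1) by (auto simp: norm_sgn)
    ultimately show "z \<in> (\<Union>j. W (real (Suc j)))" using z by (auto simp: W_def simp del: of_nat_Suc)
  qed
  ultimately show ?thesis by (intro AE_I'[of "\<Union>j. W (real (Suc j))"]) auto
qed

text \<open>A Borel representative is chosen on the sphere and then extended radially, so that
  \<Omega>0 is homogeneous at every point and its integrals over balls scale exactly. The constant
  \<open>K\<close> is the integral over the unit ball.\<close>

lemma Ls_sphere_borel_extension:
  fixes \<Omega> :: "real ^ 'n \<Rightarrow> complex"
  assumes \<Omega>: "\<Omega> \<in> Ls_sphere s" and hom: "homogeneous_deg0 \<Omega>"
  obtains \<Omega>0 K where "\<Omega>0 \<in> borel_measurable borel" "AE z in lborel. \<Omega> z = \<Omega>0 z" "0 \<le> K"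
    "\<And>r. 0 < r \<Longrightarrow> (\<integral>\<^sup>+z\<in>ball 0 r. ennreal (norm (\<Omega>0 z) powr s) \<partial>lborel) \<le> ennreal (K * r powr real CARD('n))"
proof -
  have "\<Omega> \<in> borel_measurable (completion sphere_measure)" and int: "integrable (completion sphere_measure) (\<lambda>x. norm (\<Omega> x) powr s)"
    using \<Omega> by (auto simp: Ls_sphere_def)
  then obtain \<Omega>1 where \<Omega>1: "\<Omega>1 \<in> borel_measurable sphere_measure" and ae: "AE x in sphere_measure. \<Omega> x = \<Omega>1 x"
    using completion_ex_borel_measurable_complex by blast
  have \<Omega>1': "\<Omega>1 \<in> borel_measurable (restrict_space borel (sphere 0 1))"
    using \<Omega>1 measurable_cong_sets[OF sets_sphere_measure refl] by blast
  \<comment> \<open>Extension by 0 off the sphere gives a Borel function on the whole space;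
    composition with \<open>sgn\<close> makes it radially constant, with value 0 at the origin
    because \<open>sgn 0 = 0\<close>.\<close>
  define \<Omega>2 where "\<Omega>2 x = indicator (sphere 0 1) x *\<^sub>R \<Omega>1 x" for x
  define \<Omega>0 where "\<Omega>0 z = \<Omega>2 (sgn z)" for z
  have "\<Omega>2 \<in> borel_measurable borel"
    using \<Omega>1' borel_measurable_restrict_space_iff[of "sphere 0 1" borel \<Omega>1] by (simp add: \<Omega>2_def[abs_def])
  then have [measurable]: "\<Omega>0 \<in> borel_measurable borel"
    unfolding \<Omega>0_def[abs_def] by measurable
  have eq0: "\<Omega>0 z = \<Omega>1 (sgn z)" if "z \<noteq> 0" for z
    using that by (simp add: \<Omega>0_def \<Omega>2_def norm_sgn)
  have homog: "\<Omega> (sgn z) = \<Omega> z" if "z \<noteq> 0" for z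
    using hom that unfolding homogeneous_deg0_def sgn_div_norm by simp
  have "AE z in lborel. z \<noteq> (0 :: real ^ 'n)" by (rule AE_lborel_singleton)
  with AE_sphere_measure[OF ae] have ae0: "AE z in lborel. \<Omega> z = \<Omega>0 z"
    by eventually_elim (metis eq0 homog)
  define I where "I = (\<integral>\<^sup>+z\<in>ball 0 1. ennreal (norm (\<Omega>0 z) powr s) \<partial>lborel)"
  have "(\<integral>\<^sup>+x. ennreal (norm (\<Omega> x) powr s) \<partial>completion sphere_measure) < top"
    using int by (simp add: integrable_iff_bounded)
  also have "(\<integral>\<^sup>+x. ennreal (norm (\<Omega> x) powr s) \<partial>completion sphere_measure) = (\<integral>\<^sup>+x. ennreal (norm (\<Omega>1 x) powr s) \<partial>sphere_measure)"
    unfolding nn_integral_completion using ae by (intro nn_integral_cong_AE) (auto elim: eventually_mono)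
  also have "\<dots> = of_nat CARD('n) * (\<integral>\<^sup>+z\<in>ball 0 1 - {0}. ennreal (norm (\<Omega>1 (sgn z)) powr s) \<partial>lborel)"
    using \<Omega>1' by (intro nn_integral_sphere_measure) simp
  also have "(\<integral>\<^sup>+z\<in>ball 0 1 - {0}. ennreal (norm (\<Omega>1 (sgn z)) powr s) \<partial>lborel) = I"
    unfolding I_def
  proof (intro nn_integral_cong_AE)
    show "AE z in lborel. ennreal (norm (\<Omega>1 (sgn z)) powr s) * indicator (ball 0 1 - {0}) z =
        ennreal (norm (\<Omega>0 z) powr s) * indicator (ball 0 1) z"
      using AE_lborel_singleton[of "0 :: real ^ 'n"] by eventually_elim (auto simp: indicator_def eq0)
  qed
  finally have I: "I < top"
    by (auto simp: ennreal_mult_less_top)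
  have scale: "(\<integral>\<^sup>+z\<in>ball 0 r. ennreal (norm (\<Omega>0 z) powr s) \<partial>lborel) = ennreal (r ^ CARD('n)) * I" if r: "0 < r" for r
  proof -
    have "\<Omega>0 (r *\<^sub>R z) = \<Omega>0 z" for z using r by (simp add: \<Omega>0_def sgn_scaleR)
    moreover have "indicator (ball 0 r) (r *\<^sub>R z) = (indicator (ball 0 1) z :: ennreal)" for z :: "real ^ 'n"
      using r by (auto simp: indicator_def)
    ultimately show ?thesis
      using nn_integral_lborel_scale[of "\<lambda>z. ennreal (norm (\<Omega>0 z) powr s) * indicator (ball 0 r) z" r] r
      by (simp add: I_def)
  qed
  show thesis
  proof (rule that[OF _ ae0, of "enn2real I"])
    fix r :: real assume r: "0 < r"
    have "ennreal (enn2real I * r powr real CARD('n)) = I * ennreal (r ^ CARD('n))"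
      using I r by (simp add: ennreal_mult powr_realpow)
    then show "(\<integral>\<^sup>+z\<in>ball 0 r. ennreal (norm (\<Omega>0 z) powr s) \<partial>lborel) \<le> ennreal (enn2real I * r powr real CARD('n))"
      using scale[OF r] by (simp add: mult.commute)
  qed auto
qed

text \<open>Measurability follows by exhausting the space with compact balls. Replacing nonpositive
  values by 1 changes the weight on a null set only and gives the pointwise positivity that
  \<open>weight_pair\<close> demands.\<close>

lemma weight_borel:
  fixes w :: "real ^ 'n \<Rightarrow> real"
  assumes "weight w"
  obtains w0 :: "real ^ 'n \<Rightarrow> real" where "w0 \<in> borel_measurable borel" "\<And>x. 0 < w0 x" "AE x in lborel. w x = w0 x"
proof -
  have "w \<in> borel_measurable lebesgue"
  proof (rule borel_measurable_LIMSEQ_real)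
    fix k :: nat
    have "set_integrable lebesgue (cball 0 (real k)) w" using assms by (simp add: weight_def)
    then show "(\<lambda>x. indicator (cball 0 (real k)) x *\<^sub>R w x) \<in> borel_measurable lebesgue"
      by (simp add: set_integrable_def)
  next
    fix x :: "real ^ 'n"
    obtain k0 :: nat where k0: "norm x \<le> real k0" using real_arch_simple by blast
    have "\<forall>\<^sub>F k in sequentially. indicator (cball 0 (real k)) x *\<^sub>R w x = w x"
      using eventually_ge_at_top[of k0]
      by eventually_elim (use k0 in \<open>auto simp: indicator_def\<close>)
    then show "(\<lambda>k. indicator (cball 0 (real k)) x *\<^sub>R w x) \<longlonglongrightarrow> w x"
      by (rule tendsto_eventually)
  qed
  then obtain w1 where w1: "w1 \<in> borel_measurable lborel" "AE x in lborel. w x = w1 x"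
    using completion_ex_borel_measurable_real by blast
  define w0 where "w0 x = (if 0 < w1 x then w1 x else 1)" for x
  show thesis
  proof
    show "w0 \<in> borel_measurable borel" unfolding w0_def[abs_def] using w1(1) by simp
    show "0 < w0 x" for x by (simp add: w0_def)
    have "AE x in lborel. 0 < w x" using assms by (simp add: weight_def AE_completion_iff)
    with w1(2) show "AE x in lborel. w x = w0 x"
      by eventually_elim (simp add: w0_def)
  qed
qed

section \<open>Weights, kernels and Morrey norms\<close>

lemma emeasure_wmeasure_set_integral:
  fixes u h :: "'a::euclidean_space \<Rightarrow> real"
  assumes u [measurable]: "u \<in> borel_measurable borel" "\<And>x. 0 \<le> u x" and ae: "AE x in lborel. h x = u x"
    and int: "set_integrable lebesgue B h" and B [measurable]: "B \<in> sets borel"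
  shows "emeasure (wmeasure u) B = ennreal (LINT x:B|lebesgue. h x)"
proof -
  have nonneg: "AE x in lebesgue. 0 \<le> indicator B x *\<^sub>R h x"
    using AE_completion[OF ae] by eventually_elim (use u(2) in auto)
  have "emeasure (wmeasure u) B = (\<integral>\<^sup>+x\<in>B. ennreal (u x) \<partial>lebesgue)"
    by (simp add: emeasure_wmeasure nn_integral_completion)
  also have "\<dots> = (\<integral>\<^sup>+x. ennreal (indicator B x *\<^sub>R h x) \<partial>lebesgue)"
  proof (rule nn_integral_cong_AE)
    show "AE x in lebesgue. ennreal (u x) * indicator B x = ennreal (indicator B x *\<^sub>R h x)"
      using AE_completion[OF ae] by eventually_elim (auto simp: indicator_def)
  qed
  also have "\<dots> = ennreal (LINT x:B|lebesgue. h x)"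
    unfolding set_lebesgue_integral_def
    using int nonneg by (intro nn_integral_eq_integral) (auto simp: set_integrable_def)
  finally show ?thesis .
qed

text \<open>The dual weight is \<open>w0 powr (- e)\<close>, where \<open>e\<close> is
  \<open>s'\<close> times the conjugate exponent of \<open>p / s'\<close>. Since that conjugate
  exponent is \<open>1 / b\<close>, both \<open>q * a\<close> and \<open>e * b\<close> equal
  \<open>s'\<close>, which gives the duality relation.\<close>

lemma class_A_weight_pair:
  fixes w w0 :: "real ^ 'n \<Rightarrow> real"
  assumes w0 [measurable]: "w0 \<in> borel_measurable borel" and pos: "\<And>x. 0 < w0 x" and ae: "AE x in lborel. w x = w0 x"
    and s': "1 < s'" "s' < p" and q: "0 < q"
    and A: "(\<lambda>x. w x powr s') \<in> class_A (p / s') (q / s')"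
  obtains \<sigma> C where "weight_pair (\<lambda>x. w0 x powr q) \<sigma> (s' / q) (1 - s' / p) C"
proof -
  define e where "e = s' * ((p / s') / (p / s' - 1))"
  define u where "u x = w0 x powr q" for x
  define \<sigma> where "\<sigma> x = w0 x powr (- e)" for x
  define a where "a = s' / q"
  define b where "b = 1 - s' / p"
  have b: "0 < b" "(p / s' - 1) / (p / s') = b" using s' by (auto simp: b_def field_simps)
  have eb: "e * b = s'" using s' unfolding b(2)[symmetric] e_def by simp
  have a: "0 < a" "1 / (q / s') = a" using s' q by (auto simp: a_def)
  have [measurable]: "u \<in> borel_measurable borel" "\<sigma> \<in> borel_measurable borel"
    unfolding u_def[abs_def] \<sigma>_def[abs_def] by measurable
  let ?U = "\<lambda>x. (w x powr s') powr (q / s')" and ?S = "\<lambda>x. (w x powr s') powr (- (p / s' / (p / s' - 1)))"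
  obtain C where C: "1 < C" and AC: "\<And>c r. 0 < r \<Longrightarrow> set_integrable lebesgue (ball c r) ?U"
    "\<And>c r. 0 < r \<Longrightarrow> set_integrable lebesgue (ball c r) ?S"
    "\<And>c r. 0 < r \<Longrightarrow> (1 / measure lebesgue (ball c r) * (LINT x:ball c r|lebesgue. ?U x)) powr a *
      (1 / measure lebesgue (ball c r) * (LINT x:ball c r|lebesgue. ?S x)) powr b \<le> C"
    using A unfolding class_A_def a(2) b(2) by auto
  have ae_U: "AE x in lborel. ?U x = u x"
    using ae by eventually_elim (use s' in \<open>simp add: u_def powr_powr\<close>)
  have ae_S: "AE x in lborel. ?S x = \<sigma> x"
    using ae by eventually_elim (use s' in \<open>simp add: \<sigma>_def powr_powr e_def\<close>)
  have U: "emeasure (wmeasure u) (ball c r) = ennreal (LINT x:ball c r|lebesgue. ?U x)" if "0 < r" for c r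
    by (rule emeasure_wmeasure_set_integral[OF _ _ ae_U AC(1)[OF that]]) (auto simp: u_def)
  have S: "emeasure (wmeasure \<sigma>) (ball c r) = ennreal (LINT x:ball c r|lebesgue. ?S x)" if "0 < r" for c r
    by (rule emeasure_wmeasure_set_integral[OF _ _ ae_S AC(2)[OF that]]) (auto simp: \<sigma>_def)
  have "weight_pair u \<sigma> a b C"
  proof
    fix x
    show "0 < u x" "0 < \<sigma> x" using pos[of x] by (auto simp: u_def \<sigma>_def)
    have "u x powr a * \<sigma> x powr b = w0 x powr (q * a) * w0 x powr (- (e * b))"
      by (simp add: u_def \<sigma>_def powr_powr)
    also have "q * a = s'" using q by (simp add: a_def)
    finally show "u x powr a * \<sigma> x powr b = 1" using pos[of x] by (simp add: eb flip: powr_add)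
  next
    fix c :: "real ^ 'n" and r :: real
    show "emeasure (wmeasure u) (ball c r) < top"
      by (cases "0 < r") (simp_all add: U ball_empty not_less)
    show "emeasure (wmeasure \<sigma>) (ball c r) < top"
      by (cases "0 < r") (simp_all add: S ball_empty not_less)
    assume r: "0 < r"
    define Ui where "Ui = (LINT x:ball c r|lebesgue. ?U x)"
    define Si where "Si = (LINT x:ball c r|lebesgue. ?S x)"
    define l where "l = measure lborel (ball c r)"
    have l: "0 < l" using r by (simp add: l_def)
    have nn: "0 \<le> Ui" "0 \<le> Si"
      unfolding Ui_def Si_def set_lebesgue_integral_def by (auto intro!: integral_nonneg_AE)
    have "(1 / l * Ui) powr a * (1 / l * Si) powr b \<le> C"
      using AC(3)[OF r, of c] by (simp add: Ui_def Si_def l_def)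
    then have "Ui powr a * Si powr b \<le> C * l powr (a + b)"
      using l nn by (simp add: powr_mult powr_divide powr_add field_simps)
    moreover have "measure (wmeasure u) (ball c r) = Ui" "measure (wmeasure \<sigma>) (ball c r) = Si"
      using U[OF r, of c] S[OF r, of c] nn by (simp_all add: measure_def Ui_def Si_def)
    ultimately show "measure (wmeasure u) (ball c r) powr a * measure (wmeasure \<sigma>) (ball c r) powr b
        \<le> C * measure lborel (ball c r) powr (a + b)"
      by (simp add: l_def)
  qed (use a b C in auto)
  then show thesis using that[of \<sigma> C] by (simp add: u_def[abs_def] a_def b_def)
qed

text \<open>The infimum is itself an admissible constant, as division by the power of the distance
  shows. A point of norm 1 excludes negative constants.\<close>

lemma lip_norm_bound:
  fixes g :: "real ^ 'n \<Rightarrow> complex"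
  assumes g: "g \<in> lip_space \<beta>" 
  shows "0 \<le> lip_norm \<beta> g" "norm (g x - g y) \<le> lip_norm \<beta> g * norm (x - y) powr \<beta>"
proof -
  let ?X = "{C. \<forall>x y. norm (g x - g y) \<le> C * norm (x - y) powr \<beta>}"
  have ne: "?X \<noteq> {}" using g by (auto simp: lip_space_def)
  have nonneg: "0 \<le> C" if "C \<in> ?X" for C
  proof -
    obtain z :: "real ^ 'n" where z: "norm z = 1" using vector_choose_size[of 1] by auto
    have "0 \<le> norm (g z - g 0)" by simp
    also have "\<dots> \<le> C * norm (z - 0) powr \<beta>" using that by blast
    finally show ?thesis using z by simp
  qed
  show "0 \<le> lip_norm \<beta> g"
    unfolding lip_norm_def using ne nonneg by (intro cInf_greatest) auto
  show "norm (g x - g y) \<le> lip_norm \<beta> g * norm (x - y) powr \<beta>"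
  proof (cases "x = y")
    case False
    then have pos: "0 < norm (x - y) powr \<beta>" by simp
    have "norm (g x - g y) / norm (x - y) powr \<beta> \<le> lip_norm \<beta> g"
      unfolding lip_norm_def
    proof (intro cInf_greatest ne)
      fix C assume "C \<in> ?X"
      then have "norm (g x - g y) \<le> C * norm (x - y) powr \<beta>" by blast
      then show "norm (g x - g y) / norm (x - y) powr \<beta> \<le> C" using pos by (simp add: field_simps)
    qed
    then show ?thesis using pos by (simp add: field_simps)
  qed simp
qed

lemma T_kernel_bound:
  fixes x y :: "real ^ 'n"
  assumes R: "norm (taylor_remainder (Suc k) A x y) \<le> G * norm (x - y) powr (real k + \<beta>)"
  shows "norm (T_kernel \<Omega> \<alpha> (Suc k) A x y) \<le> G * (norm (\<Omega> (x - y)) * norm (x - y) powr (\<alpha> + \<beta> - real CARD('n)))"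
proof (cases "x = y")
  case True
  then show ?thesis by (simp add: T_kernel_def)
next
  case False
  define e where "e = real CARD('n) - \<alpha> + real (Suc k) - 1"
  have pos: "0 < norm (x - y)" using False by simp
  have "norm (T_kernel \<Omega> \<alpha> (Suc k) A x y) = norm (\<Omega> (x - y)) / norm (x - y) powr e * norm (taylor_remainder (Suc k) A x y)"
    by (simp add: T_kernel_def norm_mult norm_divide e_def)
  also have "\<dots> \<le> norm (\<Omega> (x - y)) / norm (x - y) powr e * (G * norm (x - y) powr (real k + \<beta>))"
    by (intro mult_left_mono R) auto
  also have "\<dots> = G * (norm (\<Omega> (x - y)) * norm (x - y) powr (real k + \<beta> - e))"
    using pos by (simp add: powr_diff)
  also have "real k + \<beta> - e = \<alpha> + \<beta> - real CARD('n)" by (simp add: e_def)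
  finally show ?thesis .
qed

text \<open>Reduces an uncountable supremum to a countable one, for measurability. A rational radius
  slightly below \<open>r\<close> has a larger factor \<open>c\<close> and, by left continuity,
  nearly the same \<open>I\<close>.\<close>

lemma SUP_rational_radius:
  fixes I c :: "real \<Rightarrow> ennreal"
  assumes c: "\<And>r r'. 0 < r \<Longrightarrow> r \<le> r' \<Longrightarrow> c r' \<le> c r"
    and mono: "\<And>r r'. r \<le> r' \<Longrightarrow> I r \<le> I r'"
    and cont: "\<And>r. 0 < r \<Longrightarrow> I r = (SUP j::nat. I (r - r / real (j + 2)))"
  shows "(SUP r\<in>{0<..}. c r * I r) = (SUP r\<in>{0<..} \<inter> \<rat>. c r * I r)"
proof (rule antisym)
  show "(SUP r\<in>{0<..}. c r * I r) \<le> (SUP r\<in>{0<..} \<inter> \<rat>. c r * I r)"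
  proof (rule SUP_least)
    fix r :: real assume "r \<in> {0<..}"
    then have r: "0 < r" by simp
    have "c r * I r = (SUP j::nat. c r * I (r - r / real (j + 2)))"
      by (subst cont[OF r]) (simp add: SUP_mult_left_ennreal)
    also have "\<dots> \<le> (SUP r\<in>{0<..} \<inter> \<rat>. c r * I r)"
    proof (rule SUP_least)
      fix j :: nat
      \<comment> \<open>The shift by 2 keeps the radius positive at \<open>j = 0\<close>.\<close>
      have "0 < r - r / real (j + 2)" "r - r / real (j + 2) < r" using r by (auto simp: field_simps add_pos_nonneg)
      then obtain q where q: "q \<in> \<rat>" "r - r / real (j + 2) < q" "q < r" using Rats_dense_in_real by blast
      then have "c r * I (r - r / real (j + 2)) \<le> c q * I q"
        using \<open>0 < r - r / real (j + 2)\<close> by (intro mult_mono c mono) auto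
      also have "\<dots> \<le> (SUP r\<in>{0<..} \<inter> \<rat>. c r * I r)"
        using q \<open>0 < r - r / real (j + 2)\<close> by (intro SUP_upper) auto
      finally show "c r * I (r - r / real (j + 2)) \<le> (SUP r\<in>{0<..} \<inter> \<rat>. c r * I r)" .
    qed
    finally show "c r * I r \<le> (SUP r\<in>{0<..} \<inter> \<rat>. c r * I r)" .
  qed
qed (rule SUP_subset_mono, auto)

text \<open>An open ball is the increasing union of its smaller concentric balls.\<close>

lemma nn_integral_ball_left_continuous:
  fixes g :: "'a::euclidean_space \<Rightarrow> ennreal"
  assumes [measurable]: "g \<in> borel_measurable borel" and r: "0 < r"
  shows "(\<integral>\<^sup>+y\<in>ball x r. g y \<partial>lborel) = (SUP j::nat. \<integral>\<^sup>+y\<in>ball x (r - r / real (j + 2)). g y \<partial>lborel)"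
proof -
  have em: "emeasure (density lborel g) (ball x \<rho>) = (\<integral>\<^sup>+y\<in>ball x \<rho>. g y \<partial>lborel)" for \<rho>
    by (subst emeasure_density) auto
  let ?A = "\<lambda>j::nat. ball x (r - r / real (j + 2))"
  have "incseq ?A"
    using r by (auto simp: incseq_def frac_le intro!: subset_ball diff_left_mono)
  then have "(SUP j. emeasure (density lborel g) (?A j)) = emeasure (density lborel g) (\<Union>j. ?A j)"
    by (intro SUP_emeasure_incseq) auto
  moreover have "(\<Union>j. ?A j) = ball x r"
  proof safe
    fix y j assume "y \<in> ?A j"
    moreover have "0 \<le> r / real (j + 2)" using r by simp
    ultimately show "y \<in> ball x r" by simp
  next
    fix y assume "y \<in> ball x r"
    then have pos: "0 < r - dist x y" by simp
    obtain j :: nat where "r / (r - dist x y) < real j" using reals_Archimedean2 by blast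
    then have "r / (r - dist x y) < real (j + 2)" by simp
    then have "r / real (j + 2) < r - dist x y" using pos by (simp add: field_simps)
    then have "y \<in> ?A j" by simp
    then show "y \<in> (\<Union>j. ?A j)" by blast
  qed
  ultimately show ?thesis by (simp add: em)
qed

lemma measurable_SUP_radius:
  fixes G :: "real ^ 'n \<Rightarrow> real ^ 'n \<Rightarrow> ennreal"
  assumes G: "(\<lambda>(x, y). G x y) \<in> borel_measurable (borel \<Otimes>\<^sub>M borel)" and e: "0 \<le> e"
  shows "(\<lambda>x. SUP r\<in>{0<..}. ennreal (1 / r powr e) * (\<integral>\<^sup>+y\<in>ball x r. G x y \<partial>lborel)) \<in> borel_measurable borel"
proof -
  have [measurable]: "G x \<in> borel_measurable borel" for x
    using measurable_compose[OF measurable_Pair1' G, of x] by simp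
  have eq: "(SUP r\<in>{0<..}. ennreal (1 / r powr e) * (\<integral>\<^sup>+y\<in>ball x r. G x y \<partial>lborel)) =
    (SUP r\<in>{0<..} \<inter> \<rat>. ennreal (1 / r powr e) * (\<integral>\<^sup>+y\<in>ball x r. G x y \<partial>lborel))" for x
  proof (rule SUP_rational_radius)
    fix r r' :: real assume r: "0 < r" "r \<le> r'"
    have "r powr e \<le> r' powr e" using r e by (intro powr_mono2) auto
    then show "ennreal (1 / r' powr e) \<le> ennreal (1 / r powr e)"
      using r by (intro ennreal_leI divide_left_mono) auto
  next
    fix r r' :: real assume "r \<le> r'"
    then show "(\<integral>\<^sup>+y\<in>ball x r. G x y \<partial>lborel) \<le> (\<integral>\<^sup>+y\<in>ball x r'. G x y \<partial>lborel)"
      by (intro nn_integral_mono) (auto simp: indicator_def)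
  qed (rule nn_integral_ball_left_continuous, auto)
  have "(\<lambda>x. \<integral>\<^sup>+y\<in>ball x r. G x y \<partial>lborel) \<in> borel_measurable borel" for r
  proof -
    have "(\<lambda>(x, y). G x y * indicator {y. dist x y < r} y) \<in> borel_measurable (borel \<Otimes>\<^sub>M lborel)"
      using G by measurable
    then have "(\<lambda>x. \<integral>\<^sup>+y. G x y * indicator {y. dist x y < r} y \<partial>lborel) \<in> borel_measurable borel"
      by (rule lborel.borel_measurable_nn_integral)
    moreover have "ball x r = {y. dist x y < r}" for x :: "real ^ 'n" by auto
    ultimately show ?thesis by simp
  qed
  moreover have "countable ({0<..} \<inter> \<rat> :: real set)" by (simp add: countable_rat)
  ultimately show ?thesis unfolding eq by (intro borel_measurable_SUP) auto
qed

lemma morrey_norm_leI: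
  assumes p: "0 < p"
    and bound: "\<And>a r. 0 < r \<Longrightarrow> (\<integral>\<^sup>+x\<in>ball a r. F x powe p * ennreal (u x) \<partial>lebesgue) \<le>
      M powe p * (\<integral>\<^sup>+x\<in>ball a r. ennreal (v x) \<partial>lebesgue) powe \<kappa>"
  shows "morrey_norm p \<kappa> u v F \<le> M"
  unfolding morrey_norm_def
proof (rule SUP_least, clarify)
  fix a :: "real ^ 'a" and r :: real assume r: "0 < r"
  let ?X = "\<integral>\<^sup>+x\<in>ball a r. F x powe p * ennreal (u x) \<partial>lebesgue" and
    ?Y = "(\<integral>\<^sup>+x\<in>ball a r. ennreal (v x) \<partial>lebesgue) powe \<kappa>"
  have "?X / ?Y \<le> M powe p"
  proof (cases "?Y = 0")
    \<comment> \<open>The assumed bound forces the numerator to vanish too, and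
      \<open>0 / 0 = 0\<close>.\<close>
    case True
    then have "?X = 0" using bound[OF r, of a] by simp
    then show ?thesis by simp
  next
    case False
    then show ?thesis using bound[OF r, of a] by (intro divide_le_posI_ennreal) (auto simp: less_le mult.commute)
  qed
  then show "(?X / ?Y) powe (1 / p) \<le> M"
    using p by (simp add: powe_le_iff)
qed

lemma morrey_norm_ball:
  assumes p: "0 < p" and r: "0 < r"
    and Y: "(\<integral>\<^sup>+x\<in>ball a r. ennreal (v x) \<partial>lebesgue) = ennreal y" "0 < y"
  shows "(\<integral>\<^sup>+x\<in>ball a r. F x powe p * ennreal (u x) \<partial>lebesgue) \<le>
      morrey_norm p \<kappa> u v F powe p * ennreal (y powr \<kappa>)"
proof -
  let ?X = "\<integral>\<^sup>+x\<in>ball a r. F x powe p * ennreal (u x) \<partial>lebesgue"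
  have "(?X / ennreal (y powr \<kappa>)) powe (1 / p) \<le> morrey_norm p \<kappa> u v F"
    unfolding morrey_norm_def
    using Y r by (intro SUP_upper2[of "ball a r"]) auto
  then have "?X / ennreal (y powr \<kappa>) \<le> morrey_norm p \<kappa> u v F powe p"
    using p by (simp add: powe_le_iff)
  then have "?X / ennreal (y powr \<kappa>) * ennreal (y powr \<kappa>) \<le> morrey_norm p \<kappa> u v F powe p * ennreal (y powr \<kappa>)"
    by (rule mult_right_mono) simp
  then show ?thesis using Y(2) by (simp add: ennreal_divide_times ennreal_divide_self)
qed

section \<open>The main theorem\<close>

text \<open>Convergence almost everywhere and measurability accompany the norm bounds because the
  Bochner integral of a non-integrable function is 0 and the nonnegative integral of a
  non-measurable function is only a lower integral. The smoothness assumption on \<open>A\<close>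
  makes its derivatives of order \<open>m - 1\<close> classical and independent of the order of
  differentiation.\<close>

theorem theorem3p1:
  fixes \<Omega> :: "real ^ 'n \<Rightarrow> complex" and w :: "real ^ 'n \<Rightarrow> real"
    and m :: nat and \<alpha> \<beta> s s' p q \<kappa> :: real
  assumes "1 \<le> m"
    and "0 < \<alpha>" and "\<alpha> < real CARD('n)"
    and "0 < \<beta>" and "\<beta> < 1"
    and "0 < \<alpha> + \<beta>" and "\<alpha> + \<beta> < real CARD('n)"
    and "1 < s" and "\<Omega> \<in> Ls_sphere s" and "homogeneous_deg0 \<Omega>"
    and "1 / s + 1 / s' = 1"
    and "1 < s'" and "s' < p" and "p < real CARD('n) / (\<alpha> + \<beta>)"
    and "1 / q = 1 / p - (\<alpha> + \<beta>) / real CARD('n)"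
    and "0 < \<kappa>" and "\<kappa> < p / q"
    and "weight w"
    and "(\<lambda>x. w x powr s') \<in> class_A (p / s') (q / s')"
  shows "\<exists>C>0. \<forall>A. C_k (m - 1) A \<longrightarrow> (\<forall>\<gamma>. mi_order \<gamma> = m - 1 \<longrightarrow> mi_deriv \<gamma> A \<in> lip_space \<beta>) \<longrightarrow>
     (\<forall>f \<in> morrey_space p \<kappa> (\<lambda>x. w x powr p) (\<lambda>x. w x powr q).
        (AE x in lebesgue. integrable lebesgue (\<lambda>y. T_kernel \<Omega> \<alpha> m A x y * f y)) \<and>
        T_op \<Omega> \<alpha> m A f \<in> borel_measurable lebesgue \<and>
        morrey_norm q (\<kappa> * q / p) (\<lambda>x. w x powr q) (\<lambda>x. w x powr q)
            (\<lambda>x. ennreal (norm (T_op \<Omega> \<alpha> m A f x)))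
          \<le> ennreal (C * (\<Sum>\<gamma> | mi_order \<gamma> = m - 1. lip_norm \<beta> (mi_deriv \<gamma> A))) *
            morrey_norm p \<kappa> (\<lambda>x. w x powr p) (\<lambda>x. w x powr q) (\<lambda>x. ennreal (norm (f x))) \<and>
        M_op \<Omega> \<alpha> m A f \<in> borel_measurable lebesgue \<and>
        morrey_norm q (\<kappa> * q / p) (\<lambda>x. w x powr q) (\<lambda>x. w x powr q) (M_op \<Omega> \<alpha> m A f)
          \<le> ennreal (C * (\<Sum>\<gamma> | mi_order \<gamma> = m - 1. lip_norm \<beta> (mi_deriv \<gamma> A))) *
            morrey_norm p \<kappa> (\<lambda>x. w x powr p) (\<lambda>x. w x powr q) (\<lambda>x. ennreal (norm (f x))))"
proof -
  let ?n = "real CARD('n)"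
  let ?d = "\<alpha> + \<beta>"
  obtain k where m: "m = Suc k" using assms(1) by (cases m) auto
  have p: "0 < p" using assms(12,13) by simp
  have q_pos: "0 < q"
  proof -
    have "?d / ?n < 1 / p"
      using assms(6,14) p by (simp add: field_simps)
    then have "0 < 1 / q" unfolding assms(15) by simp
    then show ?thesis by simp
  qed
  obtain w0 :: "real ^ 'n \<Rightarrow> real" where w0 [measurable]: "w0 \<in> borel_measurable borel"
    and w0_pos: "\<And>x. 0 < w0 x" and w0_ae: "AE x in lborel. w x = w0 x"
    using weight_borel[OF assms(18)] by blast
  obtain \<Omega>0 K where \<Omega>0 [measurable]: "\<Omega>0 \<in> borel_measurable borel" and \<Omega>0_ae: "AE z in lborel. \<Omega> z = \<Omega>0 z"
    and K: "0 \<le> K" "\<And>r. 0 < r \<Longrightarrow> (\<integral>\<^sup>+z\<in>ball 0 r. ennreal (norm (\<Omega>0 z) powr s) \<partial>lborel) \<le> ennreal (K * r powr ?n)"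
    using Ls_sphere_borel_extension[OF assms(9,10)] by blast
  define u where "u x = w0 x powr q" for x
  obtain \<sigma> C0 where "weight_pair u \<sigma> (s' / q) (1 - s' / p) C0"
    using class_A_weight_pair[OF w0 w0_pos w0_ae assms(12,13) q_pos assms(19)] unfolding u_def[abs_def] by blast
  then interpret W: weight_pair u \<sigma> "s' / q" "1 - s' / p" C0 .
  interpret P: rough_potential u \<sigma> "s' / q" "1 - s' / p" C0 ?n ?d s s' p q "\<lambda>z. norm (\<Omega>0 z)" K
    by unfold_locales (use assms q_pos K in auto)
  obtain K1 where K1: "0 \<le> K1" and morrey: "\<And>\<phi> M c r. \<phi> \<in> borel_measurable borel \<Longrightarrow>
      (\<And>c r. 0 < r \<Longrightarrow> P.J \<phi> (ball c r) \<le> M powe p * ennreal (W.V c r powr \<kappa>)) \<Longrightarrow> 0 < r \<Longrightarrow>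
      (\<integral>\<^sup>+x\<in>ball c r. P.T \<phi> x UNIV powe q * ennreal (u x) \<partial>lborel) \<le>
        ennreal K1 * (M powe q * ennreal (W.V c r powr (\<kappa> * q / p)))"
    using P.morrey_bound_ex[OF assms(16,17)] by meson
  have wq_ae: "AE x in lborel. w x powr q = u x" and wp_ae: "AE x in lborel. w x powr p = u x powr (p / q)"
    using w0_ae by (eventually_elim, use q_pos in \<open>simp add: u_def powr_powr\<close>)+
  have V: "(\<integral>\<^sup>+x\<in>ball c r. ennreal (w x powr q) \<partial>lebesgue) = ennreal (W.V c r)" for c r
  proof -
    have "(\<integral>\<^sup>+x\<in>ball c r. ennreal (w x powr q) \<partial>lebesgue) = (\<integral>\<^sup>+x\<in>ball c r. ennreal (u x) \<partial>lborel)"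
      unfolding nn_integral_completion by (rule nn_integral_cong_AE, use wq_ae in eventually_elim) simp
    then show ?thesis by (simp add: W.emeasure_V[symmetric] emeasure_wmeasure)
  qed
  define c where "c = ?n ^ k"
  \<comment> \<open>The Taylor constant times the \<open>q\<close>-th root of the Morrey constant;
    the added 1 ensures positivity even if \<open>K1 = 0\<close>.\<close>
  define C where "C = c * K1 powr (1 / q) + 1"
  have c: "0 \<le> c" by (simp add: c_def)
  show ?thesis
  proof (intro exI[of _ C] conjI allI impI ballI)
    show "0 < C" using c by (simp add: C_def add_nonneg_pos)
  next
    fix A :: "real ^ 'n \<Rightarrow> complex" and f
    assume A: "C_k (m - 1) A" and lip: "\<forall>\<gamma>. mi_order \<gamma> = m - 1 \<longrightarrow> mi_deriv \<gamma> A \<in> lip_space \<beta>"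
      and f: "f \<in> morrey_space p \<kappa> (\<lambda>x. w x powr p) (\<lambda>x. w x powr q)"
    define L where "L = (\<Sum>\<gamma> | mi_order \<gamma> = m - 1. lip_norm \<beta> (mi_deriv \<gamma> A))"
    have lip': "mi_deriv \<gamma> A \<in> lip_space \<beta>" if "mi_order \<gamma> = m - 1" for \<gamma> using lip that by blast
    have L: "0 \<le> L" unfolding L_def using lip_norm_bound(1)[OF lip'] by (intro sum_nonneg) auto
    have L_ge: "lip_norm \<beta> (mi_deriv \<gamma> A) \<le> L" if "mi_order \<gamma> = m - 1" for \<gamma>
      unfolding L_def using lip_norm_bound(1)[OF lip'] that by (intro member_le_sum) auto
    have Ak: "C_k k A" using A m by simp
    define R where "R = taylor_remainder (Suc k) A"
    have R_bound: "norm (R x y) \<le> c * L * norm (x - y) powr (real k + \<beta>)" for x y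
      unfolding R_def c_def
    proof (rule taylor_remainder_bound[OF Ak L assms(4)])
      fix \<gamma> :: "'n \<Rightarrow> nat" and x y :: "real ^ 'n" assume "mi_order \<gamma> = k"
      then have \<gamma>: "mi_order \<gamma> = m - 1" by (simp add: m)
      have "norm (mi_deriv \<gamma> A x - mi_deriv \<gamma> A y) \<le> lip_norm \<beta> (mi_deriv \<gamma> A) * norm (x - y) powr \<beta>"
        by (rule lip_norm_bound(2)[OF lip'[OF \<gamma>]])
      also have "\<dots> \<le> L * norm (x - y) powr \<beta>" by (intro mult_right_mono L_ge \<gamma>) auto
      finally show "norm (mi_deriv \<gamma> A x - mi_deriv \<gamma> A y) \<le> L * norm (x - y) powr \<beta>" .
    qed
    have R_meas: "(\<lambda>(x, y). R x y) \<in> borel_measurable (borel \<Otimes>\<^sub>M borel)"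
      unfolding R_def by (rule taylor_remainder_measurable[OF Ak])
    have [measurable]: "R x \<in> borel_measurable borel" for x
      using measurable_compose[OF measurable_Pair1' R_meas, of x] by simp
    have [measurable]: "(\<lambda>z. R (fst z) (snd z)) \<in> borel_measurable (borel \<Otimes>\<^sub>M borel)"
      using R_meas by (simp add: case_prod_unfold)
    obtain f0 where f0 [measurable]: "f0 \<in> borel_measurable borel" and f0_ae: "AE x in lborel. f x = f0 x"
      using f completion_ex_borel_measurable_complex[of f lborel] by (auto simp: morrey_space_def)
    define \<phi> where "\<phi> x = ennreal (norm (f0 x))" for x
    have [measurable]: "\<phi> \<in> borel_measurable borel" unfolding \<phi>_def[abs_def] by measurable
    define N where "N = morrey_norm p \<kappa> (\<lambda>x. w x powr p) (\<lambda>x. w x powr q) (\<lambda>x. ennreal (norm (f x)))"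
    have N: "N < top" using f by (auto simp: morrey_space_def N_def)
    have J: "P.J \<phi> (ball a r) \<le> N powe p * ennreal (W.V a r powr \<kappa>)" if r: "0 < r" for a r
    proof -
      have "P.J \<phi> (ball a r) = (\<integral>\<^sup>+x\<in>ball a r. ennreal (norm (f x)) powe p * ennreal (w x powr p) \<partial>lebesgue)"
        unfolding P.J_def nn_integral_completion
      proof (rule nn_integral_cong_AE)
        show "AE x in lborel. \<phi> x powe p * ennreal (u x powr (p / q)) * indicator (ball a r) x =
           ennreal (norm (f x)) powe p * ennreal (w x powr p) * indicator (ball a r) x"
          using f0_ae wp_ae by eventually_elim (simp add: \<phi>_def)
      qed
      also have "\<dots> \<le> N powe p * ennreal (W.V a r powr \<kappa>)"
        unfolding N_def by (rule morrey_norm_ball[OF p r V W.V_pos[OF r]])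
      finally show ?thesis .
    qed
    have T_int: "(\<integral>\<^sup>+x\<in>ball a r. P.T \<phi> x UNIV powe q * ennreal (u x) \<partial>lborel) \<le>
        ennreal K1 * (N powe q * ennreal (W.V a r powr (\<kappa> * q / p)))" if "0 < r" for a r
      by (rule morrey[OF _ J that]) auto
    \<comment> \<open>The Morrey bound makes the weighted integral finite on each ball, and
      positivity of \<open>u\<close> passes this on to the potential; countably many balls exhaust
      the space.\<close>
    have T_fin: "AE x in lborel. P.T \<phi> x UNIV < top"
    proof -
      have "AE x in lborel. x \<in> ball 0 (real (Suc j)) \<longrightarrow> P.T \<phi> x UNIV < top" for j
      proof -
        have "(\<integral>\<^sup>+x\<in>ball 0 (real (Suc j)). P.T \<phi> x UNIV powe q * ennreal (u x) \<partial>lborel) < top"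
          using N by (intro le_less_trans[OF T_int]) (auto simp: ennreal_mult_less_top)
        then have "AE x in lborel. P.T \<phi> x UNIV powe q * ennreal (u x) * indicator (ball 0 (real (Suc j))) x \<noteq> \<infinity>"
          by (intro nn_integral_PInf_AE) auto
        then show ?thesis
        proof eventually_elim
          case (elim x)
          then show ?case using w0_pos[of x]
            by (auto simp: u_def ennreal_mult_eq_top_iff less_top indicator_def simp del: of_nat_Suc split: if_splits)
        qed
      qed
      then have "AE x in lborel. \<forall>j. x \<in> ball 0 (real (Suc j)) \<longrightarrow> P.T \<phi> x UNIV < top"
        by (subst AE_all_countable) auto
      then show ?thesis
      proof eventually_elim
        case (elim x)
        obtain j where "norm x < real j" using reals_Archimedean2 by blast
        then have "x \<in> ball 0 (real (Suc j))" by simp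
        with elim show ?case by blast
      qed
    qed
    \<comment> \<open>For each fixed \<open>x\<close> this differs from the given integrand only on
      a null set of \<open>y\<close>, by reflecting and translating the exceptional set of the
      kernel; it is jointly Borel, as Fubini requires.\<close>
    define G where "G x y = T_kernel \<Omega>0 \<alpha> m A x y * f0 y" for x y
    have G_ae: "AE y in lborel. T_kernel \<Omega> \<alpha> m A x y * f y = G x y" for x
      using AE_lborel_reflect[OF \<Omega>0_ae, of x] f0_ae
      by eventually_elim (simp add: G_def T_kernel_def)
    have G_meas: "(\<lambda>(x, y). G x y) \<in> borel_measurable (borel \<Otimes>\<^sub>M borel)"
      unfolding G_def T_kernel_def m R_def[symmetric] case_prod_unfold by measurable
    have [measurable]: "G x \<in> borel_measurable borel" for x
      using measurable_compose[OF measurable_Pair1' G_meas, of x] by simp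
    have G_bound: "ennreal (norm (G x y)) \<le> ennreal (c * L) * (ennreal (P.k (x - y)) * \<phi> y)" for x y
    proof -
      have "norm (G x y) \<le> c * L * (norm (\<Omega>0 (x - y)) * norm (x - y) powr (?d - ?n)) * norm (f0 y)"
        unfolding G_def m norm_mult using R_bound[of x y, unfolded R_def]
        by (intro mult_right_mono T_kernel_bound) auto
      then have "ennreal (norm (G x y)) \<le> ennreal (c * L * P.k (x - y) * norm (f0 y))"
        by (intro ennreal_leI) (simp add: P.k_def)
      also have "\<dots> = ennreal (c * L) * (ennreal (P.k (x - y)) * \<phi> y)"
        using c L P.k_nonneg[of "x - y"] by (simp add: \<phi>_def ennreal_mult mult.assoc)
      finally show ?thesis .
    qed
    have G_int: "(\<integral>\<^sup>+y. ennreal (norm (G x y)) \<partial>lborel) \<le> ennreal (c * L) * P.T \<phi> x UNIV" for x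
    proof -
      have "(\<integral>\<^sup>+y. ennreal (norm (G x y)) \<partial>lborel) \<le> (\<integral>\<^sup>+y. ennreal (c * L) * (ennreal (P.k (x - y)) * \<phi> y) \<partial>lborel)"
        by (intro nn_integral_mono G_bound)
      also have "\<dots> = ennreal (c * L) * P.T \<phi> x UNIV"
        unfolding P.T_def by (subst nn_integral_cmult) auto
      finally show ?thesis .
    qed
    have T_eq: "T_op \<Omega> \<alpha> m A f x = (LINT y|lborel. G x y)" for x
      unfolding T_op_def by (rule integral_completion_AE(1)[OF _ G_ae]) simp
    have integrable_iff: "integrable lebesgue (\<lambda>y. T_kernel \<Omega> \<alpha> m A x y * f y) \<longleftrightarrow> integrable lborel (G x)" for x
      by (rule integral_completion_AE(2)[OF _ G_ae]) simp
    have T_bound: "ennreal (norm (T_op \<Omega> \<alpha> m A f x)) \<le> ennreal (c * L) * P.T \<phi> x UNIV" for x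
    proof (cases "integrable lborel (G x)")
      case True
      then have "ennreal (norm (T_op \<Omega> \<alpha> m A f x)) \<le> (\<integral>\<^sup>+y. ennreal (norm (G x y)) \<partial>lborel)"
        unfolding T_eq by (rule integral_norm_bound_ennreal)
      then show ?thesis using G_int[of x] by simp
    \<comment> \<open>Where the integral diverges, \<open>T_op\<close> is 0 by convention, so the
      bound holds at every \<open>x\<close>.\<close>
    qed (simp add: T_eq not_integrable_integral_eq)
    show "AE x in lebesgue. integrable lebesgue (\<lambda>y. T_kernel \<Omega> \<alpha> m A x y * f y)"
      unfolding integrable_iff
    proof (rule AE_completion, use T_fin in eventually_elim)
      case (elim x)
      have "(\<integral>\<^sup>+y. ennreal (norm (G x y)) \<partial>lborel) < \<infinity>"
        using elim by (intro le_less_trans[OF G_int]) (auto simp: ennreal_mult_less_top)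
      then show ?case by (intro integrableI_bounded) auto
    qed
    show "T_op \<Omega> \<alpha> m A f \<in> borel_measurable lebesgue"
    proof -
      have "(\<lambda>x. LINT y|lborel. G x y) \<in> borel_measurable borel"
        using G_meas by (intro lborel.borel_measurable_lebesgue_integral) simp
      then show ?thesis unfolding T_eq[abs_def] by (intro measurable_completion) simp
    qed
    define e where "e = ?n - \<alpha> + real m - 1"
    \<comment> \<open>The sign matters twice: it makes the factor \<open>1 / r powr e\<close>
      decreasing in \<open>r\<close>, and on \<open>ball x r\<close> it bounds this factor by the
      same power of the distance to \<open>x\<close>.\<close>
    have e: "0 \<le> e" using assms(1,3) by (simp add: e_def m)
    define H where "H x y = ennreal (norm (\<Omega>0 (x - y) * R x y * f0 y))" for x y
    have H_meas: "(\<lambda>(x, y). H x y) \<in> borel_measurable (borel \<Otimes>\<^sub>M borel)"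
      unfolding H_def case_prod_unfold by measurable
    have M_eq: "M_op \<Omega> \<alpha> m A f x = (SUP r\<in>{0<..}. ennreal (1 / r powr e) * (\<integral>\<^sup>+y\<in>ball x r. H x y \<partial>lborel))" for x
    proof -
      have ae: "AE y in lborel. ennreal (norm (\<Omega> (x - y) * taylor_remainder m A x y * f y)) = H x y"
        using AE_lborel_reflect[OF \<Omega>0_ae, of x] f0_ae
        by eventually_elim (simp add: H_def R_def m)
      have "(\<integral>\<^sup>+y\<in>ball x r. ennreal (norm (\<Omega> (x - y) * taylor_remainder m A x y * f y)) \<partial>lebesgue) =
          (\<integral>\<^sup>+y\<in>ball x r. H x y \<partial>lborel)" for r
        unfolding nn_integral_completion by (rule nn_integral_cong_AE, use ae in eventually_elim) simp
      then show ?thesis by (simp add: M_op_def e_def)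
    qed
    show "M_op \<Omega> \<alpha> m A f \<in> borel_measurable lebesgue"
      unfolding M_eq[abs_def] by (intro measurable_completion) (use measurable_SUP_radius[OF H_meas e] in simp)
    have M_bound: "M_op \<Omega> \<alpha> m A f x \<le> ennreal (c * L) * P.T \<phi> x UNIV" for x
      unfolding M_eq
    proof (rule SUP_least)
      fix r :: real assume "r \<in> {0<..}"
      then have r: "0 < r" by simp
      have "ennreal (1 / r powr e) * (\<integral>\<^sup>+y\<in>ball x r. H x y \<partial>lborel) = (\<integral>\<^sup>+y\<in>ball x r. ennreal (1 / r powr e) * H x y \<partial>lborel)"
        using H_meas measurable_compose[OF measurable_Pair1' H_meas, of x]
        by (subst nn_integral_cmult[symmetric]) (auto simp: mult.assoc)
      also have "\<dots> \<le> (\<integral>\<^sup>+y. ennreal (norm (G x y)) \<partial>lborel)"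
      proof (rule nn_integral_mono)
        fix y
        show "ennreal (1 / r powr e) * H x y * indicator (ball x r) y \<le> ennreal (norm (G x y))"
        proof (cases "y \<in> ball x r \<and> x \<noteq> y")
          case True
          then have xy: "0 < norm (x - y)" "norm (x - y) \<le> r" by (auto simp: dist_norm)
          then have "norm (x - y) powr e \<le> r powr e" using e by (intro powr_mono2) auto
          then have "1 / r powr e \<le> 1 / norm (x - y) powr e"
            using xy r by (intro divide_left_mono) auto
          then have "1 / r powr e * norm (\<Omega>0 (x - y) * R x y * f0 y) \<le>
              1 / norm (x - y) powr e * norm (\<Omega>0 (x - y) * R x y * f0 y)"
            by (rule mult_right_mono) simp
          also have "\<dots> = norm (G x y)"
            by (simp add: G_def T_kernel_def R_def m e_def norm_mult norm_divide)
          finally show ?thesis using True by (simp add: H_def ennreal_leI flip: ennreal_mult)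
        next
          \<comment> \<open>On the diagonal the kernel in \<open>G\<close> is 0 by division by zero,
            but \<open>H\<close> vanishes there as well, since the remainder does.\<close>
          case False
          then show ?thesis
            by (auto simp: H_def R_def taylor_remainder_same)
        qed
      qed
      also have "\<dots> \<le> ennreal (c * L) * P.T \<phi> x UNIV" by (rule G_int)
      finally show "ennreal (1 / r powr e) * (\<integral>\<^sup>+y\<in>ball x r. H x y \<partial>lborel) \<le> ennreal (c * L) * P.T \<phi> x UNIV" .
    qed
    \<comment> \<open>Stated for any \<open>F\<close> below the common majorant, so that it serves
      both operators.\<close>
    have norm_bound: "morrey_norm q (\<kappa> * q / p) (\<lambda>x. w x powr q) (\<lambda>x. w x powr q) F \<le> ennreal (C * L) * N"
      if F: "\<And>x. F x \<le> ennreal (c * L) * P.T \<phi> x UNIV" for F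
    proof (rule morrey_norm_leI[OF q_pos])
      fix a :: "real ^ 'n" and r :: real assume r: "0 < r"
      have "(\<integral>\<^sup>+x\<in>ball a r. F x powe q * ennreal (w x powr q) \<partial>lebesgue) \<le>
          (\<integral>\<^sup>+x. ennreal ((c * L) powr q) * (P.T \<phi> x UNIV powe q * ennreal (u x) * indicator (ball a r) x) \<partial>lborel)"
        unfolding nn_integral_completion
      proof (rule nn_integral_mono_AE, use wq_ae in eventually_elim)
        case (elim x)
        have "F x powe q \<le> (ennreal (c * L) * P.T \<phi> x UNIV) powe q"
          using q_pos by (intro powe_mono F) auto
        also have "\<dots> = ennreal ((c * L) powr q) * P.T \<phi> x UNIV powe q"
          using c L by (simp add: powe_mult)
        finally have "F x powe q * (ennreal (u x) * indicator (ball a r) x) \<le>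
            ennreal ((c * L) powr q) * P.T \<phi> x UNIV powe q * (ennreal (u x) * indicator (ball a r) x)"
          by (rule mult_right_mono) simp
        then show ?case by (simp add: elim mult.assoc)
      qed
      also have "\<dots> = ennreal ((c * L) powr q) * (\<integral>\<^sup>+x\<in>ball a r. P.T \<phi> x UNIV powe q * ennreal (u x) \<partial>lborel)"
        by (rule nn_integral_cmult) measurable
      also have "\<dots> \<le> ennreal ((c * L) powr q) * (ennreal K1 * (N powe q * ennreal (W.V a r powr (\<kappa> * q / p))))"
        by (intro mult_left_mono T_int r) auto
      also have "\<dots> = ennreal ((c * K1 powr (1 / q) * L) powr q) * (N powe q * ennreal (W.V a r powr (\<kappa> * q / p)))"
        using K1 c L q_pos by (simp add: powr_mult powr_powr ennreal_mult ac_simps)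
      also have "\<dots> \<le> ennreal ((C * L) powr q) * (N powe q * ennreal (W.V a r powr (\<kappa> * q / p)))"
        using c L q_pos by (intro mult_right_mono ennreal_leI powr_mono2) (auto simp: C_def)
      also have "\<dots> = (ennreal (C * L) * N) powe q * (\<integral>\<^sup>+x\<in>ball a r. ennreal (w x powr q) \<partial>lebesgue) powe (\<kappa> * q / p)"
        using c L by (simp add: V powe_mult C_def mult.assoc)
      finally show "(\<integral>\<^sup>+x\<in>ball a r. F x powe q * ennreal (w x powr q) \<partial>lebesgue) \<le>
          (ennreal (C * L) * N) powe q * (\<integral>\<^sup>+x\<in>ball a r. ennreal (w x powr q) \<partial>lebesgue) powe (\<kappa> * q / p)" .
    qed
    show "morrey_norm q (\<kappa> * q / p) (\<lambda>x. w x powr q) (\<lambda>x. w x powr q) (\<lambda>x. ennreal (norm (T_op \<Omega> \<alpha> m A f x)))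
      \<le> ennreal (C * (\<Sum>\<gamma> | mi_order \<gamma> = m - 1. lip_norm \<beta> (mi_deriv \<gamma> A))) *
        morrey_norm p \<kappa> (\<lambda>x. w x powr p) (\<lambda>x. w x powr q) (\<lambda>x. ennreal (norm (f x)))"
      unfolding L_def[symmetric] N_def[symmetric] by (rule norm_bound[OF T_bound])
    show "morrey_norm q (\<kappa> * q / p) (\<lambda>x. w x powr q) (\<lambda>x. w x powr q) (M_op \<Omega> \<alpha> m A f)
      \<le> ennreal (C * (\<Sum>\<gamma> | mi_order \<gamma> = m - 1. lip_norm \<beta> (mi_deriv \<gamma> A))) *
        morrey_norm p \<kappa> (\<lambda>x. w x powr p) (\<lambda>x. w x powr q) (\<lambda>x. ennreal (norm (f x)))"
      unfolding L_def[symmetric] N_def[symmetric] by (rule norm_bound[OF M_bound])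
  qed
qed

end
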